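(* Suppose that the ground ring $\mathbb{K}$ is a field and that $I=\{1,2\}$. Let $(P(B)^C,(J_i)_{i\in I})$ be a regular locally cleft $C$-coalgebra Galois extension, with cleaving maps $\gamma_i:C\to P_i$. Assume that $$\gamma_2(C)\ker(\pi^2_1)=\ker(\pi^2_1)\gamma_2(C)$$ as subsets of $P_2$. Then $P(B)^C$ is a $C$-coalgebra Galois extension.
   Context: $\mathbb{K}$ is such that $2\neq 0$, $3\neq 0$ in $\mathbb{K}$, and every $\mathbb{K}$-module $M$ considered satisfies $2M=M$, $3M=M$. Algebras are unital associative and coalgebras counital coassociative over $\mathbb{K}$; $\otimes=\otimes_{\mathbb K}$; ideals are two-sided. Sweedler notation: $\rho^C(p)=p_{(0)}\otimes p_{(1)}$. Products of subspaces denote the image of multiplication (linear span of products). Coinvariants: for an algebra $P$ that is also a right $C$-comodule, $P^{\mathrm{co}\,C}=\{b\in P\mid \rho^C(bp)=b\rho^C(p)\ \forall p\in P\}$. With $B=P^{\mathrm{co}\,C}$, $P(B)^C$ is a $C$-coalgebra Galois extension if $\mathrm{can}^C_P:P\otimes_BP\to P\otimes C$, $p\otimes_Bp'\mapsto pp'_{(0)}\otimes p'_{(1)}$ is bijective. A cleaving map is a right $C$-colinear, convolution invertible map $\gamma:C\to P$ (inverse $\gamma^{-1}$); a $C$-coalgebra Galois extension admitting a cleaving map is called cleft. A cover of an algebra and right $C$-comodule $P$ is a finite family $(J_i)_{i\in I}$ of ideals which are right $C$-subcomodules with $\bigcap_iJ_i=\{0\}$; it is complete if $P\to\{(p_i)_i\in\bigoplus_iP/J_i\mid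 p_i,p_j \text{ have equal images in } P/(J_i+J_j)\ \forall i,j\}$, $p\mapsto(p+J_i)_i$, is surjective. Locally $C$-coalgebra Galois extension: a pair $(P(B)^C,(J_i)_{i\in I})$ with $P$ an algebra and right $C$-comodule, $B=P^{\mathrm{co}\,C}$, $(J_i)$ a complete cover of $P$ by ideals which are right $C$-subcomodules, such that, writing $\chi_i:P\to P_i=P/J_i$ and $\chi_{ij}:P\to P_{ij}=P/(J_i+J_j)$ for the canonical surjections, $\chi_i(B)=P_i^{\mathrm{co}\,C}$, $P_i(\chi_i(B))^C$ is a $C$-coalgebra Galois extension, and $\chi_{ij}(B)=P_{ij}^{\mathrm{co}\,C}$ for all $i,j$. It is locally cleft if every $P_i$ is a cleft $C$-coalgebra Galois extension; $\gamma_i:C\to P_i$ denotes a chosen cleaving map. Put $B_i=B/(B\cap J_i)$, identified with $\chi_i(B)\subseteq P_i$, $B_{ij}=B/((B\cap J_i)+(B\cap J_j))$, and let $\pi^i_j:B_i\to B_{ij}$ be the canonical surjection. A locally cleft extension is regular if, for all $i\in I$, the element $1_{(0)}\gamma_i^{-1}(1_{(1)})$ (with $1=1_{P_i}$) has a right inverse in $B_i$. *)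

theory Defs
  imports "HOL-Algebra.Algebra"
begin

section \<open>Tensor products\<close>

text \<open>An element of a tensor product is a coset in the free abelian group on pairs.\<close>

type_synonym ('v, 'w) tens = "(('v \<times> 'w) \<Rightarrow>\<^sub>0 int) set"

text \<open>Relations of the tensor product of a right \<open>S\<close>-module \<open>V\<close> with action \<open>r\<close> and a left
  \<open>S\<close>-module \<open>W\<close> with action \<open>l\<close>. The ring \<open>S\<close> need not be commutative.\<close>

definition bal_rels :: "('v, 'm) ring_scheme \<Rightarrow> ('w, 'n) ring_scheme \<Rightarrow> 's set \<Rightarrow>
    ('v \<Rightarrow> 's \<Rightarrow> 'v) \<Rightarrow> ('s \<Rightarrow> 'w \<Rightarrow> 'w) \<Rightarrow> (('v \<times> 'w) \<Rightarrow>\<^sub>0 int) set" where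
  "bal_rels V W S r l =
     {frag_of (v \<oplus>\<^bsub>V\<^esub> v', w) - frag_of (v, w) - frag_of (v', w) | v v' w.
        v \<in> carrier V \<and> v' \<in> carrier V \<and> w \<in> carrier W} \<union>
     {frag_of (v, w \<oplus>\<^bsub>W\<^esub> w') - frag_of (v, w) - frag_of (v, w') | v w w'.
        v \<in> carrier V \<and> w \<in> carrier W \<and> w' \<in> carrier W} \<union>
     {frag_of (r v s, w) - frag_of (v, l s w) | v s w.
        v \<in> carrier V \<and> s \<in> S \<and> w \<in> carrier W}"

definition bal_subgroup :: "('v, 'm) ring_scheme \<Rightarrow> ('w, 'n) ring_scheme \<Rightarrow> 's set \<Rightarrow>
    ('v \<Rightarrow> 's \<Rightarrow> 'v) \<Rightarrow> ('s \<Rightarrow> 'w \<Rightarrow> 'w) \<Rightarrow> (('v \<times> 'w) \<Rightarrow>\<^sub>0 int) set" where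
  "bal_subgroup V W S r l =
     generate (free_Abelian_group (carrier V \<times> carrier W)) (bal_rels V W S r l)"

text \<open>Tensor products are only additive groups; the multiplicative fields of the records are
  unused.\<close>

definition bal_tensor :: "('v, 'm) ring_scheme \<Rightarrow> ('w, 'n) ring_scheme \<Rightarrow> 's set \<Rightarrow>
    ('v \<Rightarrow> 's \<Rightarrow> 'v) \<Rightarrow> ('s \<Rightarrow> 'w \<Rightarrow> 'w) \<Rightarrow> ('v, 'w) tens ring" where
  "bal_tensor V W S r l =
    (let G = free_Abelian_group (carrier V \<times> carrier W) Mod bal_subgroup V W S r l
     in \<lparr>carrier = carrier G, monoid.mult = undefined, one = undefined,
         ring.zero = one G, ring.add = monoid.mult G\<rparr>)"

definition bal_pure :: "('v, 'm) ring_scheme \<Rightarrow> ('w, 'n) ring_scheme \<Rightarrow> 's set \<Rightarrow>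
    ('v \<Rightarrow> 's \<Rightarrow> 'v) \<Rightarrow> ('s \<Rightarrow> 'w \<Rightarrow> 'w) \<Rightarrow> 'v \<Rightarrow> 'w \<Rightarrow> ('v, 'w) tens" where
  "bal_pure V W S r l v w =
     bal_subgroup V W S r l #>\<^bsub>free_Abelian_group (carrier V \<times> carrier W)\<^esub> frag_of (v, w)"

text \<open>The additive map from a tensor product to \<open>A\<close> with \<open>v \<otimes> w \<mapsto> f v w\<close>, for a biadditive
  balanced map \<open>f\<close>. Formulas in Sweedler notation are instances of it: with
  \<open>\<Delta> c = c\<^sub>1 \<otimes> c\<^sub>2\<close>, the expression \<open>f c\<^sub>1 c\<^sub>2\<close> is \<open>tensor_lift A f (\<Delta> c)\<close>.\<close>

definition tensor_lift :: "('a, 'm) ring_scheme \<Rightarrow> ('v \<Rightarrow> 'w \<Rightarrow> 'a) \<Rightarrow> ('v, 'w) tens \<Rightarrow> 'a" where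
  "tensor_lift A f t =
     the_elem ((\<lambda>u. \<Oplus>\<^bsub>A\<^esub>x\<in>Poly_Mapping.keys u.
                  [Poly_Mapping.lookup u x] \<cdot>\<^bsub>A\<^esub> f (fst x) (snd x)) ` t)"

definition tensor_pure :: "('k, 'r) ring_scheme \<Rightarrow> ('k, 'v, 'm) module_scheme \<Rightarrow>
    ('k, 'w, 'n) module_scheme \<Rightarrow> 'v \<Rightarrow> 'w \<Rightarrow> ('v, 'w) tens" where
  "tensor_pure K V W = bal_pure V W (carrier K) (\<lambda>v a. a \<odot>\<^bsub>V\<^esub> v) (\<lambda>a w. a \<odot>\<^bsub>W\<^esub> w)"

definition tensor :: "('k, 'r) ring_scheme \<Rightarrow> ('k, 'v, 'm) module_scheme \<Rightarrow>
    ('k, 'w, 'n) module_scheme \<Rightarrow> ('k, ('v, 'w) tens) module" where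
  "tensor K V W =
    (let T = bal_tensor V W (carrier K) (\<lambda>v a. a \<odot>\<^bsub>V\<^esub> v) (\<lambda>a w. a \<odot>\<^bsub>W\<^esub> w)
     in \<lparr>carrier = carrier T, monoid.mult = undefined, one = undefined,
         ring.zero = ring.zero T, ring.add = ring.add T,
         smult = (\<lambda>a. tensor_lift T (\<lambda>v w. tensor_pure K V W (a \<odot>\<^bsub>V\<^esub> v) w))\<rparr>)"

text \<open>\<open>P \<otimes>\<^sub>B P\<close> for a subring \<open>B\<close> of \<open>P\<close>.\<close>

definition tensor_over :: "('p, 'm) ring_scheme \<Rightarrow> 'p set \<Rightarrow> ('p, 'p) tens ring" where
  "tensor_over P B = bal_tensor P P B (monoid.mult P) (monoid.mult P)"

definition tensor_map :: "('k, 'r) ring_scheme \<Rightarrow> ('k, 'v, 'm) module_scheme \<Rightarrow>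
    ('k, 'w, 'n) module_scheme \<Rightarrow> ('a \<Rightarrow> 'v) \<Rightarrow> ('b \<Rightarrow> 'w) \<Rightarrow> ('a, 'b) tens \<Rightarrow> ('v, 'w) tens" where
  "tensor_map K V W f g =
     tensor_lift (tensor K V W) (\<lambda>a b. tensor_pure K V W (f a) (g b))"

text \<open>The associativity isomorphism \<open>(U \<otimes> V) \<otimes> W \<rightarrow> U \<otimes> (V \<otimes> W)\<close>.\<close>

definition tensor_assoc :: "('k, 'r) ring_scheme \<Rightarrow> ('k, 'u, 'l) module_scheme \<Rightarrow>
    ('k, 'v, 'm) module_scheme \<Rightarrow> ('k, 'w, 'n) module_scheme \<Rightarrow>
    (('u, 'v) tens, 'w) tens \<Rightarrow> ('u, ('v, 'w) tens) tens" where
  "tensor_assoc K U V W =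
    (let VW = tensor K V W; T = tensor K U VW
     in tensor_lift T (\<lambda>t w. tensor_lift T
          (\<lambda>u v. tensor_pure K U VW u (tensor_pure K V W v w)) t))"


section \<open>Algebras, coalgebras and comodules\<close>

definition linear_maps :: "('k, 'r) ring_scheme \<Rightarrow> ('k, 'v, 'm) module_scheme \<Rightarrow>
    ('k, 'w, 'n) module_scheme \<Rightarrow> ('v \<Rightarrow> 'w) set" where
  "linear_maps K V W = {f \<in> carrier V \<rightarrow> carrier W.
     (\<forall>x\<in>carrier V. \<forall>y\<in>carrier V. f (x \<oplus>\<^bsub>V\<^esub> y) = f x \<oplus>\<^bsub>W\<^esub> f y) \<and>
     (\<forall>a\<in>carrier K. \<forall>x\<in>carrier V. f (a \<odot>\<^bsub>V\<^esub> x) = a \<odot>\<^bsub>W\<^esub> f x)}"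

text \<open>Unlike \<^locale>\<open>algebra\<close>, the algebra need not be commutative.\<close>

locale assoc_algebra = module K A + ring A for K (structure) and A (structure) +
  assumes smult_mult_left: "\<lbrakk>a \<in> carrier K; x \<in> carrier A; y \<in> carrier A\<rbrakk> \<Longrightarrow>
      (a \<odot>\<^bsub>A\<^esub> x) \<otimes>\<^bsub>A\<^esub> y = a \<odot>\<^bsub>A\<^esub> (x \<otimes>\<^bsub>A\<^esub> y)"
    and smult_mult_right: "\<lbrakk>a \<in> carrier K; x \<in> carrier A; y \<in> carrier A\<rbrakk> \<Longrightarrow>
      x \<otimes>\<^bsub>A\<^esub> (a \<odot>\<^bsub>A\<^esub> y) = a \<odot>\<^bsub>A\<^esub> (x \<otimes>\<^bsub>A\<^esub> y)"

record ('k, 'c) coalg = "('k, 'c) module" +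
  comult :: "'c \<Rightarrow> ('c, 'c) tens"
  counit :: "'c \<Rightarrow> 'k"

locale coalgebra = C: module K C
  for K :: "('k, 'r) ring_scheme" (structure) and C :: "('k, 'c, 's) coalg_scheme" (structure) +
  assumes comult_linear: "comult C \<in> linear_maps K C (tensor K C C)"
    and counit_closed: "c \<in> carrier C \<Longrightarrow> counit C c \<in> carrier K"
    and counit_add: "\<lbrakk>c \<in> carrier C; d \<in> carrier C\<rbrakk> \<Longrightarrow>
      counit C (c \<oplus>\<^bsub>C\<^esub> d) = counit C c \<oplus>\<^bsub>K\<^esub> counit C d"
    and counit_smult: "\<lbrakk>a \<in> carrier K; c \<in> carrier C\<rbrakk> \<Longrightarrow>
      counit C (a \<odot>\<^bsub>C\<^esub> c) = a \<otimes>\<^bsub>K\<^esub> counit C c"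
    and coassoc: "c \<in> carrier C \<Longrightarrow>
      tensor_assoc K C C C (tensor_map K (tensor K C C) C (comult C) (\<lambda>d. d) (comult C c)) =
      tensor_map K C (tensor K C C) (\<lambda>d. d) (comult C) (comult C c)"
    and counit_left: "c \<in> carrier C \<Longrightarrow>
      tensor_lift C (\<lambda>x y. counit C x \<odot>\<^bsub>C\<^esub> y) (comult C c) = c"
    and counit_right: "c \<in> carrier C \<Longrightarrow>
      tensor_lift C (\<lambda>x y. counit C y \<odot>\<^bsub>C\<^esub> x) (comult C c) = c"

locale right_comodule = coalgebra K C + V: module K V
  for K :: "('k, 'r) ring_scheme" (structure) and C :: "('k, 'c, 's) coalg_scheme" (structure)
    and V :: "('k, 'v, 'm) module_scheme" (structure) +
  fixes \<rho> :: "'v \<Rightarrow> ('v, 'c) tens"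
  assumes coact_linear: "\<rho> \<in> linear_maps K V (tensor K V C)"
    and coact_coassoc: "v \<in> carrier V \<Longrightarrow>
      tensor_assoc K V C C (tensor_map K (tensor K V C) C \<rho> (\<lambda>c. c) (\<rho> v)) =
      tensor_map K V (tensor K C C) (\<lambda>w. w) (comult C) (\<rho> v)"
    and coact_counit: "v \<in> carrier V \<Longrightarrow>
      tensor_lift V (\<lambda>w c. counit C c \<odot>\<^bsub>V\<^esub> w) (\<rho> v) = v"

record ('k, 'p, 'c) comod_alg = "('k, 'p) module" +
  coact :: "'p \<Rightarrow> ('p, 'c) tens"

text \<open>No compatibility between product and coaction is required.\<close>

locale comodule_algebra = A: assoc_algebra K P + right_comodule K C P "coact P"
  for K :: "('k, 'r) ring_scheme" (structure) and C :: "('k, 'c, 's) coalg_scheme" (structure)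
    and P :: "('k, 'p, 'c, 't) comod_alg_scheme" (structure)

definition colinear :: "('k, 'r) ring_scheme \<Rightarrow> ('k, 'c, 's) coalg_scheme \<Rightarrow>
    ('k, 'v, 'm) module_scheme \<Rightarrow> ('v \<Rightarrow> ('v, 'c) tens) \<Rightarrow>
    ('k, 'w, 'n) module_scheme \<Rightarrow> ('w \<Rightarrow> ('w, 'c) tens) \<Rightarrow> ('v \<Rightarrow> 'w) \<Rightarrow> bool" where
  "colinear K C V \<rho> W \<sigma> f \<longleftrightarrow> f \<in> linear_maps K V W \<and>
     (\<forall>v\<in>carrier V. \<sigma> (f v) = tensor_map K W C f (\<lambda>c. c) (\<rho> v))"

text \<open>The image of \<open>H \<otimes> C\<close> in \<open>V \<otimes> C\<close> is the additive span of the \<open>h \<otimes> c\<close>.\<close>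

definition subcomodule :: "('k, 'r) ring_scheme \<Rightarrow> ('k, 'c, 's) coalg_scheme \<Rightarrow>
    ('k, 'v, 'm) module_scheme \<Rightarrow> ('v \<Rightarrow> ('v, 'c) tens) \<Rightarrow> 'v set \<Rightarrow> bool" where
  "subcomodule K C V \<rho> H \<longleftrightarrow> submodule H K V \<and>
     \<rho> ` H \<subseteq> generate (add_monoid (tensor K V C))
               {tensor_pure K V C h c | h c. h \<in> H \<and> c \<in> carrier C}"

text \<open>Left multiplication \<open>b \<cdot> (p \<otimes> c) = b p \<otimes> c\<close> on \<open>P \<otimes> C\<close>.\<close>

definition left_act :: "('k, 'r) ring_scheme \<Rightarrow> ('k, 'c, 's) coalg_scheme \<Rightarrow>
    ('k, 'p, 'm) module_scheme \<Rightarrow> 'p \<Rightarrow> ('p, 'c) tens \<Rightarrow> ('p, 'c) tens" where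
  "left_act K C P b = tensor_map K P C (\<lambda>p. b \<otimes>\<^bsub>P\<^esub> p) (\<lambda>c. c)"

definition coinvariants :: "('k, 'r) ring_scheme \<Rightarrow> ('k, 'c, 's) coalg_scheme \<Rightarrow>
    ('k, 'p, 'c, 't) comod_alg_scheme \<Rightarrow> 'p set" where
  "coinvariants K C P = {b \<in> carrier P.
     \<forall>p\<in>carrier P. coact P (b \<otimes>\<^bsub>P\<^esub> p) = left_act K C P b (coact P p)}"


section \<open>Coalgebra Galois extensions\<close>

definition can_map :: "('k, 'r) ring_scheme \<Rightarrow> ('k, 'c, 's) coalg_scheme \<Rightarrow>
    ('k, 'p, 'c, 't) comod_alg_scheme \<Rightarrow> ('p, 'p) tens \<Rightarrow> ('p, 'c) tens" where
  "can_map K C P = tensor_lift (tensor K P C) (\<lambda>p p'. left_act K C P p (coact P p'))"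

definition coalgebra_galois :: "('k, 'r) ring_scheme \<Rightarrow> ('k, 'c, 's) coalg_scheme \<Rightarrow>
    ('k, 'p, 'c, 't) comod_alg_scheme \<Rightarrow> 'p set \<Rightarrow> bool" where
  "coalgebra_galois K C P B \<longleftrightarrow> comodule_algebra K C P \<and> B = coinvariants K C P \<and>
     bij_betw (can_map K C P) (carrier (tensor_over P B)) (carrier (tensor K P C))"

definition convolution :: "('k, 'c, 's) coalg_scheme \<Rightarrow> ('p, 'm) ring_scheme \<Rightarrow>
    ('c \<Rightarrow> 'p) \<Rightarrow> ('c \<Rightarrow> 'p) \<Rightarrow> 'c \<Rightarrow> 'p" where
  "convolution C A f g c = tensor_lift A (\<lambda>x y. f x \<otimes>\<^bsub>A\<^esub> g y) (comult C c)"

definition is_conv_inverse :: "('k, 'r) ring_scheme \<Rightarrow> ('k, 'c, 's) coalg_scheme \<Rightarrow>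
    ('k, 'p, 'm) module_scheme \<Rightarrow> ('c \<Rightarrow> 'p) \<Rightarrow> ('c \<Rightarrow> 'p) \<Rightarrow> bool" where
  "is_conv_inverse K C A f g \<longleftrightarrow> g \<in> linear_maps K C A \<and>
     (\<forall>c\<in>carrier C. convolution C A f g c = counit C c \<odot>\<^bsub>A\<^esub> \<one>\<^bsub>A\<^esub> \<and>
                    convolution C A g f c = counit C c \<odot>\<^bsub>A\<^esub> \<one>\<^bsub>A\<^esub>)"

text \<open>The convolution inverse is determined on the carrier of \<open>C\<close> only, hence the choice.\<close>

definition conv_inverse :: "('k, 'r) ring_scheme \<Rightarrow> ('k, 'c, 's) coalg_scheme \<Rightarrow>
    ('k, 'p, 'm) module_scheme \<Rightarrow> ('c \<Rightarrow> 'p) \<Rightarrow> 'c \<Rightarrow> 'p" where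
  "conv_inverse K C A f = (SOME g. is_conv_inverse K C A f g)"

definition cleaving_map :: "('k, 'r) ring_scheme \<Rightarrow> ('k, 'c, 's) coalg_scheme \<Rightarrow>
    ('k, 'p, 'c, 't) comod_alg_scheme \<Rightarrow> ('c \<Rightarrow> 'p) \<Rightarrow> bool" where
  "cleaving_map K C P \<gamma> \<longleftrightarrow> colinear K C C (comult C) P (coact P) \<gamma> \<and>
     (\<exists>g. is_conv_inverse K C P \<gamma> g)"


section \<open>Quotients and covers\<close>

definition quot_module :: "('k, 'v, 'm) module_scheme \<Rightarrow> 'v set \<Rightarrow> ('k, 'v set) module" where
  "quot_module V J = ring.extend (V Quot J)
     (module.fields (\<lambda>a Y. \<Union>x\<in>Y. J +>\<^bsub>V\<^esub> (a \<odot>\<^bsub>V\<^esub> x)))"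

text \<open>The coaction on \<open>P/J\<close> is the one induced by \<open>p \<mapsto> (\<chi> \<otimes> id) (\<rho> p)\<close>, where \<open>\<chi>\<close> is the
  canonical surjection.\<close>

definition quot_alg :: "('k, 'r) ring_scheme \<Rightarrow> ('k, 'c, 's) coalg_scheme \<Rightarrow>
    ('k, 'p, 'c, 't) comod_alg_scheme \<Rightarrow> 'p set \<Rightarrow> ('k, 'p set, 'c) comod_alg" where
  "quot_alg K C P J = module.extend (quot_module P J)
     (comod_alg.fields (\<lambda>Y. the_elem
        ((\<lambda>p. tensor_map K (quot_module P J) C (\<lambda>q. J +>\<^bsub>P\<^esub> q) (\<lambda>c. c) (coact P p)) ` Y)))"

text \<open>The canonical surjection \<open>R/M \<rightarrow> R/N\<close> for \<open>M \<subseteq> N\<close>, sending \<open>M + x\<close> to \<open>N + x\<close>.\<close>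

definition coset_proj :: "('p, 'm) ring_scheme \<Rightarrow> 'p set \<Rightarrow> 'p set \<Rightarrow> 'p set" where
  "coset_proj R N Y = the_elem ((\<lambda>x. N +>\<^bsub>R\<^esub> x) ` Y)"

definition cover :: "('k, 'r) ring_scheme \<Rightarrow> ('k, 'c, 's) coalg_scheme \<Rightarrow>
    ('k, 'p, 'c, 't) comod_alg_scheme \<Rightarrow> 'i set \<Rightarrow> ('i \<Rightarrow> 'p set) \<Rightarrow> bool" where
  "cover K C P I J \<longleftrightarrow> finite I \<and>
     (\<forall>i\<in>I. ideal (J i) P \<and> subcomodule K C P (coact P) (J i)) \<and>
     carrier P \<inter> (\<Inter>i\<in>I. J i) = {\<zero>\<^bsub>P\<^esub>}"

definition complete_cover :: "('k, 'r) ring_scheme \<Rightarrow> ('k, 'c, 's) coalg_scheme \<Rightarrow>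
    ('k, 'p, 'c, 't) comod_alg_scheme \<Rightarrow> 'i set \<Rightarrow> ('i \<Rightarrow> 'p set) \<Rightarrow> bool" where
  "complete_cover K C P I J \<longleftrightarrow> cover K C P I J \<and>
     (\<forall>x. (\<forall>i\<in>I. x i \<in> carrier (quot_alg K C P (J i))) \<and>
          (\<forall>i\<in>I. \<forall>j\<in>I. coset_proj P (J i <+>\<^bsub>P\<^esub> J j) (x i) =
                        coset_proj P (J i <+>\<^bsub>P\<^esub> J j) (x j))
       \<longrightarrow> (\<exists>p\<in>carrier P. \<forall>i\<in>I. x i = J i +>\<^bsub>P\<^esub> p))"


section \<open>Locally coalgebra Galois extensions\<close>

definition locally_coalgebra_galois :: "('k, 'r) ring_scheme \<Rightarrow> ('k, 'c, 's) coalg_scheme \<Rightarrow>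
    ('k, 'p, 'c, 't) comod_alg_scheme \<Rightarrow> 'p set \<Rightarrow> 'i set \<Rightarrow> ('i \<Rightarrow> 'p set) \<Rightarrow> bool" where
  "locally_coalgebra_galois K C P B I J \<longleftrightarrow>
     comodule_algebra K C P \<and> B = coinvariants K C P \<and> complete_cover K C P I J \<and>
     (\<forall>i\<in>I. (\<lambda>b. J i +>\<^bsub>P\<^esub> b) ` B = coinvariants K C (quot_alg K C P (J i)) \<and>
            coalgebra_galois K C (quot_alg K C P (J i)) ((\<lambda>b. J i +>\<^bsub>P\<^esub> b) ` B)) \<and>
     (\<forall>i\<in>I. \<forall>j\<in>I. (\<lambda>b. (J i <+>\<^bsub>P\<^esub> J j) +>\<^bsub>P\<^esub> b) ` B =
            coinvariants K C (quot_alg K C P (J i <+>\<^bsub>P\<^esub> J j)))"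

text \<open>Local cleftness and regularity are stated relative to the chosen cleaving maps \<open>\<gamma> i\<close>.\<close>

definition locally_cleft :: "('k, 'r) ring_scheme \<Rightarrow> ('k, 'c, 's) coalg_scheme \<Rightarrow>
    ('k, 'p, 'c, 't) comod_alg_scheme \<Rightarrow> 'p set \<Rightarrow> 'i set \<Rightarrow> ('i \<Rightarrow> 'p set) \<Rightarrow>
    ('i \<Rightarrow> 'c \<Rightarrow> 'p set) \<Rightarrow> bool" where
  "locally_cleft K C P B I J \<gamma> \<longleftrightarrow> locally_coalgebra_galois K C P B I J \<and>
     (\<forall>i\<in>I. cleaving_map K C (quot_alg K C P (J i)) (\<gamma> i))"

definition regular_locally_cleft :: "('k, 'r) ring_scheme \<Rightarrow> ('k, 'c, 's) coalg_scheme \<Rightarrow>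
    ('k, 'p, 'c, 't) comod_alg_scheme \<Rightarrow> 'p set \<Rightarrow> 'i set \<Rightarrow> ('i \<Rightarrow> 'p set) \<Rightarrow>
    ('i \<Rightarrow> 'c \<Rightarrow> 'p set) \<Rightarrow> bool" where
  "regular_locally_cleft K C P B I J \<gamma> \<longleftrightarrow> locally_cleft K C P B I J \<gamma> \<and>
     (\<forall>i\<in>I. let Q = quot_alg K C P (J i);
                u = tensor_lift Q (\<lambda>p c. p \<otimes>\<^bsub>Q\<^esub> conv_inverse K C Q (\<gamma> i) c) (coact Q \<one>\<^bsub>Q\<^esub>)
            in \<exists>b\<in>(\<lambda>b. J i +>\<^bsub>P\<^esub> b) ` B. u \<otimes>\<^bsub>Q\<^esub> b = \<one>\<^bsub>Q\<^esub>)"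

text \<open>The kernel of the canonical surjection
  \<open>\<pi> : B/(B \<inter> Ji) \<rightarrow> B/((B \<inter> Ji) + (B \<inter> Jj))\<close>, as a subset of \<open>P/Ji\<close>.
  An element \<open>Y\<close> of the image of \<open>B\<close> in \<open>P/Ji\<close> is identified with the coset \<open>Y \<inter> B\<close> of \<open>B \<inter> Ji\<close>
  in \<open>B\<close>.\<close>

definition ker_pi :: "('p, 'm) ring_scheme \<Rightarrow> 'p set \<Rightarrow> 'p set \<Rightarrow> 'p set \<Rightarrow> 'p set set" where
  "ker_pi P B Ji Jj =
    (let N = (B \<inter> Ji) <+>\<^bsub>P\<^esub> (B \<inter> Jj)
     in a_kernel ((P Quot Ji)\<lparr>carrier := (\<lambda>b. Ji +>\<^bsub>P\<^esub> b) ` B\<rparr>)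
          (P\<lparr>carrier := B\<rparr> Quot N)
          (\<lambda>Y. coset_proj (P\<lparr>carrier := B\<rparr>) N (Y \<inter> B)))"

text \<open>The image of \<open>U \<otimes> V\<close> under multiplication. For linear subspaces \<open>U\<close>, \<open>V\<close> the additive
  span of the products is already closed under scalars.\<close>

definition subspace_prod :: "('p, 'm) ring_scheme \<Rightarrow> 'p set \<Rightarrow> 'p set \<Rightarrow> 'p set" where
  "subspace_prod A U V = generate (add_monoid A) {u \<otimes>\<^bsub>A\<^esub> v | u v. u \<in> U \<and> v \<in> V}"

end

theory Submission
  imports Defs
begin

text \<open>
  Write \<open>\<chi>\<^sub>i : P \<rightarrow> P\<^sub>i\<close> for the canonical surjections and \<open>N = B \<inter> J\<^sub>1\<close>; as \<open>J\<^sub>1 \<inter> J\<^sub>2 = 0\<close>, \<open>\<chi>\<^sub>2\<close> is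
  injective on \<open>J\<^sub>1\<close>, and over a field also \<open>J\<^sub>1 \<otimes> C \<rightarrow> P\<^sub>2 \<otimes> C\<close> is injective. Surjectivity of the
  canonical map holds modulo \<open>J\<^sub>1 \<otimes> C\<close> by the Galois property of \<open>P\<^sub>1\<close>, and \<open>J\<^sub>1 \<otimes> C\<close> is reached by
  that of \<open>P\<^sub>2\<close>.

  For injectivity, in \<open>P\<^sub>2\<close> every \<open>q\<close> equals \<open>E(q\<^sub>0) \<gamma>(q\<^sub>1)\<close> with \<open>E(q) = q\<^sub>0 \<gamma>\<inverse>(q\<^sub>1)\<close>, and the Galois
  property forces \<open>1 \<otimes> E(q) = E(q) \<otimes> 1\<close>, so that \<open>E(q)\<close> is coinvariant. Hence \<open>\<chi>\<^sub>2(J\<^sub>1) = \<chi>\<^sub>2(N) \<gamma>\<^sub>2(C)\<close>,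
  and by the commutation hypothesis \<open>J\<^sub>1 = P N\<close>. An element of the kernel of the canonical map vanishes
  in \<open>P\<^sub>1 \<otimes>\<^sub>B P\<^sub>1\<close>, so it lies in \<open>J\<^sub>1 \<otimes> P + P \<otimes> J\<^sub>1 = P N \<otimes> P + P \<otimes> N \<gamma>\<^sub>2(C)\<close> and has the form
  \<open>\<Sum> j\<^sub>k \<otimes> \<gamma>\<^sub>2(c\<^sub>k)\<close> with \<open>j\<^sub>k \<in> J\<^sub>1\<close>. Its image \<open>\<Sum> j\<^sub>k \<gamma>\<^sub>2(c\<^sub>k\<^sub>1) \<otimes> c\<^sub>k\<^sub>2\<close> in \<open>P\<^sub>2 \<otimes> C\<close> being zero,
  convolution with \<open>\<gamma>\<^sub>2\<inverse>\<close> gives \<open>\<Sum> j\<^sub>k \<otimes> c\<^sub>k = 0\<close>.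
\<close>

section \<open>Balanced tensor products\<close>

text \<open>The coaction is not assumed to be multiplicative, so coinvariance of E(q) cannot be
  computed from a product rule; it is read off from 1 \<otimes> E(q) = E(q) \<otimes> 1 by applying
  x \<otimes> y \<mapsto> x \<rho>(y p). Tensoring over B is only right exact, and J_1 \<otimes> P
  need not embed into P \<otimes> P; kernel elements have to be rewritten inside P \<otimes> P
  itself. For this J_1 must be spanned in two ways: N \<gamma>_2(C) has N on the left and lets
  elements leave the right tensor factor, P N has N on the right and lets them leave the left one.
  The commutation hypothesis turns the first description into the second. The second description
  also gives j \<otimes> k = 0 for j in J_1 and k in J_2. A right factor therefore matters only
  modulo J_2, and j \<otimes> \<gamma>_2(c) makes sense in P \<otimes> P although \<gamma>_2(c) lies
  in P_2. Over a field J_1 has a complement containing J_2. The projection along it induces a linear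
  left inverse of \<chi>_2 on J_1, which is what survives tensoring with C.\<close>

definition add_map :: "('a, 'm) ring_scheme \<Rightarrow> ('b, 'n) ring_scheme \<Rightarrow> ('a \<Rightarrow> 'b) \<Rightarrow> bool" where
  "add_map V W h \<longleftrightarrow> (\<forall>x\<in>carrier V. h x \<in> carrier W) \<and>
     (\<forall>x\<in>carrier V. \<forall>y\<in>carrier V. h (x \<oplus>\<^bsub>V\<^esub> y) = h x \<oplus>\<^bsub>W\<^esub> h y)"

lemma add_mapI:
  assumes "\<And>x. x \<in> carrier V \<Longrightarrow> h x \<in> carrier W"
    and "\<And>x y. x \<in> carrier V \<Longrightarrow> y \<in> carrier V \<Longrightarrow> h (x \<oplus>\<^bsub>V\<^esub> y) = h x \<oplus>\<^bsub>W\<^esub> h y"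
  shows "add_map V W h"
  using assms by (simp add: add_map_def)

lemma add_map_closed: "add_map V W h \<Longrightarrow> x \<in> carrier V \<Longrightarrow> h x \<in> carrier W"
  by (simp add: add_map_def)

lemma add_map_add:
  "add_map V W h \<Longrightarrow> x \<in> carrier V \<Longrightarrow> y \<in> carrier V \<Longrightarrow> h (x \<oplus>\<^bsub>V\<^esub> y) = h x \<oplus>\<^bsub>W\<^esub> h y"
  by (simp add: add_map_def)

lemma add_map_comp: "add_map U V g \<Longrightarrow> add_map V W h \<Longrightarrow> add_map U W (\<lambda>x. h (g x))"
  by (simp add: add_map_def)

text \<open>\<open>add_map\<close> mentions carriers and addition only, so that it can be passed
  unchanged between \<open>tensor\<close> and \<open>bal_tensor\<close>; the group structures are
  supplied where zeros and differences are needed.\<close>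

lemma add_map_hom:
  assumes "abelian_group V" "abelian_group W" "add_map V W h"
  shows "abelian_group_hom V W h"
  using assms by (intro abelian_group_homI group_hom.intro group_hom_axioms.intro)
    (auto simp: add_map_def hom_def abelian_group.a_group)

lemma add_map_zero:
  assumes "abelian_group V" "abelian_group W" "add_map V W h"
  shows "h \<zero>\<^bsub>V\<^esub> = \<zero>\<^bsub>W\<^esub>"
  by (rule abelian_group_hom.hom_zero[OF add_map_hom[OF assms]])

lemma add_map_minus:
  assumes "abelian_group V" "abelian_group W" "add_map V W h" "x \<in> carrier V" "y \<in> carrier V"
  shows "h (x \<ominus>\<^bsub>V\<^esub> y) = h x \<ominus>\<^bsub>W\<^esub> h y"
proof -
  interpret abelian_group_hom V W h by (rule add_map_hom) fact+
  show ?thesis using assms by (simp add: a_minus_def)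
qed

lemma add_map_diff:
  assumes "abelian_group W" "add_map V W g" "add_map V W h"
  shows "add_map V W (\<lambda>x. g x \<ominus>\<^bsub>W\<^esub> h x)"
proof -
  interpret abelian_group W by fact
  show ?thesis using assms by (auto simp: add_map_def a_minus_def minus_add a_ac)
qed

definition balanced :: "('v, 'm) ring_scheme \<Rightarrow> ('w, 'n) ring_scheme \<Rightarrow> 's set \<Rightarrow>
    ('v \<Rightarrow> 's \<Rightarrow> 'v) \<Rightarrow> ('s \<Rightarrow> 'w \<Rightarrow> 'w) \<Rightarrow> ('a, 'l) ring_scheme \<Rightarrow> ('v \<Rightarrow> 'w \<Rightarrow> 'a) \<Rightarrow> bool" where
  "balanced V W S r l A f \<longleftrightarrow>
     (\<forall>w\<in>carrier W. add_map V A (\<lambda>v. f v w)) \<and> (\<forall>v\<in>carrier V. add_map W A (f v)) \<and>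
     (\<forall>v\<in>carrier V. \<forall>s\<in>S. \<forall>w\<in>carrier W. f (r v s) w = f v (l s w))"

text \<open>The additive extension of \<open>f\<close> from generators to formal integer
  combinations; \<open>tensor_lift\<close> is its value at a representative of the coset.\<close>

definition frag_sum :: "('a, 'm) ring_scheme \<Rightarrow> ('x \<Rightarrow> 'a) \<Rightarrow> ('x \<Rightarrow>\<^sub>0 int) \<Rightarrow> 'a" where
  "frag_sum A f u = (\<Oplus>\<^bsub>A\<^esub>x\<in>Poly_Mapping.keys u. [Poly_Mapping.lookup u x] \<cdot>\<^bsub>A\<^esub> f x)"

lemma keys_diff_subset:
  "Poly_Mapping.keys a \<subseteq> D \<Longrightarrow> Poly_Mapping.keys b \<subseteq> D \<Longrightarrow> Poly_Mapping.keys (a - b) \<subseteq> D"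
  for a b :: "'x \<Rightarrow>\<^sub>0 int"
  using keys_diff[of a b] by blast

context abelian_group
begin

lemma add_diff: "x \<in> carrier G \<Longrightarrow> y \<in> carrier G \<Longrightarrow> x \<oplus> y \<ominus> x \<ominus> y = \<zero>"
  using a_comm[of x y] by (simp add: a_minus_def a_assoc r_neg)

lemma minus_self: "x \<in> carrier G \<Longrightarrow> x \<ominus> x = \<zero>"
  by (simp add: a_minus_def r_neg)

lemma minus_zeroD:
  assumes "x \<in> carrier G" "y \<in> carrier G" "x \<ominus> y = \<zero>"
  shows "x = y"
proof -
  have "x = (x \<ominus> y) \<oplus> y" using assms(1,2) by (simp add: a_minus_def a_assoc l_neg)
  then show ?thesis using assms by simp
qed

text \<open>Cancellation can make the keys of \<open>u + v\<close> smaller than the union of the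
  keys. Additivity is therefore checked over a common finite set, where the extra terms have
  coefficient 0.\<close>

lemma frag_sum_superset:
  assumes "finite Y" "Poly_Mapping.keys u \<subseteq> Y" "\<And>x. x \<in> Y \<Longrightarrow> f x \<in> carrier G"
  shows "frag_sum G f u = (\<Oplus>x\<in>Y. [Poly_Mapping.lookup u x] \<cdot> f x)"
proof -
  have z: "add_pow G (0::int) x = \<zero>" for x by (simp add: add_pow_def)
  show ?thesis
  unfolding frag_sum_def
  by (rule add.finprod_mono_neutral_cong_left)
     (use assms z in \<open>auto intro: add.int_pow_closed simp: in_keys_iff\<close>)
qed

lemma frag_sum_closed:
  assumes "\<And>x. x \<in> Poly_Mapping.keys u \<Longrightarrow> f x \<in> carrier G"
  shows "frag_sum G f u \<in> carrier G"
  unfolding frag_sum_def using assms by (auto intro!: finsum_closed add.int_pow_closed)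

lemma frag_sum_hom:
  assumes "\<And>x. x \<in> D \<Longrightarrow> f x \<in> carrier G"
  shows "group_hom (free_Abelian_group D) (add_monoid G) (frag_sum G f)"
proof (intro group_hom.intro group_hom_axioms.intro homI group_free_Abelian_group a_group)
  fix u v
  assume uv: "u \<in> carrier (free_Abelian_group D)" "v \<in> carrier (free_Abelian_group D)"
  let ?Y = "Poly_Mapping.keys u \<union> Poly_Mapping.keys v"
  have f: "x \<in> ?Y \<Longrightarrow> f x \<in> carrier G" for x using uv assms by auto
  have "frag_sum G f (u + v) = (\<Oplus>x\<in>?Y. [Poly_Mapping.lookup (u + v) x] \<cdot> f x)"
    by (rule frag_sum_superset) (use f in \<open>auto dest: keys_add[THEN subsetD]\<close>)
  also have "\<dots> = (\<Oplus>x\<in>?Y. [Poly_Mapping.lookup u x] \<cdot> f x \<oplus> [Poly_Mapping.lookup v x] \<cdot> f x)"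
    by (rule finsum_cong') (use f in \<open>auto simp: lookup_add add.int_pow_mult\<close>)
  also have "\<dots> = frag_sum G f u \<oplus> frag_sum G f v"
    using f by (subst (1 2) frag_sum_superset[where Y="?Y"])
      (auto intro!: finsum_addf add.int_pow_closed)
  finally show "frag_sum G f (u \<otimes>\<^bsub>free_Abelian_group D\<^esub> v) =
      frag_sum G f u \<otimes>\<^bsub>add_monoid G\<^esub> frag_sum G f v"
    by simp
next
  fix u assume "u \<in> carrier (free_Abelian_group D)"
  then show "frag_sum G f u \<in> carrier (add_monoid G)"
    using assms by (auto intro!: frag_sum_closed)
qed

lemma frag_sum_frag_of: "f x \<in> carrier G \<Longrightarrow> frag_sum G f (frag_of x) = f x"
  by (simp add: frag_sum_def)

end

text \<open>Only closure of the two actions is required, so that the locale covers scalar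
  multiplication by the ground ring as well as multiplication by the ring of coinvariants.\<close>

locale bal_pair = V: abelian_group V + W: abelian_group W
  for V :: "('v, 'm) ring_scheme" (structure) and W :: "('w, 'n) ring_scheme" (structure) +
  fixes S :: "'s set" and r :: "'v \<Rightarrow> 's \<Rightarrow> 'v" and l :: "'s \<Rightarrow> 'w \<Rightarrow> 'w"
  assumes r_closed: "v \<in> carrier V \<Longrightarrow> s \<in> S \<Longrightarrow> r v s \<in> carrier V"
    and l_closed: "w \<in> carrier W \<Longrightarrow> s \<in> S \<Longrightarrow> l s w \<in> carrier W"
begin

abbreviation T where "T \<equiv> bal_tensor V W S r l"
abbreviation pure where "pure \<equiv> bal_pure V W S r l"
abbreviation F where "F \<equiv> free_Abelian_group (carrier V \<times> carrier W)"
abbreviation R where "R \<equiv> bal_subgroup V W S r l"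

sublocale F: comm_group F
  by (rule abelian_free_Abelian_group)

lemma rels_subset: "bal_rels V W S r l \<subseteq> carrier F"
  unfolding bal_rels_def
  by (intro Un_least subsetI; clarify; unfold carrier_free_Abelian_group_iff; intro keys_diff_subset)
     (auto simp: r_closed l_closed)

lemma R_subgroup: "subgroup R F"
  unfolding bal_subgroup_def by (rule F.generate_is_subgroup) (rule rels_subset)

lemma R_normal: "R \<lhd> F"
  by (rule F.subgroup_imp_normal) (rule R_subgroup)

lemma carrier_T: "carrier T = (\<lambda>u. R #>\<^bsub>F\<^esub> u) ` carrier F"
  by (simp add: bal_tensor_def Let_def carrier_FactGroup)

lemma add_T: "u \<in> carrier F \<Longrightarrow> v \<in> carrier F \<Longrightarrow>
    (R #>\<^bsub>F\<^esub> u) \<oplus>\<^bsub>T\<^esub> (R #>\<^bsub>F\<^esub> v) = R #>\<^bsub>F\<^esub> (u + v)"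
  using normal.rcos_sum[OF R_normal] by (simp add: bal_tensor_def Let_def)

lemma abelian_T: "abelian_group T"
proof (rule comm_group_abelian_groupI)
  have "comm_group (F Mod R)" by (rule F.abelian_FactGroup) (rule R_subgroup)
  moreover have "add_monoid T = F Mod R"
    by (simp add: bal_tensor_def Let_def)
  ultimately show "comm_group (add_monoid T)" by simp
qed

sublocale T: abelian_group T
  by (rule abelian_T)

lemma coset_eqI:
  assumes "u \<in> carrier F" "v \<in> carrier F" "u - v \<in> R"
  shows "R #>\<^bsub>F\<^esub> u = R #>\<^bsub>F\<^esub> v"
proof -
  have "u \<in> R #>\<^bsub>F\<^esub> v"
    unfolding r_coset_def using assms(3) by (auto intro!: bexI[of _ "u - v"])
  then show ?thesis
    using F.repr_independence[OF _ assms(2) R_subgroup] by blast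
qed

lemma pure_closed [simp, intro]: "v \<in> carrier V \<Longrightarrow> w \<in> carrier W \<Longrightarrow> pure v w \<in> carrier T"
  unfolding bal_pure_def carrier_T by (auto intro!: imageI)

lemma rels_R: "u \<in> bal_rels V W S r l \<Longrightarrow> u \<in> R"
  by (simp add: bal_subgroup_def generate.incl)

lemma pure_add_left:
  assumes "v \<in> carrier V" "v' \<in> carrier V" "w \<in> carrier W"
  shows "pure (v \<oplus>\<^bsub>V\<^esub> v') w = pure v w \<oplus>\<^bsub>T\<^esub> pure v' w"
proof -
  have "frag_of (v \<oplus>\<^bsub>V\<^esub> v', w) - frag_of (v, w) - frag_of (v', w) \<in> R"
    by (rule rels_R) (use assms in \<open>auto simp: bal_rels_def\<close>)
  then show ?thesis
    unfolding bal_pure_def using assms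
    by (subst add_T, simp, simp, intro coset_eqI)
      (auto simp: diff_diff_eq V.add.m_closed W.add.m_closed dest: keys_add[THEN subsetD])
qed

lemma pure_add_right:
  assumes "v \<in> carrier V" "w \<in> carrier W" "w' \<in> carrier W"
  shows "pure v (w \<oplus>\<^bsub>W\<^esub> w') = pure v w \<oplus>\<^bsub>T\<^esub> pure v w'"
proof -
  have "frag_of (v, w \<oplus>\<^bsub>W\<^esub> w') - frag_of (v, w) - frag_of (v, w') \<in> R"
    by (rule rels_R) (use assms in \<open>auto simp: bal_rels_def\<close>)
  then show ?thesis
    unfolding bal_pure_def using assms
    by (subst add_T, simp, simp, intro coset_eqI)
      (auto simp: diff_diff_eq V.add.m_closed W.add.m_closed dest: keys_add[THEN subsetD])
qed

lemma pure_bal: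
  assumes "v \<in> carrier V" "w \<in> carrier W" "s \<in> S"
  shows "pure (r v s) w = pure v (l s w)"
proof -
  have "frag_of (r v s, w) - frag_of (v, l s w) \<in> R"
    by (rule rels_R) (use assms in \<open>auto simp: bal_rels_def\<close>)
  then show ?thesis
    unfolding bal_pure_def using assms
    by (intro coset_eqI) (auto simp: r_closed l_closed)
qed

lemma balanced_pure: "balanced V W S r l T pure"
  by (simp add: balanced_def add_map_def pure_add_left pure_add_right pure_bal)

lemma pure_hom_left: "w \<in> carrier W \<Longrightarrow> abelian_group_hom V T (\<lambda>v. pure v w)"
  by (intro add_map_hom V.abelian_group_axioms T.abelian_group_axioms)
    (use balanced_pure in \<open>simp add: balanced_def\<close>)

lemma pure_hom_right: "v \<in> carrier V \<Longrightarrow> abelian_group_hom W T (pure v)"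
  by (intro add_map_hom W.abelian_group_axioms T.abelian_group_axioms)
    (use balanced_pure in \<open>simp add: balanced_def\<close>)

lemma pure_a_inv_left:
  "v \<in> carrier V \<Longrightarrow> w \<in> carrier W \<Longrightarrow> pure (\<ominus>\<^bsub>V\<^esub> v) w = \<ominus>\<^bsub>T\<^esub> pure v w"
  using abelian_group_hom.hom_a_inv[OF pure_hom_left] by simp

lemma pure_zero_left: "w \<in> carrier W \<Longrightarrow> pure \<zero>\<^bsub>V\<^esub> w = \<zero>\<^bsub>T\<^esub>"
  using abelian_group_hom.hom_zero[OF pure_hom_left] by simp

lemma pure_zero_right: "v \<in> carrier V \<Longrightarrow> pure v \<zero>\<^bsub>W\<^esub> = \<zero>\<^bsub>T\<^esub>"
  using abelian_group_hom.hom_zero[OF pure_hom_right] by simp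

text \<open>Negatives need no case of their own, since - (v \<otimes> w) = (- v) \<otimes> w is
  again pure.\<close>

lemma T_induct [consumes 1, case_names pure add]:
  assumes "t \<in> carrier T"
    and p: "\<And>v w. v \<in> carrier V \<Longrightarrow> w \<in> carrier W \<Longrightarrow> Q (pure v w)"
    and a: "\<And>x y. x \<in> carrier T \<Longrightarrow> y \<in> carrier T \<Longrightarrow> Q x \<Longrightarrow> Q y \<Longrightarrow> Q (x \<oplus>\<^bsub>T\<^esub> y)"
  shows "Q t"
proof -
  \<comment> \<open>\<open>free_Abelian_group_induct\<close> steps from \<open>x\<close> and
    \<open>y\<close> to \<open>x - y\<close>, so the claim has to carry along the negative of each
    element.\<close>
  have "Q (R #>\<^bsub>F\<^esub> u) \<and> Q (R #>\<^bsub>F\<^esub> (- u))" if "Poly_Mapping.keys u \<subseteq> carrier V \<times> carrier W" for u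
  proof (rule free_Abelian_group_induct[OF that], goal_cases)
    case 1
    have "Q (pure \<zero>\<^bsub>V\<^esub> \<zero>\<^bsub>W\<^esub>)" by (rule p) auto
    moreover have "pure \<zero>\<^bsub>V\<^esub> \<zero>\<^bsub>W\<^esub> = \<zero>\<^bsub>T\<^esub>" by (simp add: pure_zero_left)
    moreover have "\<zero>\<^bsub>T\<^esub> = R" by (simp add: bal_tensor_def Let_def)
    moreover have "R #>\<^bsub>F\<^esub> 0 = R" using F.coset_mult_one[OF subgroup.subset[OF R_subgroup]] by simp
    ultimately show ?case by simp
  next
    case (2 x y)
    then have xy: "x \<in> carrier F" "y \<in> carrier F" "- x \<in> carrier F" "- y \<in> carrier F"
      by (simp_all add: keys_minus)
    then have c: "R #>\<^bsub>F\<^esub> z \<in> carrier T" if "z \<in> {x, y, - x, - y}" for z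
      using that unfolding carrier_T by blast
    have "Q ((R #>\<^bsub>F\<^esub> x) \<oplus>\<^bsub>T\<^esub> (R #>\<^bsub>F\<^esub> (- y)))" "Q ((R #>\<^bsub>F\<^esub> y) \<oplus>\<^bsub>T\<^esub> (R #>\<^bsub>F\<^esub> (- x)))"
      using 2(3,4) by (auto intro!: a c)
    then show ?case
      by (simp only: add_T[OF xy(1) xy(4)] add_T[OF xy(2) xy(3)]) simp
  next
    case (3 x)
    then obtain v w where x: "x = (v, w)" "v \<in> carrier V" "w \<in> carrier W" by auto
    have "\<ominus>\<^bsub>T\<^esub> pure v w = R #>\<^bsub>F\<^esub> (- frag_of x)"
    proof (rule T.add.inv_equality)
      have "(R #>\<^bsub>F\<^esub> (- frag_of x)) \<oplus>\<^bsub>T\<^esub> pure v w = R #>\<^bsub>F\<^esub> 0"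
        unfolding bal_pure_def using x by (subst add_T) (auto simp: keys_minus)
      also have "\<dots> = \<zero>\<^bsub>T\<^esub>" 
        using F.coset_mult_one[OF subgroup.subset[OF R_subgroup]] by (simp add: bal_tensor_def Let_def)
      finally show "(R #>\<^bsub>F\<^esub> (- frag_of x)) \<oplus>\<^bsub>T\<^esub> pure v w = \<zero>\<^bsub>T\<^esub>" .
    next
      show "R #>\<^bsub>F\<^esub> (- frag_of x) \<in> carrier T"
        unfolding carrier_T using x by (auto simp: keys_minus)
    qed (use x in simp)
    moreover have "Q (\<ominus>\<^bsub>T\<^esub> pure v w)"
      using x p[of "\<ominus>\<^bsub>V\<^esub> v" w] by (simp add: pure_a_inv_left)
    ultimately show ?case using x p[of v w] by (simp add: bal_pure_def)
  qed
  then show ?thesis using assms(1) by (auto simp: carrier_T)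
qed

context
  fixes A :: "('a, 'l) ring_scheme" and f :: "'v \<Rightarrow> 'w \<Rightarrow> 'a"
  assumes A: "abelian_group A" and f: "balanced V W S r l A f"
begin

interpretation A: abelian_group A by (rule A)

interpretation h: group_hom F "add_monoid A" "frag_sum A (\<lambda>x. f (fst x) (snd x))"
  by (rule A.frag_sum_hom) (use f in \<open>auto simp: balanced_def add_map_def\<close>)

lemma balanced_closed: "v \<in> carrier V \<Longrightarrow> w \<in> carrier W \<Longrightarrow> f v w \<in> carrier A"
  using f by (simp add: balanced_def add_map_def)

lemma frag_sum_pair: "v \<in> carrier V \<Longrightarrow> w \<in> carrier W \<Longrightarrow>
    frag_sum A (\<lambda>x. f (fst x) (snd x)) (frag_of (v, w)) = f v w"
  by (subst A.frag_sum_frag_of) (auto simp: balanced_closed)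

lemma frag_sum_diff:
  assumes "u \<in> carrier F" "v \<in> carrier F"
  shows "frag_sum A (\<lambda>x. f (fst x) (snd x)) (u - v) =
    frag_sum A (\<lambda>x. f (fst x) (snd x)) u \<ominus>\<^bsub>A\<^esub> frag_sum A (\<lambda>x. f (fst x) (snd x)) v"
proof -
  have "frag_sum A (\<lambda>x. f (fst x) (snd x)) (u \<otimes>\<^bsub>F\<^esub> inv\<^bsub>F\<^esub> v) =
    frag_sum A (\<lambda>x. f (fst x) (snd x)) u \<ominus>\<^bsub>A\<^esub> frag_sum A (\<lambda>x. f (fst x) (snd x)) v"
    using assms h.hom_inv[of v] h.hom_mult[of u "inv\<^bsub>F\<^esub> v"] F.inv_closed[of v]
    by (simp add: a_minus_def a_inv_def del: inv_free_Abelian_group mult_free_Abelian_group)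
  then show ?thesis using assms by simp
qed

lemma frag_sum_bal_subgroup: "u \<in> R \<Longrightarrow> frag_sum A (\<lambda>x. f (fst x) (snd x)) u = \<zero>\<^bsub>A\<^esub>"
proof -
  have "bal_rels V W S r l \<subseteq> kernel F (add_monoid A) (frag_sum A (\<lambda>x. f (fst x) (snd x)))"
  proof
    fix u assume u: "u \<in> bal_rels V W S r l"
    then have "u \<in> carrier F" using rels_subset by blast
    moreover have "frag_sum A (\<lambda>x. f (fst x) (snd x)) u = \<zero>\<^bsub>A\<^esub>"
      using u f unfolding bal_rels_def balanced_def add_map_def
      by (auto simp: frag_sum_diff frag_sum_pair r_closed l_closed balanced_closed keys_diff_subset A.add_diff A.minus_self)
    ultimately show "u \<in> kernel F (add_monoid A) (frag_sum A (\<lambda>x. f (fst x) (snd x)))"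
      by (simp add: kernel_def)
  qed
  then have "R \<subseteq> kernel F (add_monoid A) (frag_sum A (\<lambda>x. f (fst x) (snd x)))"
    unfolding bal_subgroup_def by (intro F.generate_subgroup_incl h.subgroup_kernel)
  then show "u \<in> R \<Longrightarrow> frag_sum A (\<lambda>x. f (fst x) (snd x)) u = \<zero>\<^bsub>A\<^esub>"
    by (auto simp: kernel_def)
qed

text \<open>The additive extension of a balanced map kills the relations and so is constant on each
  coset; this is what makes \<open>the_elem\<close> in \<open>tensor_lift\<close>
  meaningful.\<close>

lemma lift_coset:
  assumes u: "u \<in> carrier F"
  shows "tensor_lift A f (R #>\<^bsub>F\<^esub> u) = frag_sum A (\<lambda>x. f (fst x) (snd x)) u"
proof -
  have "frag_sum A (\<lambda>x. f (fst x) (snd x)) u' = frag_sum A (\<lambda>x. f (fst x) (snd x)) u"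
    if u': "u' \<in> R #>\<^bsub>F\<^esub> u" for u'
  proof -
    obtain k where k: "k \<in> R" "u' = k \<otimes>\<^bsub>F\<^esub> u" using u' unfolding r_coset_def by blast
    have "k \<in> carrier F" using k(1) subgroup.subset[OF R_subgroup] by blast
    then have "frag_sum A (\<lambda>x. f (fst x) (snd x)) u' = \<zero>\<^bsub>A\<^esub> \<oplus>\<^bsub>A\<^esub> frag_sum A (\<lambda>x. f (fst x) (snd x)) u"
      using h.hom_mult[of k u] k u frag_sum_bal_subgroup[OF k(1)] by simp
    then show ?thesis using h.hom_closed[OF u] by simp
  qed
  moreover have "u \<in> R #>\<^bsub>F\<^esub> u" by (rule F.rcos_self[OF u R_subgroup])
  ultimately have "frag_sum A (\<lambda>x. f (fst x) (snd x)) ` (R #>\<^bsub>F\<^esub> u) =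
      {frag_sum A (\<lambda>x. f (fst x) (snd x)) u}" by blast
  then show ?thesis
    unfolding tensor_lift_def frag_sum_def[symmetric] by simp
qed

lemma lift_pure [simp]: "v \<in> carrier V \<Longrightarrow> w \<in> carrier W \<Longrightarrow> tensor_lift A f (pure v w) = f v w"
  unfolding bal_pure_def by (subst lift_coset) (auto simp: frag_sum_pair)

lemma add_map_lift: "add_map T A (tensor_lift A f)"
proof (rule add_mapI)
  fix t t' assume "t \<in> carrier T" "t' \<in> carrier T"
  then obtain u u' where u: "u \<in> carrier F" "u' \<in> carrier F"
     "t = R #>\<^bsub>F\<^esub> u" "t' = R #>\<^bsub>F\<^esub> u'" by (auto simp: carrier_T)
  have "tensor_lift A f (R #>\<^bsub>F\<^esub> (u \<otimes>\<^bsub>F\<^esub> u')) = 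
    tensor_lift A f (R #>\<^bsub>F\<^esub> u) \<oplus>\<^bsub>A\<^esub> tensor_lift A f (R #>\<^bsub>F\<^esub> u')"
    using u F.m_closed[OF u(1,2)] h.hom_mult[OF u(1,2)] by (subst (1 2 3) lift_coset) auto
  then show "tensor_lift A f (t \<oplus>\<^bsub>T\<^esub> t') = tensor_lift A f t \<oplus>\<^bsub>A\<^esub> tensor_lift A f t'"
    using u by (simp add: add_T)
next
  fix t assume "t \<in> carrier T"
  then show "tensor_lift A f t \<in> carrier A"
    using h.hom_closed by (auto simp: carrier_T lift_coset)
qed

end

lemma add_map_eqI:
  assumes "add_map T A g" "add_map T A h" "t \<in> carrier T"
    and "\<And>v w. v \<in> carrier V \<Longrightarrow> w \<in> carrier W \<Longrightarrow> g (pure v w) = h (pure v w)"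
  shows "g t = h t"
  using assms(3) by (induction t rule: T_induct) (use assms in \<open>auto simp: add_map_add\<close>)

lemma lift_comp:
  assumes A: "abelian_group A" "balanced V W S r l A f" and A': "abelian_group A'" and h: "add_map A A' h"
    and t: "t \<in> carrier T"
  shows "h (tensor_lift A f t) = tensor_lift A' (\<lambda>v w. h (f v w)) t"
proof -
  have b: "balanced V W S r l A' (\<lambda>v w. h (f v w))"
    using A(2) h unfolding balanced_def add_map_def by simp
  show ?thesis
    by (rule add_map_eqI[where g="\<lambda>t. h (tensor_lift A f t)", OF _ add_map_lift[OF A' b] t])
       (use A A' b h in \<open>auto intro: add_map_comp[OF add_map_lift]\<close>)
qed

text \<open>Only \<open>g\<close> has to be known as balanced: \<open>f\<close> agrees with it on
  the carriers, which the actions do not leave. Rewriting inside a Sweedler expression is an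
  application of this.\<close>

lemma lift_cong:
  assumes A: "abelian_group A" and g: "balanced V W S r l A g" and t: "t \<in> carrier T"
    and eq: "\<And>v w. v \<in> carrier V \<Longrightarrow> w \<in> carrier W \<Longrightarrow> f v w = g v w"
  shows "tensor_lift A f t = tensor_lift A g t"
proof -
  have f: "balanced V W S r l A f"
    using g eq unfolding balanced_def add_map_def by (auto simp: r_closed l_closed)
  show ?thesis
    by (rule add_map_eqI[OF add_map_lift[OF A f] add_map_lift[OF A g] t])
      (simp add: A f g eq)
qed

end


section \<open>Spans and additive maps\<close>

lemma gen_image:
  assumes A: "abelian_group A" and A': "abelian_group A'" and h: "add_map A A' h"
    and Z: "Z \<subseteq> carrier A" "h ` Z \<subseteq> H" and H: "subgroup H (add_monoid A')"
    and x: "x \<in> generate (add_monoid A) Z"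
  shows "h x \<in> H"
proof -
  interpret A: abelian_group A by fact
  interpret A': abelian_group A' by fact
  interpret h: abelian_group_hom A A' h by (rule add_map_hom) fact+
  have "subgroup {x \<in> carrier A. h x \<in> H} (add_monoid A)"
  proof (rule A.add.subgroupI)
    show "{x \<in> carrier A. h x \<in> H} \<noteq> {}"
      using subgroup.one_closed[OF H] by (auto intro!: exI[of _ "\<zero>\<^bsub>A\<^esub>"])
  qed (use subgroup.m_closed[OF H] subgroup.m_inv_closed[OF H] in \<open>auto simp: a_inv_def[symmetric]\<close>)
  then have "generate (add_monoid A) Z \<subseteq> {x \<in> carrier A. h x \<in> H}"
    by (rule A.add.generate_subgroup_incl[rotated]) (use Z in auto)
  then show ?thesis using x by blast
qed

lemma gen_zero:
  assumes A: "abelian_group A" and A': "abelian_group A'" and h: "add_map A A' h"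
    and Z: "Z \<subseteq> carrier A" "\<And>z. z \<in> Z \<Longrightarrow> h z = \<zero>\<^bsub>A'\<^esub>"
    and x: "x \<in> generate (add_monoid A) Z"
  shows "h x = \<zero>\<^bsub>A'\<^esub>"
proof -
  interpret A': abelian_group A' by fact
  have "h x \<in> {\<zero>\<^bsub>A'\<^esub>}"
    by (rule gen_image[OF A A' h Z(1) _ _ x]) (use Z A'.add.triv_subgroup in auto)
  then show ?thesis by simp
qed

lemma gen_eq:
  assumes A: "abelian_group A" and A': "abelian_group A'" and h: "add_map A A' h" "add_map A A' k"
    and Z: "Z \<subseteq> carrier A" "\<And>z. z \<in> Z \<Longrightarrow> h z = k z"
    and x: "x \<in> generate (add_monoid A) Z"
  shows "h x = k x"
proof -
  interpret A: abelian_group A by fact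
  interpret A': abelian_group A' by fact
  have "x \<in> carrier A"
    using x A.add.generate_in_carrier[OF Z(1)] by simp
  moreover have "h x \<ominus>\<^bsub>A'\<^esub> k x = \<zero>\<^bsub>A'\<^esub>"
    by (rule gen_zero[OF A A' add_map_diff[OF A' h] Z(1) _ x])
       (use Z h in \<open>auto simp: add_map_closed A'.minus_self subset_iff\<close>)
  ultimately show ?thesis
    using h by (simp add: add_map_closed A'.minus_zeroD)
qed

context abelian_group
begin

lemma gen_subgroup: "Z \<subseteq> carrier G \<Longrightarrow> subgroup (generate (add_monoid G) Z) (add_monoid G)"
  by (rule add.generate_is_subgroup) simp

lemma gen_incl: "z \<in> Z \<Longrightarrow> z \<in> generate (add_monoid G) Z"
  by (rule generate.incl)

lemma gen_add: "x \<in> generate (add_monoid G) Z \<Longrightarrow> y \<in> generate (add_monoid G) Z \<Longrightarrow>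
    x \<oplus> y \<in> generate (add_monoid G) Z"
  using generate.eng[of x "add_monoid G" Z y] by simp

lemma gen_subsetI: "Y \<subseteq> generate (add_monoid G) Z \<Longrightarrow> Z \<subseteq> carrier G \<Longrightarrow>
    generate (add_monoid G) Y \<subseteq> generate (add_monoid G) Z"
  by (rule add.generate_subgroup_incl) (auto intro: gen_subgroup)

end

text \<open>Right exactness of the balanced tensor product, for surjections in both factors and a
  change of scalars from \<open>S\<close> to \<open>S'\<close>. With M the span in the conclusion,
  sending v' \<otimes> w' to the class of v \<otimes> w modulo M, for any preimages v and w, gives a
  map back from the target whose composite with \<open>h\<close> is the projection. Each
  \<open>s'\<close> must lift to some \<open>s\<close> for this map to be balanced over
  \<open>S'\<close>.\<close>

lemma tensor_kernel:
  fixes V :: "('v, 'm) ring_scheme" and W :: "('w, 'n) ring_scheme"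
    and V' :: "('v1, 'm1) ring_scheme" and W' :: "('w1, 'n1) ring_scheme"
  assumes p: "bal_pair V W S r l" and p': "bal_pair V' W' S' r' l'"
    and f: "add_map V V' f" "f ` carrier V = carrier V'"
    and g: "add_map W W' g" "g ` carrier W = carrier W'"
    and s: "\<And>s'. s' \<in> S' \<Longrightarrow> \<exists>s\<in>S. (\<forall>v\<in>carrier V. f (r v s) = r' (f v) s') \<and>
        (\<forall>w\<in>carrier W. g (l s w) = l' s' (g w))"
    and h: "add_map (bal_tensor V W S r l) (bal_tensor V' W' S' r' l') h"
      "\<And>v w. v \<in> carrier V \<Longrightarrow> w \<in> carrier W \<Longrightarrow>
         h (bal_pure V W S r l v w) = bal_pure V' W' S' r' l' (f v) (g w)"
    and t: "t \<in> carrier (bal_tensor V W S r l)" "h t = \<zero>\<^bsub>bal_tensor V' W' S' r' l'\<^esub>"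
  shows "t \<in> generate (add_monoid (bal_tensor V W S r l))
    ({bal_pure V W S r l x w | x w. x \<in> carrier V \<and> f x = \<zero>\<^bsub>V'\<^esub> \<and> w \<in> carrier W} \<union>
     {bal_pure V W S r l v y | v y. v \<in> carrier V \<and> y \<in> carrier W \<and> g y = \<zero>\<^bsub>W'\<^esub>})"
    (is "_ \<in> generate _ ?Z")
proof -
  interpret p: bal_pair V W S r l by (rule p)
  interpret p': bal_pair V' W' S' r' l' by (rule p')
  interpret f: abelian_group_hom V V' f
    by (rule add_map_hom) (fact p.V.abelian_group_axioms p'.V.abelian_group_axioms f)+
  interpret g: abelian_group_hom W W' g
    by (rule add_map_hom) (fact p.W.abelian_group_axioms p'.W.abelian_group_axioms g)+
  define M where "M = generate (add_monoid p.T) ?Z"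
  have Z: "?Z \<subseteq> carrier p.T" by auto
  interpret M: abelian_subgroup M p.T
    by (intro abelian_subgroupI3 additive_subgroupI p.T.abelian_group_axioms)
      (unfold M_def, rule p.T.gen_subgroup[OF Z])
  define A where "A = p.T Quot M"
  interpret A: abelian_group A
    by (rule comm_group_abelian_groupI)
      (simp add: A_def FactRing_def M.a_factorgroup_is_comm_group[unfolded A_FactGroup_def'])
  define \<pi> where "\<pi> x = M +>\<^bsub>p.T\<^esub> x" for x
  have \<pi>: "add_map p.T A \<pi>"
    unfolding A_def \<pi>_def
    by (rule add_mapI) (simp_all add: FactRing_def p.T.a_rcosetsI M.a_subset M.a_rcos_sum)
  have \<pi>_eq: "\<pi> x = \<pi> y" if "x \<in> carrier p.T" "y \<in> carrier p.T" "x \<ominus>\<^bsub>p.T\<^esub> y \<in> M" for x y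
  proof -
    have "x \<oplus>\<^bsub>p.T\<^esub> \<ominus>\<^bsub>p.T\<^esub> y \<in> M"
      using that(3) by (simp only: a_minus_def)
    then have "x \<in> M +>\<^bsub>p.T\<^esub> y"
      by (rule M.a_rcos_module_rev[OF that(2,1)])
    then have "M +>\<^bsub>p.T\<^esub> y = M +>\<^bsub>p.T\<^esub> x"
      by (rule M.a_repr_independence'[OF _ that(2)])
    then show ?thesis
      unfolding \<pi>_def by (rule sym)
  qed
  have f': "\<exists>v\<in>carrier V. v' = f v" if "v' \<in> carrier V'" for v' using that f(2) by blast
  have g': "\<exists>w\<in>carrier W. w' = g w" if "w' \<in> carrier W'" for w' using that g(2) by blast
  \<comment> \<open>The preimages are arbitrary choices; \<open>k\<close> does not depend on them
    because it takes values modulo \<open>M\<close>.\<close>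
  define i where "i v' = (SOME v. v \<in> carrier V \<and> f v = v')" for v'
  define j where "j w' = (SOME w. w \<in> carrier W \<and> g w = w')" for w'
  have i: "i v' \<in> carrier V \<and> f (i v') = v'" if "v' \<in> carrier V'" for v'
    unfolding i_def by (rule someI_ex) (use f'[OF that] in blast)
  have j: "j w' \<in> carrier W \<and> g (j w') = w'" if "w' \<in> carrier W'" for w'
    unfolding j_def by (rule someI_ex) (use g'[OF that] in blast)
  define k where "k v' w' = \<pi> (p.pure (i v') (j w'))" for v' w'
  have k: "k (f v) (g w) = \<pi> (p.pure v w)" if v: "v \<in> carrier V" and w: "w \<in> carrier W" for v w
  proof -
    let ?v = "i (f v)" and ?w = "j (g w)"
    have c: "?v \<in> carrier V" "f ?v = f v" "?w \<in> carrier W" "g ?w = g w"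
      using i[of "f v"] j[of "g w"] v w by auto
    have m: "?w \<ominus>\<^bsub>W\<^esub> w \<in> carrier W" "g (?w \<ominus>\<^bsub>W\<^esub> w) = \<zero>\<^bsub>W'\<^esub>"
      "?v \<ominus>\<^bsub>V\<^esub> v \<in> carrier V" "f (?v \<ominus>\<^bsub>V\<^esub> v) = \<zero>\<^bsub>V'\<^esub>"
      using c v w add_map_minus[OF p.V.abelian_group_axioms p'.V.abelian_group_axioms f(1)]
        add_map_minus[OF p.W.abelian_group_axioms p'.W.abelian_group_axioms g(1)]
      by (auto simp: p'.V.minus_self p'.W.minus_self)
    \<comment> \<open>Changing the factors one at a time writes \<open>?v\<close> \<otimes>
      \<open>?w\<close> - \<open>v\<close> \<otimes> \<open>w\<close> as a sum of two tensors, each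
      with one factor in a kernel.\<close>
    have "p.pure ?v (?w \<ominus>\<^bsub>W\<^esub> w) \<oplus>\<^bsub>p.T\<^esub> p.pure (?v \<ominus>\<^bsub>V\<^esub> v) w \<in> M"
      unfolding M_def by (intro p.T.gen_add p.T.gen_incl) (use c v w m in blast)+
    also have "p.pure ?v (?w \<ominus>\<^bsub>W\<^esub> w) = p.pure ?v ?w \<ominus>\<^bsub>p.T\<^esub> p.pure ?v w"
      using c w v abelian_group_hom.hom_a_inv[OF p.pure_hom_right[OF c(1)]]
      by (simp add: a_minus_def p.pure_add_right)
    also have "p.pure (?v \<ominus>\<^bsub>V\<^esub> v) w = p.pure ?v w \<ominus>\<^bsub>p.T\<^esub> p.pure v w"
      using c w v by (simp add: a_minus_def p.pure_add_left p.pure_a_inv_left)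
    also have "p.pure ?v ?w \<ominus>\<^bsub>p.T\<^esub> p.pure ?v w \<oplus>\<^bsub>p.T\<^esub> (p.pure ?v w \<ominus>\<^bsub>p.T\<^esub> p.pure v w) =
        p.pure ?v ?w \<ominus>\<^bsub>p.T\<^esub> p.pure v w"
      using c w v by (simp add: a_minus_def p.T.a_assoc p.T.r_neg1)
    finally show ?thesis
      unfolding k_def using c v w by (intro \<pi>_eq) auto
  qed
  have kb: "balanced V' W' S' r' l' A k"
    unfolding balanced_def
  proof (intro conjI ballI add_mapI)
    fix v' w' assume *: "v' \<in> carrier V'" "w' \<in> carrier W'"
    show "k v' w' \<in> carrier A" "k v' w' \<in> carrier A"
      unfolding k_def using * i j by (auto intro!: add_map_closed[OF \<pi>])
  next
    fix v1 v2 w' assume "v1 \<in> carrier V'" "v2 \<in> carrier V'" "w' \<in> carrier W'"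
    then obtain a b w where "a \<in> carrier V" "b \<in> carrier V" "w \<in> carrier W" "v1 = f a" "v2 = f b" "w' = g w"
      using f' g' by meson
    then show "k (v1 \<oplus>\<^bsub>V'\<^esub> v2) w' = k v1 w' \<oplus>\<^bsub>A\<^esub> k v2 w'"
      using k[of "a \<oplus>\<^bsub>V\<^esub> b" w] by (simp add: k p.pure_add_left add_map_add[OF \<pi>])
  next
    fix v' w1 w2 assume "v' \<in> carrier V'" "w1 \<in> carrier W'" "w2 \<in> carrier W'"
    then obtain v a b where "v \<in> carrier V" "a \<in> carrier W" "b \<in> carrier W" "v' = f v" "w1 = g a" "w2 = g b"
      using f' g' by meson
    then show "k v' (w1 \<oplus>\<^bsub>W'\<^esub> w2) = k v' w1 \<oplus>\<^bsub>A\<^esub> k v' w2"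
      using k[of v "a \<oplus>\<^bsub>W\<^esub> b"] by (simp add: k p.pure_add_right add_map_add[OF \<pi>])
  next
    fix v' s' w' assume "v' \<in> carrier V'" "s' \<in> S'" "w' \<in> carrier W'"
    then obtain v w where vw: "v \<in> carrier V" "w \<in> carrier W" "v' = f v" "w' = g w"
      using f' g' by meson
    obtain s where s: "s \<in> S" "f (r v s) = r' v' s'" "g (l s w) = l' s' w'"
      using s[OF \<open>s' \<in> S'\<close>] vw by blast
    show "k (r' v' s') w' = k v' (l' s' w')"
      using k[of "r v s" w] k[of v "l s w"] s vw
      by (simp add: p.r_closed p.l_closed p.pure_bal)
  qed
  have "tensor_lift A k (h t) = \<pi> t"
    by (rule p.add_map_eqI[OF add_map_comp[OF h(1) p'.add_map_lift[OF A.abelian_group_axioms kb]] \<pi> t(1)])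
      (simp add: h(2) p'.lift_pure[OF A.abelian_group_axioms kb] k)
  then have "\<pi> t = \<zero>\<^bsub>A\<^esub>"
    using t(2) add_map_zero[OF p'.T.abelian_group_axioms A.abelian_group_axioms
      p'.add_map_lift[OF A.abelian_group_axioms kb]] by simp
  then have "M +>\<^bsub>p.T\<^esub> t = M" by (simp add: \<pi>_def A_def FactRing_def)
  then show ?thesis using M.a_rcos_self[OF t(1)] by (simp add: M_def)
qed

section \<open>Tensor products over a commutative ring\<close>

text \<open>The target is a bare abelian group: the balanced tensor product over the coinvariants
  has no scalar action, and many lifts take values there.\<close>

definition bilin :: "('k, 'r) ring_scheme \<Rightarrow> ('k, 'v, 'm) module_scheme \<Rightarrow>
    ('k, 'w, 'n) module_scheme \<Rightarrow> ('a, 'l) ring_scheme \<Rightarrow> ('v \<Rightarrow> 'w \<Rightarrow> 'a) \<Rightarrow> bool" where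
  "bilin K V W A f = balanced V W (carrier K) (\<lambda>v a. a \<odot>\<^bsub>V\<^esub> v) (\<lambda>a w. a \<odot>\<^bsub>W\<^esub> w) A f"

lemma bilinI:
  assumes "\<And>v w. v \<in> carrier V \<Longrightarrow> w \<in> carrier W \<Longrightarrow> f v w \<in> carrier A"
    and "\<And>v v' w. v \<in> carrier V \<Longrightarrow> v' \<in> carrier V \<Longrightarrow> w \<in> carrier W \<Longrightarrow>
      f (v \<oplus>\<^bsub>V\<^esub> v') w = f v w \<oplus>\<^bsub>A\<^esub> f v' w"
    and "\<And>v w w'. v \<in> carrier V \<Longrightarrow> w \<in> carrier W \<Longrightarrow> w' \<in> carrier W \<Longrightarrow>
      f v (w \<oplus>\<^bsub>W\<^esub> w') = f v w \<oplus>\<^bsub>A\<^esub> f v w'"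
    and "\<And>a v w. a \<in> carrier K \<Longrightarrow> v \<in> carrier V \<Longrightarrow> w \<in> carrier W \<Longrightarrow>
      f (a \<odot>\<^bsub>V\<^esub> v) w = f v (a \<odot>\<^bsub>W\<^esub> w)"
  shows "bilin K V W A f"
  using assms by (simp add: bilin_def balanced_def add_map_def)

lemma bilinD:
  assumes "bilin K V W A f"
  shows "v \<in> carrier V \<Longrightarrow> w \<in> carrier W \<Longrightarrow> f v w \<in> carrier A"
    and "v \<in> carrier V \<Longrightarrow> v' \<in> carrier V \<Longrightarrow> w \<in> carrier W \<Longrightarrow>
      f (v \<oplus>\<^bsub>V\<^esub> v') w = f v w \<oplus>\<^bsub>A\<^esub> f v' w"
    and "v \<in> carrier V \<Longrightarrow> w \<in> carrier W \<Longrightarrow> w' \<in> carrier W \<Longrightarrow>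
      f v (w \<oplus>\<^bsub>W\<^esub> w') = f v w \<oplus>\<^bsub>A\<^esub> f v w'"
    and "a \<in> carrier K \<Longrightarrow> v \<in> carrier V \<Longrightarrow> w \<in> carrier W \<Longrightarrow>
      f (a \<odot>\<^bsub>V\<^esub> v) w = f v (a \<odot>\<^bsub>W\<^esub> w)"
  using assms by (simp_all add: bilin_def balanced_def add_map_def)

lemma linear_mapsD:
  assumes "h \<in> linear_maps K V W"
  shows "v \<in> carrier V \<Longrightarrow> h v \<in> carrier W"
    and "v \<in> carrier V \<Longrightarrow> v' \<in> carrier V \<Longrightarrow> h (v \<oplus>\<^bsub>V\<^esub> v') = h v \<oplus>\<^bsub>W\<^esub> h v'"
    and "a \<in> carrier K \<Longrightarrow> v \<in> carrier V \<Longrightarrow> h (a \<odot>\<^bsub>V\<^esub> v) = a \<odot>\<^bsub>W\<^esub> h v"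
  using assms by (auto simp: linear_maps_def)

lemma linear_add_map: "h \<in> linear_maps K V W \<Longrightarrow> add_map V W h"
  by (auto simp: linear_maps_def add_map_def)

lemma linear_maps_id: "(\<lambda>v. v) \<in> linear_maps K V V"
  by (auto simp: linear_maps_def)

lemma bilin_comp:
  assumes "bilin K V W A f" "h \<in> linear_maps K V' V" "g \<in> linear_maps K W' W"
  shows "bilin K V' W' A (\<lambda>x y. f (h x) (g y))"
  by (rule bilinI) (simp_all add: bilinD[OF assms(1)] linear_mapsD[OF assms(2)] linear_mapsD[OF assms(3)])

lemma bilin_add_map: "bilin K V W A f \<Longrightarrow> add_map A A' h \<Longrightarrow> bilin K V W A' (\<lambda>v w. h (f v w))"
  by (simp add: bilin_def balanced_def add_map_def)

text \<open>Serves to identify spans in \<open>tensor\<close> with spans in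
  \<open>bal_tensor\<close>, two records with the same additive group.\<close>

lemma generate_cong:
  assumes "carrier G = carrier H" "monoid.mult G = monoid.mult H" "one G = one H"
  shows "generate G Z = generate H Z"
proof -
  have inv: "m_inv G = m_inv H" by (simp add: m_inv_def fun_eq_iff assms)
  have "x \<in> generate H Z" if "x \<in> generate G Z" for x
    using that by induction (auto simp: assms inv intro: generate.intros)
  moreover have "x \<in> generate G Z" if "x \<in> generate H Z" for x
    using that by induction (auto simp flip: assms inv intro: generate.intros)
  ultimately show ?thesis by blast
qed

locale module_pair = V: module K V + W: module K W
  for K :: "('k, 'r) ring_scheme" (structure) and V :: "('k, 'v, 'm) module_scheme" (structure)
    and W :: "('k, 'w, 'n) module_scheme" (structure)
begin

sublocale b: bal_pair V W "carrier K" "\<lambda>v a. a \<odot>\<^bsub>V\<^esub> v" "\<lambda>a w. a \<odot>\<^bsub>W\<^esub> w"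
  by unfold_locales auto

abbreviation TT where "TT \<equiv> tensor K V W"
abbreviation pu where "pu \<equiv> tensor_pure K V W"

lemma pu_eq: "pu = b.pure"
  by (simp add: fun_eq_iff tensor_pure_def)

lemma tensor_simps: "carrier TT = carrier b.T" "ring.add TT = ring.add b.T" "ring.zero TT = ring.zero b.T"
  by (simp_all add: tensor_def Let_def)

lemma add_map_TT: "add_map TT A h \<longleftrightarrow> add_map b.T A h" "add_map B TT k \<longleftrightarrow> add_map B b.T k"
  by (simp_all add: add_map_def tensor_simps)

lemma generate_TT: "generate (add_monoid TT) Z = generate (add_monoid b.T) Z"
  by (rule generate_cong) (simp_all add: tensor_simps)

lemma abelian_TT: "abelian_group TT"
proof (rule abelian_groupI)
  fix x assume "x \<in> carrier TT"
  then show "\<exists>y\<in>carrier TT. y \<oplus>\<^bsub>TT\<^esub> x = \<zero>\<^bsub>TT\<^esub>"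
    unfolding tensor_simps by (intro bexI[of _ "\<ominus>\<^bsub>b.T\<^esub> x"]) (simp_all add: b.T.l_neg)
qed (simp_all add: tensor_simps b.T.a_ac)

sublocale TT: abelian_group TT
  by (rule abelian_TT)

lemma pu_closed [simp, intro]: "v \<in> carrier V \<Longrightarrow> w \<in> carrier W \<Longrightarrow> pu v w \<in> carrier TT"
  by (simp add: pu_eq tensor_simps)

lemma pu_add_left: "v \<in> carrier V \<Longrightarrow> v' \<in> carrier V \<Longrightarrow> w \<in> carrier W \<Longrightarrow>
    pu (v \<oplus>\<^bsub>V\<^esub> v') w = pu v w \<oplus>\<^bsub>TT\<^esub> pu v' w"
  by (simp add: pu_eq tensor_simps b.pure_add_left)

lemma pu_add_right: "v \<in> carrier V \<Longrightarrow> w \<in> carrier W \<Longrightarrow> w' \<in> carrier W \<Longrightarrow>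
    pu v (w \<oplus>\<^bsub>W\<^esub> w') = pu v w \<oplus>\<^bsub>TT\<^esub> pu v w'"
  by (simp add: pu_eq tensor_simps b.pure_add_right)

lemma pu_smult: "v \<in> carrier V \<Longrightarrow> w \<in> carrier W \<Longrightarrow> a \<in> carrier K \<Longrightarrow>
    pu v (a \<odot>\<^bsub>W\<^esub> w) = pu (a \<odot>\<^bsub>V\<^esub> v) w"
  by (simp add: pu_eq b.pure_bal)

lemma bilin_pu: "bilin K V W TT pu"
  by (rule bilinI) (simp_all add: pu_add_left pu_add_right pu_smult)

lemma TT_induct [consumes 1, case_names pure add]:
  assumes "t \<in> carrier TT"
    and "\<And>v w. v \<in> carrier V \<Longrightarrow> w \<in> carrier W \<Longrightarrow> Q (pu v w)"
    and "\<And>x y. x \<in> carrier TT \<Longrightarrow> y \<in> carrier TT \<Longrightarrow> Q x \<Longrightarrow> Q y \<Longrightarrow> Q (x \<oplus>\<^bsub>TT\<^esub> y)"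
  shows "Q t"
  using assms unfolding tensor_simps pu_eq by (rule b.T_induct)

lemma lift_pu [simp]:
  "abelian_group A \<Longrightarrow> bilin K V W A f \<Longrightarrow> v \<in> carrier V \<Longrightarrow> w \<in> carrier W \<Longrightarrow>
    tensor_lift A f (pu v w) = f v w"
  by (simp add: pu_eq bilin_def)

lemma lift_add_map:
  "abelian_group A \<Longrightarrow> bilin K V W A f \<Longrightarrow> add_map TT A (tensor_lift A f)"
  unfolding add_map_TT bilin_def by (rule b.add_map_lift)

lemma TT_eqI:
  assumes "add_map TT A g" "add_map TT A h" "t \<in> carrier TT"
    and "\<And>v w. v \<in> carrier V \<Longrightarrow> w \<in> carrier W \<Longrightarrow> g (pu v w) = h (pu v w)"
  shows "g t = h t"
  using assms unfolding add_map_TT tensor_simps pu_eq by (rule b.add_map_eqI)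

lemma lift_TT_comp:
  assumes "abelian_group A" "bilin K V W A f" "abelian_group A'" "add_map A A' h" "t \<in> carrier TT"
  shows "h (tensor_lift A f t) = tensor_lift A' (\<lambda>v w. h (f v w)) t"
  using assms unfolding bilin_def tensor_simps by (rule b.lift_comp)

lemma lift_TT_cong:
  assumes "abelian_group A" "bilin K V W A g" "t \<in> carrier TT"
    and "\<And>v w. v \<in> carrier V \<Longrightarrow> w \<in> carrier W \<Longrightarrow> f v w = g v w"
  shows "tensor_lift A f t = tensor_lift A g t"
  using assms unfolding bilin_def tensor_simps by (rule b.lift_cong)

lemma bilin_smult: "a \<in> carrier K \<Longrightarrow> bilin K V W b.T (\<lambda>v w. pu (a \<odot>\<^bsub>V\<^esub> v) w)"
  by (rule bilinI)
    (auto simp: V.smult_r_distr pu_add_left pu_add_right pu_smult tensor_simps(1)[symmetric]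
      tensor_simps(2)[symmetric] V.smult_assoc1[symmetric] V.R.m_comm)

lemma smult_TT: "smult TT a = tensor_lift b.T (\<lambda>v w. pu (a \<odot>\<^bsub>V\<^esub> v) w)"
  by (simp add: tensor_def Let_def)

lemma smult_pu [simp]:
  "a \<in> carrier K \<Longrightarrow> v \<in> carrier V \<Longrightarrow> w \<in> carrier W \<Longrightarrow> a \<odot>\<^bsub>TT\<^esub> pu v w = pu (a \<odot>\<^bsub>V\<^esub> v) w"
  by (simp add: smult_TT b.T.abelian_group_axioms bilin_smult)

lemma add_map_smult: "a \<in> carrier K \<Longrightarrow> add_map TT TT (smult TT a)"
  unfolding smult_TT add_map_TT(2)
  by (rule lift_add_map[OF b.T.abelian_group_axioms bilin_smult])

lemma module_TT: "module K TT"
proof (rule moduleI)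
  show "cring K" by (rule V.is_cring)
  show "abelian_group TT" by (rule abelian_TT)
  fix a x assume a: "a \<in> carrier K" and x: "x \<in> carrier TT"
  show ax: "a \<odot>\<^bsub>TT\<^esub> x \<in> carrier TT" using add_map_closed[OF add_map_smult[OF a] x] .
next
  fix a x y assume "a \<in> carrier K" "x \<in> carrier TT" "y \<in> carrier TT"
  then show "a \<odot>\<^bsub>TT\<^esub> (x \<oplus>\<^bsub>TT\<^esub> y) = a \<odot>\<^bsub>TT\<^esub> x \<oplus>\<^bsub>TT\<^esub> a \<odot>\<^bsub>TT\<^esub> y"
    by (rule add_map_add[OF add_map_smult])
next
  fix a b x assume ab: "a \<in> carrier K" "b \<in> carrier K" and "x \<in> carrier TT"
  from this(3) show "(a \<oplus>\<^bsub>K\<^esub> b) \<odot>\<^bsub>TT\<^esub> x = a \<odot>\<^bsub>TT\<^esub> x \<oplus>\<^bsub>TT\<^esub> b \<odot>\<^bsub>TT\<^esub> x"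
  proof (induction x rule: TT_induct)
    case (add x y)
    then show ?case
      using ab by (simp add: add_map_add[OF add_map_smult] add_map_closed[OF add_map_smult] TT.a_ac)
  qed (use ab in \<open>simp add: V.smult_l_distr pu_add_left\<close>)
next
  fix a b x assume ab: "a \<in> carrier K" "b \<in> carrier K" and "x \<in> carrier TT"
  from this(3) show "(a \<otimes>\<^bsub>K\<^esub> b) \<odot>\<^bsub>TT\<^esub> x = a \<odot>\<^bsub>TT\<^esub> (b \<odot>\<^bsub>TT\<^esub> x)"
    by (induction x rule: TT_induct)
      (use ab in \<open>auto simp: V.smult_assoc1 add_map_add[OF add_map_smult] add_map_closed[OF add_map_smult]\<close>)
next
  fix x assume "x \<in> carrier TT"
  then show "\<one>\<^bsub>K\<^esub> \<odot>\<^bsub>TT\<^esub> x = x"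
    by (induction x rule: TT_induct) (auto simp: add_map_add[OF add_map_smult])
qed

lemma lift_smult:
  assumes A: "abelian_group A" "bilin K V W A f" and a: "a \<in> carrier K" and t: "t \<in> carrier TT"
  shows "tensor_lift A f (a \<odot>\<^bsub>TT\<^esub> t) = tensor_lift A (\<lambda>v w. f (a \<odot>\<^bsub>V\<^esub> v) w) t"
proof -
  have b: "bilin K V W A (\<lambda>v w. f (a \<odot>\<^bsub>V\<^esub> v) w)"
    by (rule bilinI)
      (use a in \<open>auto simp: bilinD[OF A(2)] V.smult_r_distr W.smult_r_distr W.smult_assoc1[symmetric] V.R.m_comm\<close>)
  show ?thesis
    by (rule TT_eqI[OF add_map_comp[OF add_map_smult[OF a] lift_add_map[OF A]] lift_add_map[OF A(1) b] t])
      (simp add: A a b)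
qed

end

section \<open>Trilinear maps and coassociativity in Sweedler form\<close>

definition trilin :: "('k, 'r) ring_scheme \<Rightarrow> ('k, 'u, 'm) module_scheme \<Rightarrow> ('k, 'v, 'n) module_scheme \<Rightarrow>
    ('k, 'w, 'o) module_scheme \<Rightarrow> ('a, 'l) ring_scheme \<Rightarrow> ('u \<Rightarrow> 'v \<Rightarrow> 'w \<Rightarrow> 'a) \<Rightarrow> bool" where
  "trilin K U V W A f \<longleftrightarrow> (\<forall>u\<in>carrier U. bilin K V W A (f u)) \<and>
     (\<forall>w\<in>carrier W. bilin K U V A (\<lambda>u v. f u v w))"

text \<open>Maps out of an iterated tensor product are lifted in two stages. Additivity in the outer
  variable passes through the inner lift because additive maps that agree on pure tensors agree
  everywhere.\<close>

lemma trilin_lift_left: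
  assumes m: "module K U" "module K V" "module K W" and A: "abelian_group A" and f: "trilin K U V W A f"
  shows "bilin K (tensor K U V) W A (\<lambda>t w. tensor_lift A (\<lambda>u v. f u v w) t)"
proof -
  interpret UV: module_pair K U V by (intro module_pair.intro m)
  interpret W: module K W by (rule m)
  interpret A: abelian_group A by (rule A)
  have 1: "w \<in> carrier W \<Longrightarrow> bilin K U V A (\<lambda>u v. f u v w)" for w using f by (simp add: trilin_def)
  have 2: "u \<in> carrier U \<Longrightarrow> bilin K V W A (f u)" for u using f by (simp add: trilin_def)
  note L = UV.lift_add_map[OF A 1]
  show ?thesis
  proof (rule bilinI)
    fix t w w' assume t: "t \<in> carrier UV.TT" and w: "w \<in> carrier W" "w' \<in> carrier W"
    show "tensor_lift A (\<lambda>u v. f u v (w \<oplus>\<^bsub>W\<^esub> w')) t =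
        tensor_lift A (\<lambda>u v. f u v w) t \<oplus>\<^bsub>A\<^esub> tensor_lift A (\<lambda>u v. f u v w') t"
      by (rule UV.TT_eqI[OF L _ t])
        (use w in \<open>auto intro!: add_mapI simp: A.a_ac add_map_closed[OF L] add_map_add[OF L] A 1 bilinD[OF 2]\<close>)
  next
    fix a t w assume a: "a \<in> carrier K" and t: "t \<in> carrier UV.TT" and w: "w \<in> carrier W"
    show "tensor_lift A (\<lambda>u v. f u v w) (a \<odot>\<^bsub>UV.TT\<^esub> t) = tensor_lift A (\<lambda>u v. f u v (a \<odot>\<^bsub>W\<^esub> w)) t"
      using a w by (subst UV.lift_smult[OF A 1 a t])
        (auto intro!: UV.lift_TT_cong[OF A 1 t] simp: bilinD[OF 1] bilinD[OF 2])
  qed (simp_all add: add_map_closed[OF L] add_map_add[OF L])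
qed

lemma trilin_lift_right:
  assumes m: "module K U" "module K V" "module K W" and A: "abelian_group A" and f: "trilin K U V W A f"
  shows "bilin K U (tensor K V W) A (\<lambda>u t. tensor_lift A (f u) t)"
proof -
  interpret VW: module_pair K V W by (intro module_pair.intro m)
  interpret U: module K U by (rule m)
  interpret A: abelian_group A by (rule A)
  have 1: "w \<in> carrier W \<Longrightarrow> bilin K U V A (\<lambda>u v. f u v w)" for w using f by (simp add: trilin_def)
  have 2: "u \<in> carrier U \<Longrightarrow> bilin K V W A (f u)" for u using f by (simp add: trilin_def)
  note L = VW.lift_add_map[OF A 2]
  show ?thesis
  proof (rule bilinI)
    fix u u' t assume t: "t \<in> carrier VW.TT" and u: "u \<in> carrier U" "u' \<in> carrier U"
    show "tensor_lift A (f (u \<oplus>\<^bsub>U\<^esub> u')) t = tensor_lift A (f u) t \<oplus>\<^bsub>A\<^esub> tensor_lift A (f u') t"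
      by (rule VW.TT_eqI[OF L _ t])
        (use u in \<open>auto intro!: add_mapI simp: A.a_ac add_map_closed[OF L] add_map_add[OF L] A 2 bilinD[OF 1]\<close>)
  next
    fix a u t assume a: "a \<in> carrier K" and t: "t \<in> carrier VW.TT" and u: "u \<in> carrier U"
    have "tensor_lift A (f u) (a \<odot>\<^bsub>VW.TT\<^esub> t) = tensor_lift A (\<lambda>v w. f u (a \<odot>\<^bsub>V\<^esub> v) w) t"
      by (rule VW.lift_smult[OF A 2[OF u] a t])
    also have "\<dots> = tensor_lift A (f (a \<odot>\<^bsub>U\<^esub> u)) t"
      using a u by (intro VW.lift_TT_cong[OF A 2 t]) (auto simp: bilinD[OF 1])
    finally show "tensor_lift A (f (a \<odot>\<^bsub>U\<^esub> u)) t = tensor_lift A (f u) (a \<odot>\<^bsub>VW.TT\<^esub> t)" by simp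
  qed (simp_all add: add_map_closed[OF L] add_map_add[OF L])
qed

lemma trilin_pure:
  assumes m: "module K U" "module K V" "module K W"
  shows "trilin K U V W (tensor K U (tensor K V W))
    (\<lambda>u v w. tensor_pure K U (tensor K V W) u (tensor_pure K V W v w))"
proof -
  interpret VW: module_pair K V W by (intro module_pair.intro m)
  interpret UVW: module_pair K U "tensor K V W" by (intro module_pair.intro m VW.module_TT)
  show ?thesis
    unfolding trilin_def
    by (auto intro!: bilinI simp: UVW.pu_add_left UVW.pu_add_right VW.pu_add_left VW.pu_add_right VW.pu_smult)
       (auto simp: VW.smult_pu[symmetric] UVW.pu_smult simp del: VW.smult_pu)
qed

sublocale coalgebra \<subseteq> CC: module_pair K C C ..

context right_comodule
begin

sublocale VC: module_pair K V C ..

lemma sweedler_trilin: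
  assumes A: "abelian_group A" and f: "trilin K V C C A f"
  shows "bilin K V C A (\<lambda>w c. tensor_lift A (\<lambda>w' c'. f w' c' c) (\<rho> w))"
    and "bilin K V C A (\<lambda>w c. tensor_lift A (f w) (comult C c))"
   apply (rule bilin_comp[OF trilin_lift_left[OF _ _ _ A f] coact_linear linear_maps_id]; unfold_locales)
  apply (rule bilin_comp[OF trilin_lift_right[OF _ _ _ A f] linear_maps_id comult_linear]; unfold_locales)
  done

text \<open>Both sides are values of the map V \<otimes> (C \<otimes> C) \<rightarrow> A induced by
  \<open>f\<close>, taken at the two members of the coassociativity axiom. This is what permits
  writing f(v0, v1, v2) without brackets.\<close>

lemma sweedler_coassoc:
  assumes A: "abelian_group A" and f: "trilin K V C C A f" and v: "v \<in> carrier V"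
  shows "tensor_lift A (\<lambda>w c. tensor_lift A (\<lambda>w' c'. f w' c' c) (\<rho> w)) (\<rho> v) =
    tensor_lift A (\<lambda>w c. tensor_lift A (f w) (comult C c)) (\<rho> v)"
proof -
  have mV: "module K V" and mC: "module K C" by unfold_locales
  interpret VCC: module_pair K V CC.TT by (intro module_pair.intro mV CC.module_TT)
  interpret VC_C: module_pair K VC.TT C by (intro module_pair.intro mC VC.module_TT)
  define G where "G = tensor_lift A (\<lambda>w t. tensor_lift A (f w) t)"
  have Gb: "bilin K V CC.TT A (\<lambda>w t. tensor_lift A (f w) t)"
    by (rule trilin_lift_right[OF mV mC mC A f])
  have G: "add_map VCC.TT A G"
    unfolding G_def by (rule VCC.lift_add_map[OF A Gb])
  have s: "\<rho> v \<in> carrier VC.TT" using coact_linear v by (rule linear_mapsD)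
  have 2: "w \<in> carrier V \<Longrightarrow> bilin K C C A (f w)" for w using f by (simp add: trilin_def)
  have 1: "c \<in> carrier C \<Longrightarrow> bilin K V C A (\<lambda>w c'. f w c' c)" for c using f by (simp add: trilin_def)
  have "G (tensor_map K V CC.TT (\<lambda>w. w) (comult C) (\<rho> v)) =
      tensor_lift A (\<lambda>w c. G (VCC.pu w (comult C c))) (\<rho> v)"
    unfolding tensor_map_def
    by (rule VC.lift_TT_comp[OF VCC.abelian_TT _ A G s])
      (rule bilin_comp[OF VCC.bilin_pu linear_maps_id comult_linear])
  also have "\<dots> = tensor_lift A (\<lambda>w c. tensor_lift A (f w) (comult C c)) (\<rho> v)"
    by (rule VC.lift_TT_cong[OF A sweedler_trilin(2)[OF A f] s])
      (simp add: G_def A Gb linear_mapsD[OF comult_linear])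
  finally have R: "G (tensor_map K V CC.TT (\<lambda>w. w) (comult C) (\<rho> v)) = \<dots>" .
  \<comment> \<open>On the other side the associator intervenes; it turns \<rho>(w) \<otimes> c into
    the sum of the u \<otimes> (v \<otimes> c), where \<rho>(w) is the sum of the u \<otimes>
    v.\<close>
  define as where "as = tensor_assoc K V C C"
  have asb: "bilin K VC.TT C VCC.TT (\<lambda>t c. tensor_lift VCC.TT (\<lambda>u v. VCC.pu u (CC.pu v c)) t)"
    by (rule trilin_lift_left[OF mV mC mC VCC.abelian_TT trilin_pure[OF mV mC mC]])
  have as: "add_map VC_C.TT VCC.TT as"
    unfolding as_def tensor_assoc_def Let_def
    by (rule VC_C.lift_add_map[OF VCC.abelian_TT asb])
  have "G (as (tensor_map K VC.TT C \<rho> (\<lambda>c. c) (\<rho> v))) =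
     tensor_lift A (\<lambda>w c. G (as (VC_C.pu (\<rho> w) c))) (\<rho> v)"
    unfolding tensor_map_def
    by (rule VC.lift_TT_comp[OF VC_C.abelian_TT _ A add_map_comp[OF as G] s])
      (rule bilin_comp[OF VC_C.bilin_pu coact_linear linear_maps_id])
  also have "\<dots> = tensor_lift A (\<lambda>w c. tensor_lift A (\<lambda>w' c'. f w' c' c) (\<rho> w)) (\<rho> v)"
  proof (rule VC.lift_TT_cong[OF A sweedler_trilin(1)[OF A f] s])
    fix w c assume w: "w \<in> carrier V" and c: "c \<in> carrier C"
    have t: "\<rho> w \<in> carrier VC.TT" using coact_linear w by (rule linear_mapsD)
    have "as (VC_C.pu (\<rho> w) c) = tensor_lift VCC.TT (\<lambda>u v. VCC.pu u (CC.pu v c)) (\<rho> w)"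
      unfolding as_def tensor_assoc_def Let_def
      by (rule VC_C.lift_pu[OF VCC.abelian_TT asb t c])
    also have "G \<dots> = tensor_lift A (\<lambda>u v. G (VCC.pu u (CC.pu v c))) (\<rho> w)"
      by (rule VC.lift_TT_comp[OF VCC.abelian_TT _ A G t])
        (use trilin_pure[OF mV mC mC] c in \<open>simp add: trilin_def\<close>)
    also have "\<dots> = tensor_lift A (\<lambda>w' c'. f w' c' c) (\<rho> w)"
      by (rule VC.lift_TT_cong[OF A 1 t]) (use c in \<open>simp_all add: G_def A Gb 2\<close>)
    finally show "G (as (VC_C.pu (\<rho> w) c)) = tensor_lift A (\<lambda>w' c'. f w' c' c) (\<rho> w)" .
  qed
  finally show ?thesis
    using R coact_coassoc[OF v] by (simp add: as_def)
qed

end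

text \<open>With C coacting on itself, the Sweedler rule for coactions also covers iterated
  comultiplication.\<close>

sublocale coalgebra \<subseteq> self: right_comodule K C C "comult C"
  by unfold_locales (simp_all add: comult_linear coassoc counit_right)

section \<open>Comodule algebras\<close>

definition tpure :: "('p, 'm) ring_scheme \<Rightarrow> 'p set \<Rightarrow> 'p \<Rightarrow> 'p \<Rightarrow> ('p, 'p) tens" where
  "tpure P B = bal_pure P P B (monoid.mult P) (monoid.mult P)"

context comodule_algebra
begin

abbreviation B where "B \<equiv> coinvariants K C P"
abbreviation PT where "PT \<equiv> tensor_over P B"
abbreviation pp where "pp \<equiv> tpure P B"
abbreviation PC where "PC \<equiv> tensor K P C"

lemma coact_closed: "p \<in> carrier P \<Longrightarrow> coact P p \<in> carrier PC"
  using linear_mapsD(1)[OF coact_linear] .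

lemma coact_add: "p \<in> carrier P \<Longrightarrow> q \<in> carrier P \<Longrightarrow> coact P (p \<oplus>\<^bsub>P\<^esub> q) = coact P p \<oplus>\<^bsub>PC\<^esub> coact P q"
  using linear_mapsD(2)[OF coact_linear] .

lemma coact_add_map: "add_map P PC (coact P)"
  by (rule linear_add_map[OF coact_linear])

lemma bilin_left_act: "b \<in> carrier P \<Longrightarrow> bilin K P C PC (\<lambda>p c. VC.pu (b \<otimes>\<^bsub>P\<^esub> p) c)"
  by (rule bilinI) (simp_all add: VC.pu_add_left VC.pu_add_right A.r_distr VC.pu_smult A.smult_mult_right)

lemma left_act_add_map: "b \<in> carrier P \<Longrightarrow> add_map PC PC (left_act K C P b)"
  unfolding left_act_def tensor_map_def by (rule VC.lift_add_map[OF VC.abelian_TT bilin_left_act])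

lemma left_act_closed: "b \<in> carrier P \<Longrightarrow> t \<in> carrier PC \<Longrightarrow> left_act K C P b t \<in> carrier PC"
  by (rule add_map_closed[OF left_act_add_map])

lemma left_act_add: "b \<in> carrier P \<Longrightarrow> t \<in> carrier PC \<Longrightarrow> t' \<in> carrier PC \<Longrightarrow>
    left_act K C P b (t \<oplus>\<^bsub>PC\<^esub> t') = left_act K C P b t \<oplus>\<^bsub>PC\<^esub> left_act K C P b t'"
  by (rule add_map_add[OF left_act_add_map])

lemma left_act_pu: "b \<in> carrier P \<Longrightarrow> p \<in> carrier P \<Longrightarrow> c \<in> carrier C \<Longrightarrow>
    left_act K C P b (VC.pu p c) = VC.pu (b \<otimes>\<^bsub>P\<^esub> p) c"
  unfolding left_act_def tensor_map_def by (rule VC.lift_pu[OF VC.abelian_TT bilin_left_act])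

lemma left_act_add_left: 
  assumes "b \<in> carrier P" "b' \<in> carrier P" "t \<in> carrier PC"
  shows "left_act K C P (b \<oplus>\<^bsub>P\<^esub> b') t = left_act K C P b t \<oplus>\<^bsub>PC\<^esub> left_act K C P b' t"
  using assms(3)
  by (induction t rule: VC.TT_induct)
    (use assms(1,2) in \<open>simp_all add: left_act_pu left_act_add left_act_closed A.l_distr VC.pu_add_left VC.TT.a_ac\<close>)

lemma left_act_mult:
  assumes "b \<in> carrier P" "b' \<in> carrier P" "t \<in> carrier PC"
  shows "left_act K C P (b \<otimes>\<^bsub>P\<^esub> b') t = left_act K C P b (left_act K C P b' t)"
  using assms(3)
  by (induction t rule: VC.TT_induct)
    (use assms(1,2) in \<open>simp_all add: left_act_pu left_act_add left_act_closed A.m_assoc\<close>)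

lemma left_act_one: "t \<in> carrier PC \<Longrightarrow> left_act K C P \<one>\<^bsub>P\<^esub> t = t"
  by (induction t rule: VC.TT_induct) (simp_all add: left_act_pu left_act_add)

lemma left_act_smult_one:
  assumes "a \<in> carrier K" "t \<in> carrier PC"
  shows "left_act K C P (a \<odot>\<^bsub>P\<^esub> \<one>\<^bsub>P\<^esub>) t = a \<odot>\<^bsub>PC\<^esub> t"
  using assms(2)
  by (induction t rule: VC.TT_induct)
    (use assms(1) in \<open>simp_all add: left_act_pu left_act_add A.smult_mult_left add_map_add[OF VC.add_map_smult]\<close>)

lemma coinv_closed: "b \<in> B \<Longrightarrow> b \<in> carrier P"
  by (simp add: coinvariants_def)

lemma coinv_coact: "b \<in> B \<Longrightarrow> p \<in> carrier P \<Longrightarrow> coact P (b \<otimes>\<^bsub>P\<^esub> p) = left_act K C P b (coact P p)"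
  by (simp add: coinvariants_def)

lemma coinvI: "b \<in> carrier P \<Longrightarrow> (\<And>p. p \<in> carrier P \<Longrightarrow> coact P (b \<otimes>\<^bsub>P\<^esub> p) = left_act K C P b (coact P p)) \<Longrightarrow> b \<in> B"
  by (simp add: coinvariants_def)

lemma coinv_add: "b \<in> B \<Longrightarrow> b' \<in> B \<Longrightarrow> b \<oplus>\<^bsub>P\<^esub> b' \<in> B"
  by (rule coinvI) (simp_all add: coinv_closed A.l_distr coact_add left_act_add_left coact_closed coinv_coact)

text \<open>Linearity of the coaction makes every scalar multiple of 1 coinvariant. Hence B is a
  subspace, and balancing over B includes balancing over the ground ring, which
  \<open>pp_smult\<close> exploits.\<close>

lemma coinv_smult_one: "a \<in> carrier K \<Longrightarrow> a \<odot>\<^bsub>P\<^esub> \<one>\<^bsub>P\<^esub> \<in> B"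
  by (rule coinvI)
    (simp_all add: left_act_smult_one coact_closed A.smult_mult_left linear_mapsD(3)[OF coact_linear])

lemma coinv_mult: "b \<in> B \<Longrightarrow> b' \<in> B \<Longrightarrow> b \<otimes>\<^bsub>P\<^esub> b' \<in> B"
  by (rule coinvI) (simp_all add: coinv_closed A.m_assoc left_act_mult coact_closed coinv_coact)

lemma coinv_smult: "a \<in> carrier K \<Longrightarrow> b \<in> B \<Longrightarrow> a \<odot>\<^bsub>P\<^esub> b \<in> B"
  using coinv_mult[OF coinv_smult_one, of a b] by (simp add: coinv_closed A.smult_mult_left)

lemma coinv_one: "\<one>\<^bsub>P\<^esub> \<in> B"
  by (rule coinvI) (simp_all add: left_act_one coact_closed)

lemma coinv_subgroup: "subgroup B (add_monoid P)"
proof (rule A.add.subgroupI)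
  show "B \<subseteq> carrier P" "B \<noteq> {}" using coinv_closed coinv_one by auto
  fix b assume b: "b \<in> B"
  have "\<ominus>\<^bsub>P\<^esub> b = (\<ominus>\<^bsub>K\<^esub> \<one>\<^bsub>K\<^esub>) \<odot>\<^bsub>P\<^esub> b"
    using b coinv_closed by (simp add: A.smult_l_minus)
  then show "\<ominus>\<^bsub>P\<^esub> b \<in> B" using b by (simp add: coinv_smult)
qed (rule coinv_add)

sublocale P: bal_pair P P B "monoid.mult P" "monoid.mult P"
  by unfold_locales (auto simp: coinv_closed)

lemma PT_eq: "PT = P.T"
  by (simp add: tensor_over_def)

sublocale PT: abelian_group PT
  unfolding PT_eq by (rule P.abelian_T)

lemma pp_eq: "pp = P.pure"
  by (simp add: tpure_def)

lemma pp_closed [simp, intro]: "p \<in> carrier P \<Longrightarrow> q \<in> carrier P \<Longrightarrow> pp p q \<in> carrier PT"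
  by (simp add: PT_eq pp_eq)

lemma pp_add_left: "p \<in> carrier P \<Longrightarrow> p' \<in> carrier P \<Longrightarrow> q \<in> carrier P \<Longrightarrow>
    pp (p \<oplus>\<^bsub>P\<^esub> p') q = pp p q \<oplus>\<^bsub>PT\<^esub> pp p' q"
  by (simp add: PT_eq pp_eq P.pure_add_left)

lemma pp_add_right: "p \<in> carrier P \<Longrightarrow> q \<in> carrier P \<Longrightarrow> q' \<in> carrier P \<Longrightarrow>
    pp p (q \<oplus>\<^bsub>P\<^esub> q') = pp p q \<oplus>\<^bsub>PT\<^esub> pp p q'"
  by (simp add: PT_eq pp_eq P.pure_add_right)

lemma pp_bal: "p \<in> carrier P \<Longrightarrow> b \<in> B \<Longrightarrow> q \<in> carrier P \<Longrightarrow> pp (p \<otimes>\<^bsub>P\<^esub> b) q = pp p (b \<otimes>\<^bsub>P\<^esub> q)"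
  by (simp add: pp_eq P.pure_bal)

lemma pp_smult: "p \<in> carrier P \<Longrightarrow> a \<in> carrier K \<Longrightarrow> q \<in> carrier P \<Longrightarrow>
    pp p (a \<odot>\<^bsub>P\<^esub> q) = pp (a \<odot>\<^bsub>P\<^esub> p) q"
  using pp_bal[of p "a \<odot>\<^bsub>P\<^esub> \<one>\<^bsub>P\<^esub>" q] by (simp add: coinv_smult_one A.smult_mult_left A.smult_mult_right)

lemma pp_zero_right: "p \<in> carrier P \<Longrightarrow> pp p \<zero>\<^bsub>P\<^esub> = \<zero>\<^bsub>PT\<^esub>"
  by (simp add: pp_eq PT_eq P.pure_zero_right)

definition B_balanced :: "('b, 'z) ring_scheme \<Rightarrow> ('p \<Rightarrow> 'p \<Rightarrow> 'b) \<Rightarrow> bool" where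
  "B_balanced D f = balanced P P B (monoid.mult P) (monoid.mult P) D f"

lemma B_balancedI:
  assumes "\<And>p q. p \<in> carrier P \<Longrightarrow> q \<in> carrier P \<Longrightarrow> f p q \<in> carrier D"
    and "\<And>p p' q. p \<in> carrier P \<Longrightarrow> p' \<in> carrier P \<Longrightarrow> q \<in> carrier P \<Longrightarrow>
      f (p \<oplus>\<^bsub>P\<^esub> p') q = f p q \<oplus>\<^bsub>D\<^esub> f p' q"
    and "\<And>p q q'. p \<in> carrier P \<Longrightarrow> q \<in> carrier P \<Longrightarrow> q' \<in> carrier P \<Longrightarrow>
      f p (q \<oplus>\<^bsub>P\<^esub> q') = f p q \<oplus>\<^bsub>D\<^esub> f p q'"
    and "\<And>p b q. p \<in> carrier P \<Longrightarrow> b \<in> B \<Longrightarrow> q \<in> carrier P \<Longrightarrow>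
      f (p \<otimes>\<^bsub>P\<^esub> b) q = f p (b \<otimes>\<^bsub>P\<^esub> q)"
  shows "B_balanced D f"
  using assms by (simp add: B_balanced_def balanced_def add_map_def)

lemma lift_pp: "abelian_group D \<Longrightarrow> B_balanced D f \<Longrightarrow> p \<in> carrier P \<Longrightarrow> q \<in> carrier P \<Longrightarrow>
    tensor_lift D f (pp p q) = f p q"
  by (simp add: B_balanced_def pp_eq)

lemma lift_PT_add_map: "abelian_group D \<Longrightarrow> B_balanced D f \<Longrightarrow> add_map PT D (tensor_lift D f)"
  unfolding B_balanced_def PT_eq by (rule P.add_map_lift)

lemma PT_eqI:
  assumes "add_map PT D h" "add_map PT D k" "t \<in> carrier PT"
    and "\<And>p q. p \<in> carrier P \<Longrightarrow> q \<in> carrier P \<Longrightarrow> h (pp p q) = k (pp p q)"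
  shows "h t = k t"
  using assms unfolding PT_eq pp_eq by (rule P.add_map_eqI)

text \<open>Balancing over B comes from the defining identity \<rho>(b q) = b \<rho>(q) of
  coinvariants.\<close>

lemma B_balanced_can: "B_balanced PC (\<lambda>p p'. left_act K C P p (coact P p'))"
  by (rule B_balancedI)
    (simp_all add: left_act_closed coact_closed left_act_add_left coact_add left_act_add left_act_mult
      coinv_closed coinv_coact)

lemma can_add_map: "add_map PT PC (can_map K C P)"
  unfolding can_map_def by (rule lift_PT_add_map[OF VC.abelian_TT B_balanced_can])

lemma can_pp: "p \<in> carrier P \<Longrightarrow> q \<in> carrier P \<Longrightarrow> can_map K C P (pp p q) = left_act K C P p (coact P q)"
  unfolding can_map_def by (rule lift_pp[OF VC.abelian_TT B_balanced_can])

text \<open>Balancing happens between the two factors, so multiplication on the outer sides of P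
  \<otimes> P survives it. The canonical map respects the left one
  (\<open>can_lmul\<close>).\<close>

definition lmul where "lmul p = tensor_lift PT (\<lambda>x y. pp (p \<otimes>\<^bsub>P\<^esub> x) y)"
definition rmul where "rmul p = tensor_lift PT (\<lambda>x y. pp x (y \<otimes>\<^bsub>P\<^esub> p))"

lemma B_balanced_lmul: "p \<in> carrier P \<Longrightarrow> B_balanced PT (\<lambda>x y. pp (p \<otimes>\<^bsub>P\<^esub> x) y)"
  by (rule B_balancedI) (simp_all add: pp_add_left pp_add_right A.r_distr coinv_closed A.m_assoc[symmetric] pp_bal)

lemma B_balanced_rmul: "p \<in> carrier P \<Longrightarrow> B_balanced PT (\<lambda>x y. pp x (y \<otimes>\<^bsub>P\<^esub> p))"
  by (rule B_balancedI) (simp_all add: pp_add_left pp_add_right A.l_distr coinv_closed A.m_assoc pp_bal)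

lemma lmul_add_map: "p \<in> carrier P \<Longrightarrow> add_map PT PT (lmul p)"
  unfolding lmul_def by (rule lift_PT_add_map[OF PT.abelian_group_axioms B_balanced_lmul])

lemma rmul_add_map: "p \<in> carrier P \<Longrightarrow> add_map PT PT (rmul p)"
  unfolding rmul_def by (rule lift_PT_add_map[OF PT.abelian_group_axioms B_balanced_rmul])

lemma lmul_pp: "p \<in> carrier P \<Longrightarrow> x \<in> carrier P \<Longrightarrow> y \<in> carrier P \<Longrightarrow> lmul p (pp x y) = pp (p \<otimes>\<^bsub>P\<^esub> x) y"
  unfolding lmul_def by (rule lift_pp[OF PT.abelian_group_axioms B_balanced_lmul])

lemma rmul_pp: "p \<in> carrier P \<Longrightarrow> x \<in> carrier P \<Longrightarrow> y \<in> carrier P \<Longrightarrow> rmul p (pp x y) = pp x (y \<otimes>\<^bsub>P\<^esub> p)"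
  unfolding rmul_def by (rule lift_pp[OF PT.abelian_group_axioms B_balanced_rmul])

lemma can_lmul:
  assumes "p \<in> carrier P" "t \<in> carrier PT"
  shows "can_map K C P (lmul p t) = left_act K C P p (can_map K C P t)"
  by (rule PT_eqI[OF add_map_comp[OF lmul_add_map can_add_map] add_map_comp[OF can_add_map left_act_add_map] assms(2)])
    (use assms(1) in \<open>simp_all add: lmul_pp can_pp left_act_mult coact_closed\<close>)

end

section \<open>Cleaving maps\<close>

locale cleft_comodule_algebra = comodule_algebra K C P
  for K :: "('k, 'r) ring_scheme" (structure) and C :: "('k, 'c, 's) coalg_scheme" (structure)
    and P :: "('k, 'p, 'c, 't) comod_alg_scheme" (structure) +
  fixes \<gamma> g :: "'c \<Rightarrow> 'p"
  assumes gam_colinear: "colinear K C C (comult C) P (coact P) \<gamma>"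
    and gam_inv: "is_conv_inverse K C P \<gamma> g"
begin

lemma gam_linear: "\<gamma> \<in> linear_maps K C P"
  using gam_colinear by (simp add: colinear_def)

lemma g_linear: "g \<in> linear_maps K C P"
  using gam_inv by (simp add: is_conv_inverse_def)

lemmas gam_simps = linear_mapsD[OF gam_linear] linear_mapsD[OF g_linear]
lemmas alg_simps = A.l_distr A.r_distr A.smult_mult_left A.smult_mult_right A.m_assoc

lemma coact_gam: "c \<in> carrier C \<Longrightarrow>
    coact P (\<gamma> c) = tensor_lift PC (\<lambda>u v. VC.pu (\<gamma> u) v) (comult C c)"
  using gam_colinear by (simp add: colinear_def tensor_map_def)

lemma comult_closed: "c \<in> carrier C \<Longrightarrow> comult C c \<in> carrier CC.TT"
  by (rule linear_mapsD(1)[OF comult_linear])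

lemma mod_C: "module K C"
  by unfold_locales

lemma K_comm: "a \<in> carrier K \<Longrightarrow> b \<in> carrier K \<Longrightarrow> a \<otimes>\<^bsub>K\<^esub> b = b \<otimes>\<^bsub>K\<^esub> a"
  by (rule comm_monoid.m_comm[OF cring.axioms(2)[OF module.axioms(1)[OF mod_C]]])

lemma left_act_coact_gam:
  assumes "q \<in> carrier P" "c \<in> carrier C"
  shows "left_act K C P q (coact P (\<gamma> c)) =
    tensor_lift PC (\<lambda>u v. VC.pu (q \<otimes>\<^bsub>P\<^esub> \<gamma> u) v) (comult C c)"
proof -
  have b: "bilin K C C PC (\<lambda>u v. VC.pu (\<gamma> u) v)"
    by (rule bilin_comp[OF VC.bilin_pu gam_linear linear_maps_id])
  have b': "bilin K C C PC (\<lambda>u v. VC.pu (q \<otimes>\<^bsub>P\<^esub> \<gamma> u) v)"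
    by (rule bilin_comp[OF bilin_left_act[OF assms(1)] gam_linear linear_maps_id])
  have "left_act K C P q (coact P (\<gamma> c)) = 
      tensor_lift PC (\<lambda>u v. left_act K C P q (VC.pu (\<gamma> u) v)) (comult C c)"
    unfolding coact_gam[OF assms(2)]
    by (rule CC.lift_TT_comp[OF VC.abelian_TT b VC.abelian_TT left_act_add_map comult_closed]) fact+
  also have "\<dots> = tensor_lift PC (\<lambda>u v. VC.pu (q \<otimes>\<^bsub>P\<^esub> \<gamma> u) v) (comult C c)"
    by (rule CC.lift_TT_cong[OF VC.abelian_TT b' comult_closed[OF assms(2)]])
      (simp add: left_act_pu assms gam_simps)
  finally show ?thesis .
qed

lemma bilin_conv:
  assumes "f \<in> linear_maps K C P" "f' \<in> linear_maps K C P"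
  shows "bilin K C C P (\<lambda>x y. f x \<otimes>\<^bsub>P\<^esub> f' y)"
  by (rule bilinI) (simp_all add: linear_mapsD[OF assms(1)] linear_mapsD[OF assms(2)] alg_simps)

lemma bilin_counit: "bilin K C C C (\<lambda>x y. counit C x \<odot>\<^bsub>C\<^esub> y)" "bilin K C C C (\<lambda>x y. counit C y \<odot>\<^bsub>C\<^esub> x)"
  by (rule bilinI; simp add: counit_closed counit_add counit_smult C.smult_l_distr C.smult_r_distr
      C.smult_assoc1[symmetric] K_comm)+

text \<open>Coassociativity gathers the two maps in the first leg, where \<open>conv\<close> turns
  them into the counit of c1, and the counit law absorbs it: q f(c1) f'(c2) \<otimes> c3 = q
  \<otimes> c. The pair is kept general since \<gamma> and its inverse are needed in both
  orders.\<close>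

lemma cancel_left:
  assumes f: "f \<in> linear_maps K C P" "f' \<in> linear_maps K C P"
    and conv: "\<And>c. c \<in> carrier C \<Longrightarrow> convolution C P f f' c = counit C c \<odot>\<^bsub>P\<^esub> \<one>\<^bsub>P\<^esub>"
    and q: "q \<in> carrier P" and c: "c \<in> carrier C"
  shows "tensor_lift PC (\<lambda>x y. tensor_lift PC (\<lambda>u v. VC.pu (q \<otimes>\<^bsub>P\<^esub> f x \<otimes>\<^bsub>P\<^esub> f' u) v) (comult C y)) (comult C c)
    = VC.pu q c"
proof -
  note fs = linear_mapsD[OF f(1)] linear_mapsD[OF f(2)]
  have tri: "trilin K C C C PC (\<lambda>x u v. VC.pu (q \<otimes>\<^bsub>P\<^esub> f x \<otimes>\<^bsub>P\<^esub> f' u) v)"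
    unfolding trilin_def
    by (auto intro!: bilinI simp: q fs alg_simps VC.pu_add_left VC.pu_add_right VC.pu_smult)
  have "tensor_lift PC (\<lambda>x y. tensor_lift PC (\<lambda>u v. VC.pu (q \<otimes>\<^bsub>P\<^esub> f x \<otimes>\<^bsub>P\<^esub> f' u) v) (comult C y)) (comult C c)
    = tensor_lift PC (\<lambda>x y. tensor_lift PC (\<lambda>u v. VC.pu (q \<otimes>\<^bsub>P\<^esub> f u \<otimes>\<^bsub>P\<^esub> f' v) y) (comult C x)) (comult C c)"
    by (rule self.sweedler_coassoc[OF VC.abelian_TT tri c, symmetric])
  also have "\<dots> = tensor_lift PC (\<lambda>x y. VC.pu q (counit C x \<odot>\<^bsub>C\<^esub> y)) (comult C c)"
  proof (rule CC.lift_TT_cong[OF VC.abelian_TT _ comult_closed[OF c]])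
    show "bilin K C C PC (\<lambda>x y. VC.pu q (counit C x \<odot>\<^bsub>C\<^esub> y))"
      by (rule bilin_add_map[OF bilin_counit(1)]) (simp add: add_map_def q VC.pu_add_right)
    fix x y assume x: "x \<in> carrier C" and y: "y \<in> carrier C"
    have h: "add_map P PC (\<lambda>p. VC.pu (q \<otimes>\<^bsub>P\<^esub> p) y)"
      by (rule add_mapI) (simp_all add: q y alg_simps VC.pu_add_left)
    have "VC.pu (q \<otimes>\<^bsub>P\<^esub> convolution C P f f' x) y =
        tensor_lift PC (\<lambda>u v. VC.pu (q \<otimes>\<^bsub>P\<^esub> (f u \<otimes>\<^bsub>P\<^esub> f' v)) y) (comult C x)"
      unfolding convolution_def
      by (rule CC.lift_TT_comp[OF A.abelian_group_axioms bilin_conv[OF f] VC.abelian_TT h comult_closed[OF x]])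
    also have "\<dots> = tensor_lift PC (\<lambda>u v. VC.pu (q \<otimes>\<^bsub>P\<^esub> f u \<otimes>\<^bsub>P\<^esub> f' v) y) (comult C x)"
      by (rule CC.lift_TT_cong[OF VC.abelian_TT _ comult_closed[OF x]])
        (use tri y in \<open>auto simp: trilin_def q fs A.m_assoc\<close>)
    finally show "tensor_lift PC (\<lambda>u v. VC.pu (q \<otimes>\<^bsub>P\<^esub> f u \<otimes>\<^bsub>P\<^esub> f' v) y) (comult C x) =
        VC.pu q (counit C x \<odot>\<^bsub>C\<^esub> y)"
      by (simp add: conv x y q VC.pu_smult counit_closed A.smult_mult_right)
  qed
  also have "\<dots> = VC.pu q (tensor_lift C (\<lambda>x y. counit C x \<odot>\<^bsub>C\<^esub> y) (comult C c))"
    by (rule CC.lift_TT_comp[OF C.abelian_group_axioms bilin_counit(1) VC.abelian_TT _ comult_closed[OF c], symmetric])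
      (simp add: add_map_def q VC.pu_add_right)
  also have "\<dots> = VC.pu q c" by (simp add: counit_left c)
  finally show ?thesis .
qed

lemma conv_gam_g: "c \<in> carrier C \<Longrightarrow> convolution C P \<gamma> g c = counit C c \<odot>\<^bsub>P\<^esub> \<one>\<^bsub>P\<^esub>"
  and conv_g_gam: "c \<in> carrier C \<Longrightarrow> convolution C P g \<gamma> c = counit C c \<odot>\<^bsub>P\<^esub> \<one>\<^bsub>P\<^esub>"
  using gam_inv by (simp_all add: is_conv_inverse_def)

text \<open>In Sweedler notation, \<open>Psi (q \<otimes> c) = q g(c\<^sub>1) \<otimes> c\<^sub>2\<close> and
  \<open>Theta (q \<otimes> c) = q g(c\<^sub>1) \<otimes>\<^sub>B \<gamma>(c\<^sub>2)\<close>; the latter inverts the canonical map.\<close>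

definition Psi where
  "Psi = tensor_lift PC (\<lambda>q c. tensor_lift PC (\<lambda>x y. VC.pu (q \<otimes>\<^bsub>P\<^esub> g x) y) (comult C c))"

lemma bilin_Psi: "bilin K P C PC (\<lambda>q c. tensor_lift PC (\<lambda>x y. VC.pu (q \<otimes>\<^bsub>P\<^esub> g x) y) (comult C c))"
proof (rule sweedler_trilin(2)[OF VC.abelian_TT])
  show "trilin K P C C PC (\<lambda>q x y. VC.pu (q \<otimes>\<^bsub>P\<^esub> g x) y)"
    unfolding trilin_def
    by (auto intro!: bilinI simp: gam_simps alg_simps VC.pu_add_left VC.pu_add_right VC.pu_smult)
qed

lemma Psi_add_map: "add_map PC PC Psi"
  unfolding Psi_def by (rule VC.lift_add_map[OF VC.abelian_TT bilin_Psi])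

text \<open>By colinearity the argument of \<open>Psi\<close> is q \<gamma>(c1) \<otimes> c2, so the
  value is q \<gamma>(c1) g(c2) \<otimes> c3, with \<gamma> in front of its inverse.\<close>

lemma Psi_left_act:
  assumes "q \<in> carrier P" "c \<in> carrier C"
  shows "Psi (left_act K C P q (coact P (\<gamma> c))) = VC.pu q c"
proof -
  have b: "bilin K C C PC (\<lambda>u v. VC.pu (q \<otimes>\<^bsub>P\<^esub> \<gamma> u) v)"
    by (rule bilin_comp[OF bilin_left_act[OF assms(1)] gam_linear linear_maps_id])
  have "Psi (left_act K C P q (coact P (\<gamma> c))) =
    tensor_lift PC (\<lambda>u v. Psi (VC.pu (q \<otimes>\<^bsub>P\<^esub> \<gamma> u) v)) (comult C c)"
    unfolding left_act_coact_gam[OF assms]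
    by (rule CC.lift_TT_comp[OF VC.abelian_TT b VC.abelian_TT Psi_add_map comult_closed[OF assms(2)]])
  also have "\<dots> = tensor_lift PC (\<lambda>u v. tensor_lift PC (\<lambda>x y. VC.pu (q \<otimes>\<^bsub>P\<^esub> \<gamma> u \<otimes>\<^bsub>P\<^esub> g x) y) (comult C v)) (comult C c)"
    unfolding Psi_def
    by (rule CC.lift_TT_cong[OF VC.abelian_TT bilin_comp[OF bilin_Psi _ linear_maps_id] comult_closed[OF assms(2)]])
      (use assms in \<open>auto simp: linear_maps_def gam_simps alg_simps VC.abelian_TT bilin_Psi\<close>)
  also have "\<dots> = VC.pu q c"
    by (rule cancel_left[OF gam_linear g_linear conv_gam_g assms])
  finally show ?thesis .
qed

definition Theta where
  "Theta = tensor_lift PT (\<lambda>q c. tensor_lift PT (\<lambda>x y. pp (q \<otimes>\<^bsub>P\<^esub> g x) (\<gamma> y)) (comult C c))"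

lemma trilin_Theta: "trilin K P C C PT (\<lambda>q x y. pp (q \<otimes>\<^bsub>P\<^esub> g x) (\<gamma> y))"
  unfolding trilin_def
  by (auto intro!: bilinI simp: gam_simps alg_simps pp_add_left pp_add_right pp_smult)

lemma bilin_Theta: "bilin K P C PT (\<lambda>q c. tensor_lift PT (\<lambda>x y. pp (q \<otimes>\<^bsub>P\<^esub> g x) (\<gamma> y)) (comult C c))"
  by (rule sweedler_trilin(2)[OF PT.abelian_group_axioms trilin_Theta])

lemma Theta_add_map: "add_map PC PT Theta"
  unfolding Theta_def by (rule VC.lift_add_map[OF PT.abelian_group_axioms bilin_Theta])

text \<open>Here the inverse stands in front: the composite gives q g(c1) \<gamma>(c2) \<otimes> c3.
  A cleaving map by itself thus makes the canonical map surjective.\<close>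

lemma can_Theta:
  assumes "t \<in> carrier PC"
  shows "can_map K C P (Theta t) = t"
proof (rule VC.TT_eqI[OF add_map_comp[OF Theta_add_map can_add_map] _ assms])
  show "add_map PC PC (\<lambda>t. t)" by (simp add: add_map_def)
  fix q c assume q: "q \<in> carrier P" and c: "c \<in> carrier C"
  have b: "bilin K C C PT (\<lambda>x y. pp (q \<otimes>\<^bsub>P\<^esub> g x) (\<gamma> y))"
    using trilin_Theta q by (simp add: trilin_def)
  have tri: "trilin K C C C PC (\<lambda>x u v. VC.pu (q \<otimes>\<^bsub>P\<^esub> g x \<otimes>\<^bsub>P\<^esub> \<gamma> u) v)"
    unfolding trilin_def
    by (auto intro!: bilinI simp: q gam_simps alg_simps VC.pu_add_left VC.pu_add_right VC.pu_smult)
  have "Theta (VC.pu q c) = tensor_lift PT (\<lambda>x y. pp (q \<otimes>\<^bsub>P\<^esub> g x) (\<gamma> y)) (comult C c)"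
    unfolding Theta_def by (rule VC.lift_pu[OF PT.abelian_group_axioms bilin_Theta q c])
  then have "can_map K C P (Theta (VC.pu q c)) =
      tensor_lift PC (\<lambda>x y. can_map K C P (pp (q \<otimes>\<^bsub>P\<^esub> g x) (\<gamma> y))) (comult C c)"
    using CC.lift_TT_comp[OF PT.abelian_group_axioms b VC.abelian_TT can_add_map comult_closed[OF c]] by simp
  also have "\<dots> = tensor_lift PC (\<lambda>x y. tensor_lift PC (\<lambda>u v. VC.pu (q \<otimes>\<^bsub>P\<^esub> g x \<otimes>\<^bsub>P\<^esub> \<gamma> u) v) (comult C y)) (comult C c)"
    by (rule CC.lift_TT_cong[OF VC.abelian_TT self.sweedler_trilin(2)[OF VC.abelian_TT tri] comult_closed[OF c]])
      (simp add: can_pp left_act_coact_gam q gam_simps)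
  also have "\<dots> = VC.pu q c"
    by (rule cancel_left[OF g_linear gam_linear conv_g_gam q c])
  finally show "can_map K C P (Theta (VC.pu q c)) = VC.pu q c" .
qed

section \<open>Decomposition of elements by a cleaving map\<close>

definition E where "E q = tensor_lift P (\<lambda>p c. p \<otimes>\<^bsub>P\<^esub> g c) (coact P q)"

lemma bilin_E: "bilin K P C P (\<lambda>p c. p \<otimes>\<^bsub>P\<^esub> g c)"
  by (rule bilinI) (simp_all add: gam_simps alg_simps)

lemma E_add_map: "add_map P P E"
  unfolding E_def
  by (rule add_map_comp[OF coact_add_map VC.lift_add_map[OF A.abelian_group_axioms bilin_E]])

lemma trilin_decomp: "trilin K P C C P (\<lambda>p x y. p \<otimes>\<^bsub>P\<^esub> g x \<otimes>\<^bsub>P\<^esub> \<gamma> y)"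
  unfolding trilin_def by (auto intro!: bilinI simp: gam_simps alg_simps)

lemma lift_decomp:
  assumes "p \<in> carrier P" "c \<in> carrier C"
  shows "tensor_lift P (\<lambda>p' c'. p' \<otimes>\<^bsub>P\<^esub> g c' \<otimes>\<^bsub>P\<^esub> \<gamma> c) (coact P p) = E p \<otimes>\<^bsub>P\<^esub> \<gamma> c"
  unfolding E_def
  by (rule VC.lift_TT_comp[OF A.abelian_group_axioms bilin_E A.abelian_group_axioms _ coact_closed[OF assms(1)], symmetric])
    (use assms in \<open>simp add: add_map_def gam_simps alg_simps\<close>)

text \<open>A lift into an abelian group only promises additivity, so homogeneity is derived
  separately, by moving the scalar onto the first tensor factor.\<close>

lemma E_smult: "a \<in> carrier K \<Longrightarrow> p \<in> carrier P \<Longrightarrow> E (a \<odot>\<^bsub>P\<^esub> p) = a \<odot>\<^bsub>P\<^esub> E p"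
proof -
  assume a: "a \<in> carrier K" and p: "p \<in> carrier P"
  have "a \<odot>\<^bsub>P\<^esub> E p = tensor_lift P (\<lambda>p c. a \<odot>\<^bsub>P\<^esub> (p \<otimes>\<^bsub>P\<^esub> g c)) (coact P p)"
    unfolding E_def
    by (rule VC.lift_TT_comp[OF A.abelian_group_axioms bilin_E A.abelian_group_axioms _ coact_closed[OF p]])
      (simp add: add_map_def a A.smult_r_distr)
  also have "\<dots> = tensor_lift P (\<lambda>p c. a \<odot>\<^bsub>P\<^esub> p \<otimes>\<^bsub>P\<^esub> g c) (coact P p)"
  proof (rule VC.lift_TT_cong[OF A.abelian_group_axioms _ coact_closed[OF p]])
    have "(\<lambda>p. a \<odot>\<^bsub>P\<^esub> p) \<in> linear_maps K P P"
      using a by (auto simp: linear_maps_def A.smult_r_distr A.smult_assoc1[symmetric] K_comm)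
    then show "bilin K P C P (\<lambda>p c. a \<odot>\<^bsub>P\<^esub> p \<otimes>\<^bsub>P\<^esub> g c)"
      by (rule bilin_comp[OF bilin_E _ linear_maps_id])
  qed (simp add: a gam_simps A.smult_mult_left)
  also have "\<dots> = E (a \<odot>\<^bsub>P\<^esub> p)"
    unfolding E_def
    using VC.lift_smult[OF A.abelian_group_axioms bilin_E a coact_closed[OF p]]
    by (simp add: linear_mapsD(3)[OF coact_linear a p])
  finally show ?thesis by simp
qed

lemma bilin_E_gam: "bilin K P C P (\<lambda>p c. E p \<otimes>\<^bsub>P\<^esub> \<gamma> c)"
  by (rule bilinI)
    (simp_all add: add_map_closed[OF E_add_map] add_map_add[OF E_add_map] E_smult gam_simps alg_simps)

text \<open>By coassociativity the left side is q0 g(q1) \<gamma>(q2), and the last two factors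
  collapse to the counit of q1.\<close>

lemma E_decomp:
  assumes q: "q \<in> carrier P"
  shows "tensor_lift P (\<lambda>p c. E p \<otimes>\<^bsub>P\<^esub> \<gamma> c) (coact P q) = q"
proof -
  note tri = trilin_decomp
  have "tensor_lift P (\<lambda>p c. E p \<otimes>\<^bsub>P\<^esub> \<gamma> c) (coact P q) =
      tensor_lift P (\<lambda>p c. tensor_lift P (\<lambda>p' c'. p' \<otimes>\<^bsub>P\<^esub> g c' \<otimes>\<^bsub>P\<^esub> \<gamma> c) (coact P p)) (coact P q)"
    by (rule VC.lift_TT_cong[OF A.abelian_group_axioms sweedler_trilin(1)[OF A.abelian_group_axioms tri] coact_closed[OF q]])
      (simp add: lift_decomp)
  also have "\<dots> = tensor_lift P (\<lambda>p c. tensor_lift P (\<lambda>x y. p \<otimes>\<^bsub>P\<^esub> g x \<otimes>\<^bsub>P\<^esub> \<gamma> y) (comult C c)) (coact P q)"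
    by (rule sweedler_coassoc[OF A.abelian_group_axioms tri q])
  also have "\<dots> = tensor_lift P (\<lambda>p c. counit C c \<odot>\<^bsub>P\<^esub> p) (coact P q)"
  proof (rule VC.lift_TT_cong[OF A.abelian_group_axioms _ coact_closed[OF q]])
    show "bilin K P C P (\<lambda>p c. counit C c \<odot>\<^bsub>P\<^esub> p)"
      by (rule bilinI) (simp_all add: counit_closed counit_add counit_smult A.smult_l_distr A.smult_r_distr
          A.smult_assoc1[symmetric] K_comm)
    fix p c assume p: "p \<in> carrier P" and c: "c \<in> carrier C"
    have "p \<otimes>\<^bsub>P\<^esub> convolution C P g \<gamma> c =
        tensor_lift P (\<lambda>x y. p \<otimes>\<^bsub>P\<^esub> (g x \<otimes>\<^bsub>P\<^esub> \<gamma> y)) (comult C c)"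
      unfolding convolution_def
      by (rule CC.lift_TT_comp[OF A.abelian_group_axioms bilin_conv[OF g_linear gam_linear] A.abelian_group_axioms _ comult_closed[OF c]])
        (simp add: add_map_def p alg_simps)
    also have "\<dots> = tensor_lift P (\<lambda>x y. p \<otimes>\<^bsub>P\<^esub> g x \<otimes>\<^bsub>P\<^esub> \<gamma> y) (comult C c)"
      by (rule CC.lift_TT_cong[OF A.abelian_group_axioms _ comult_closed[OF c]])
        (use tri p in \<open>auto simp: trilin_def gam_simps A.m_assoc\<close>)
    finally show "tensor_lift P (\<lambda>x y. p \<otimes>\<^bsub>P\<^esub> g x \<otimes>\<^bsub>P\<^esub> \<gamma> y) (comult C c) = counit C c \<odot>\<^bsub>P\<^esub> p"
      by (simp add: conv_g_gam c p A.smult_mult_right counit_closed)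
  qed
  also have "\<dots> = q" by (rule coact_counit[OF q])
  finally show ?thesis .
qed

end

text \<open>Once the canonical map is injective, its right inverse \<open>Theta\<close> is
  two-sided, which turns equalities in P \<otimes> C into equalities in P \<otimes> P over
  B.\<close>

locale cleft_galois = cleft_comodule_algebra +
  assumes can_inj: "inj_on (can_map K C P) (carrier PT)"
begin

text \<open>Both sides have image \<rho>(q) under the canonical map. Written out, 1 \<otimes> q = q0
  g(q1) \<otimes> \<gamma>(q2).\<close>

lemma pp_one_left: 
  assumes "q \<in> carrier P"
  shows "pp \<one>\<^bsub>P\<^esub> q = Theta (coact P q)"
proof (rule inj_onD[OF can_inj])
  show "can_map K C P (pp \<one>\<^bsub>P\<^esub> q) = can_map K C P (Theta (coact P q))"
    using assms by (simp add: can_pp can_Theta coact_closed left_act_one)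
qed (use assms in \<open>auto intro: add_map_closed[OF Theta_add_map] coact_closed\<close>)

text \<open>Multiplying the expansion of 1 \<otimes> p by g(c) from the right gives p0 g(p1)
  \<otimes> \<gamma>(p2) g(c).\<close>

lemma pp_one_mult_g:
  assumes p: "p \<in> carrier P" and c: "c \<in> carrier C"
  shows "pp \<one>\<^bsub>P\<^esub> (p \<otimes>\<^bsub>P\<^esub> g c) = tensor_lift PT (\<lambda>p' c'.
    tensor_lift PT (\<lambda>x y. pp (p' \<otimes>\<^bsub>P\<^esub> g x) (\<gamma> y \<otimes>\<^bsub>P\<^esub> g c)) (comult C c')) (coact P p)"
proof -
  have tri: "trilin K P C C PT (\<lambda>p' x y. pp (p' \<otimes>\<^bsub>P\<^esub> g x) (\<gamma> y \<otimes>\<^bsub>P\<^esub> g c))"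
    unfolding trilin_def
    by (auto intro!: bilinI simp: c gam_simps alg_simps pp_add_left pp_add_right pp_smult)
  have r: "add_map PT PT (rmul (g c))" by (rule rmul_add_map) (simp add: c gam_simps)
  have "pp \<one>\<^bsub>P\<^esub> (p \<otimes>\<^bsub>P\<^esub> g c) = rmul (g c) (Theta (coact P p))"
    using p c by (simp add: rmul_pp gam_simps flip: pp_one_left)
  also have "\<dots> = tensor_lift PT (\<lambda>p' c'.
     rmul (g c) (tensor_lift PT (\<lambda>x y. pp (p' \<otimes>\<^bsub>P\<^esub> g x) (\<gamma> y)) (comult C c'))) (coact P p)"
    unfolding Theta_def
    by (rule VC.lift_TT_comp[OF PT.abelian_group_axioms bilin_Theta PT.abelian_group_axioms r coact_closed[OF p]])
  also have "\<dots> = tensor_lift PT (\<lambda>p' c'.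
    tensor_lift PT (\<lambda>x y. pp (p' \<otimes>\<^bsub>P\<^esub> g x) (\<gamma> y \<otimes>\<^bsub>P\<^esub> g c)) (comult C c')) (coact P p)"
  proof (rule VC.lift_TT_cong[OF PT.abelian_group_axioms sweedler_trilin(2)[OF PT.abelian_group_axioms tri] coact_closed[OF p]])
    fix p' c' assume p': "p' \<in> carrier P" and c': "c' \<in> carrier C"
    have b: "bilin K C C PT (\<lambda>x y. pp (p' \<otimes>\<^bsub>P\<^esub> g x) (\<gamma> y))"
      using trilin_Theta p' by (simp add: trilin_def)
    have "rmul (g c) (tensor_lift PT (\<lambda>x y. pp (p' \<otimes>\<^bsub>P\<^esub> g x) (\<gamma> y)) (comult C c')) =
       tensor_lift PT (\<lambda>x y. rmul (g c) (pp (p' \<otimes>\<^bsub>P\<^esub> g x) (\<gamma> y))) (comult C c')"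
      by (rule CC.lift_TT_comp[OF PT.abelian_group_axioms b PT.abelian_group_axioms r comult_closed[OF c']])
    also have "\<dots> = tensor_lift PT (\<lambda>x y. pp (p' \<otimes>\<^bsub>P\<^esub> g x) (\<gamma> y \<otimes>\<^bsub>P\<^esub> g c)) (comult C c')"
      by (rule CC.lift_TT_cong[OF PT.abelian_group_axioms _ comult_closed[OF c']])
        (use tri p' c in \<open>auto simp: trilin_def rmul_pp gam_simps\<close>)
    finally show "rmul (g c) (tensor_lift PT (\<lambda>x y. pp (p' \<otimes>\<^bsub>P\<^esub> g x) (\<gamma> y)) (comult C c')) = \<dots>" .
  qed
  finally show ?thesis .
qed

text \<open>Expanding 1 \<otimes> q0 g(q1) gives q0 g(q1) \<otimes> \<gamma>(q2) g(q3); the right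
  factor collapses to the counit of q2, and q0 g(q1) \<otimes> 1 remains.\<close>

lemma pp_E:
  assumes q: "q \<in> carrier P"
  shows "pp \<one>\<^bsub>P\<^esub> (E q) = pp (E q) \<one>\<^bsub>P\<^esub>"
proof -
  note PTg = PT.abelian_group_axioms
  \<comment> \<open>Four legs q0, ..., q3 occur, so coassociativity is applied twice: once with
    \<open>H\<close> as the trilinear map, once to the lift inside \<open>H\<close>.\<close>
  define H where "H p' c' c = tensor_lift PT (\<lambda>x y. pp (p' \<otimes>\<^bsub>P\<^esub> g x) (\<gamma> y \<otimes>\<^bsub>P\<^esub> g c)) (comult C c')" for p' c' c
  have tri1: "trilin K P C C PT (\<lambda>p' x y. pp (p' \<otimes>\<^bsub>P\<^esub> g x) (\<gamma> y \<otimes>\<^bsub>P\<^esub> g c))" if "c \<in> carrier C" for c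
    unfolding trilin_def using that
    by (auto intro!: bilinI simp: gam_simps alg_simps pp_add_left pp_add_right pp_smult)
  have tri2: "trilin K C C C PT (\<lambda>x y c. pp (p' \<otimes>\<^bsub>P\<^esub> g x) (\<gamma> y \<otimes>\<^bsub>P\<^esub> g c))" if "p' \<in> carrier P" for p'
    unfolding trilin_def using that
    by (auto intro!: bilinI simp: gam_simps alg_simps pp_add_left pp_add_right pp_smult)
  have triH: "trilin K P C C PT H"
    unfolding trilin_def H_def
    using sweedler_trilin(2)[OF PTg tri1] self.sweedler_trilin(1)[OF PTg tri2] by auto
  have one_add: "add_map P PT (pp \<one>\<^bsub>P\<^esub>)" "add_map P PT (\<lambda>p. pp p \<one>\<^bsub>P\<^esub>)"
    by (simp_all add: add_map_def pp_add_left pp_add_right)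
  have inner: "tensor_lift PT (H p) (comult C c) = pp (p \<otimes>\<^bsub>P\<^esub> g c) \<one>\<^bsub>P\<^esub>"
    if p: "p \<in> carrier P" and c: "c \<in> carrier C" for p c
  proof -
    have "tensor_lift PT (H p) (comult C c) =
      tensor_lift PT (\<lambda>x y. tensor_lift PT (\<lambda>u v. pp (p \<otimes>\<^bsub>P\<^esub> g x) (\<gamma> u \<otimes>\<^bsub>P\<^esub> g v)) (comult C y)) (comult C c)"
      unfolding H_def by (rule self.sweedler_coassoc[OF PTg tri2[OF p] c])
    also have "\<dots> = tensor_lift PT (\<lambda>x y. pp (p \<otimes>\<^bsub>P\<^esub> g (counit C y \<odot>\<^bsub>C\<^esub> x)) \<one>\<^bsub>P\<^esub>) (comult C c)"
    proof (rule CC.lift_TT_cong[OF PTg _ comult_closed[OF c]])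
      show "bilin K C C PT (\<lambda>x y. pp (p \<otimes>\<^bsub>P\<^esub> g (counit C y \<odot>\<^bsub>C\<^esub> x)) \<one>\<^bsub>P\<^esub>)"
        by (rule bilin_add_map[OF bilin_counit(2)]) (simp add: add_map_def p gam_simps alg_simps pp_add_left)
      fix x y assume x: "x \<in> carrier C" and y: "y \<in> carrier C"
      have "pp (p \<otimes>\<^bsub>P\<^esub> g x) (convolution C P \<gamma> g y) =
         tensor_lift PT (\<lambda>u v. pp (p \<otimes>\<^bsub>P\<^esub> g x) (\<gamma> u \<otimes>\<^bsub>P\<^esub> g v)) (comult C y)"
        unfolding convolution_def
        by (rule CC.lift_TT_comp[OF A.abelian_group_axioms bilin_conv[OF gam_linear g_linear] PTg _ comult_closed[OF y]])
          (simp add: add_map_def p x gam_simps pp_add_right)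
      then show "tensor_lift PT (\<lambda>u v. pp (p \<otimes>\<^bsub>P\<^esub> g x) (\<gamma> u \<otimes>\<^bsub>P\<^esub> g v)) (comult C y) =
          pp (p \<otimes>\<^bsub>P\<^esub> g (counit C y \<odot>\<^bsub>C\<^esub> x)) \<one>\<^bsub>P\<^esub>"
        by (simp add: conv_gam_g x y p gam_simps pp_smult counit_closed A.smult_mult_right)
    qed
    also have "\<dots> = pp (p \<otimes>\<^bsub>P\<^esub> g (tensor_lift C (\<lambda>x y. counit C y \<odot>\<^bsub>C\<^esub> x) (comult C c))) \<one>\<^bsub>P\<^esub>"
      by (rule CC.lift_TT_comp[OF C.abelian_group_axioms bilin_counit(2) PTg _ comult_closed[OF c],
            where h = "\<lambda>c. pp (p \<otimes>\<^bsub>P\<^esub> g c) \<one>\<^bsub>P\<^esub>", symmetric])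
        (simp add: add_map_def p gam_simps alg_simps pp_add_left)
    also have "\<dots> = pp (p \<otimes>\<^bsub>P\<^esub> g c) \<one>\<^bsub>P\<^esub>" by (simp add: counit_right c)
    finally show ?thesis .
  qed
  have "pp \<one>\<^bsub>P\<^esub> (E q) = tensor_lift PT (\<lambda>p c. pp \<one>\<^bsub>P\<^esub> (p \<otimes>\<^bsub>P\<^esub> g c)) (coact P q)"
    unfolding E_def
    by (rule VC.lift_TT_comp[OF A.abelian_group_axioms bilin_E PTg one_add(1) coact_closed[OF q]])
  also have "\<dots> = tensor_lift PT (\<lambda>p c. tensor_lift PT (\<lambda>p' c'. H p' c' c) (coact P p)) (coact P q)"
    by (rule VC.lift_TT_cong[OF PTg sweedler_trilin(1)[OF PTg triH] coact_closed[OF q]])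
      (simp add: pp_one_mult_g H_def)
  also have "\<dots> = tensor_lift PT (\<lambda>p c. tensor_lift PT (H p) (comult C c)) (coact P q)"
    by (rule sweedler_coassoc[OF PTg triH q])
  also have "\<dots> = tensor_lift PT (\<lambda>p c. pp (p \<otimes>\<^bsub>P\<^esub> g c) \<one>\<^bsub>P\<^esub>) (coact P q)"
    by (rule VC.lift_TT_cong[OF PTg bilin_add_map[OF bilin_E one_add(2)] coact_closed[OF q]])
      (simp add: inner)
  also have "\<dots> = pp (E q) \<one>\<^bsub>P\<^esub>"
    unfolding E_def
    by (rule VC.lift_TT_comp[OF A.abelian_group_axioms bilin_E PTg one_add(2) coact_closed[OF q], symmetric])
  finally show ?thesis .
qed

text \<open>Without a product rule for the coaction, \<rho>(E(q) p) cannot be expanded. Instead x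
  \<otimes> y \<mapsto> x \<rho>(y p) is balanced over B and sends the two sides of
  \<open>pp_E\<close> to \<rho>(E(q) p) and E(q) \<rho>(p).\<close>

lemma E_coinvariant:
  assumes q: "q \<in> carrier P"
  shows "E q \<in> B"
proof (rule coinvI)
  show Eq: "E q \<in> carrier P" by (rule add_map_closed[OF E_add_map q])
  fix p assume p: "p \<in> carrier P"
  have b: "B_balanced PC (\<lambda>x y. left_act K C P x (coact P (y \<otimes>\<^bsub>P\<^esub> p)))"
    by (rule B_balancedI)
      (simp_all add: p left_act_closed coact_closed left_act_add_left coact_add left_act_add left_act_mult
        coinv_closed coinv_coact A.m_assoc A.l_distr)
  have "tensor_lift PC (\<lambda>x y. left_act K C P x (coact P (y \<otimes>\<^bsub>P\<^esub> p))) (pp \<one>\<^bsub>P\<^esub> (E q)) =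
     tensor_lift PC (\<lambda>x y. left_act K C P x (coact P (y \<otimes>\<^bsub>P\<^esub> p))) (pp (E q) \<one>\<^bsub>P\<^esub>)"
    by (simp add: pp_E q)
  then show "coact P (E q \<otimes>\<^bsub>P\<^esub> p) = left_act K C P (E q) (coact P p)"
    using p Eq by (simp add: lift_pp[OF VC.abelian_TT b] left_act_one coact_closed)
qed

end

section \<open>Surjections of comodule algebras\<close>

lemma gen_preimage:
  assumes A: "abelian_group A" and A': "abelian_group A'" and h: "add_map A A' h"
    and Z: "Z \<subseteq> carrier A" and x: "x \<in> generate (add_monoid A') (h ` Z)"
  obtains y where "y \<in> generate (add_monoid A) Z" "x = h y"
proof -
  interpret A: abelian_group A by fact
  interpret A': abelian_group A' by fact
  interpret h: abelian_group_hom A A' h by (rule add_map_hom) fact+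
  interpret gh: group_hom "add_monoid A" "add_monoid A'" h
    by (rule h.a_group_hom)
  have "subgroup (h ` generate (add_monoid A) Z) (add_monoid A')"
    by (rule gh.subgroup_img_is_subgroup[OF A.gen_subgroup[OF Z]])
  then have "generate (add_monoid A') (h ` Z) \<subseteq> h ` generate (add_monoid A) Z"
    by (rule A'.add.generate_subgroup_incl[rotated]) (auto intro: A.gen_incl)
  then show thesis using x that by blast
qed

text \<open>What the quotient maps P \<rightarrow> P/J_i provide, freed from cosets. The equality
  \<open>chi_coinv\<close> is used in both directions: one inclusion makes \<open>chiPT\<close> well
  defined, the other computes its kernel.\<close>

locale comodule_algebra_surj = P: comodule_algebra K C P + Q: comodule_algebra K C Q
  for K :: "('k, 'r) ring_scheme" and C :: "('k, 'c, 's) coalg_scheme"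
    and P :: "('k, 'p, 'c, 't) comod_alg_scheme" and Q :: "('k, 'q, 'c, 'u) comod_alg_scheme" +
  fixes \<chi> :: "'p \<Rightarrow> 'q"
  assumes chi_colinear: "colinear K C P (coact P) Q (coact Q) \<chi>"
    and chi_surj: "\<chi> ` carrier P = carrier Q"
    and chi_mult: "p \<in> carrier P \<Longrightarrow> p' \<in> carrier P \<Longrightarrow> \<chi> (p \<otimes>\<^bsub>P\<^esub> p') = \<chi> p \<otimes>\<^bsub>Q\<^esub> \<chi> p'"
    and chi_one: "\<chi> \<one>\<^bsub>P\<^esub> = \<one>\<^bsub>Q\<^esub>"
    and chi_coinv: "\<chi> ` coinvariants K C P = coinvariants K C Q"
begin

lemma chi_linear: "\<chi> \<in> linear_maps K P Q"
  using chi_colinear by (simp add: colinear_def)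

lemmas chi_simps = linear_mapsD[OF chi_linear]

lemma chi_add_map: "add_map P Q \<chi>"
  by (rule linear_add_map[OF chi_linear])

lemma chi_zero: "\<chi> \<zero>\<^bsub>P\<^esub> = \<zero>\<^bsub>Q\<^esub>"
  by (rule add_map_zero[OF P.A.abelian_group_axioms Q.A.abelian_group_axioms chi_add_map])

lemma chi_minus: "p \<in> carrier P \<Longrightarrow> q \<in> carrier P \<Longrightarrow> \<chi> (p \<ominus>\<^bsub>P\<^esub> q) = \<chi> p \<ominus>\<^bsub>Q\<^esub> \<chi> q"
  by (rule add_map_minus[OF P.A.abelian_group_axioms Q.A.abelian_group_axioms chi_add_map])

lemma chi_surjE:
  assumes "q \<in> carrier Q" obtains p where "p \<in> carrier P" "\<chi> p = q"
proof -
  have "q \<in> \<chi> ` carrier P" using assms by (simp add: chi_surj)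
  then show thesis using that by (elim imageE) simp
qed

definition J where "J = {p \<in> carrier P. \<chi> p = \<zero>\<^bsub>Q\<^esub>}"

lemma J_closed: "j \<in> J \<Longrightarrow> j \<in> carrier P"
  by (simp add: J_def)

lemma J_mult_right: "j \<in> J \<Longrightarrow> p \<in> carrier P \<Longrightarrow> j \<otimes>\<^bsub>P\<^esub> p \<in> J"
  by (simp add: J_def chi_mult chi_simps)

lemma J_mult_left: "j \<in> J \<Longrightarrow> p \<in> carrier P \<Longrightarrow> p \<otimes>\<^bsub>P\<^esub> j \<in> J"
  by (simp add: J_def chi_mult chi_simps)

lemma J_minus: "j \<in> J \<Longrightarrow> j' \<in> J \<Longrightarrow> j \<ominus>\<^bsub>P\<^esub> j' \<in> J"
  by (simp add: J_def chi_minus Q.A.minus_self)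

lemma J_subgroup: "subgroup J (add_monoid P)"
proof (rule P.A.add.subgroupI)
  show "J \<noteq> {}" using chi_zero by (auto simp: J_def)
  fix j assume j: "j \<in> J"
  then have "\<ominus>\<^bsub>P\<^esub> j = \<zero>\<^bsub>P\<^esub> \<ominus>\<^bsub>P\<^esub> j" by (simp add: a_minus_def J_closed)
  moreover have "\<zero>\<^bsub>P\<^esub> \<in> J" by (simp add: J_def chi_zero)
  ultimately show "\<ominus>\<^bsub>P\<^esub> j \<in> J" using j J_minus by simp
qed (auto simp: J_def chi_simps)

definition chiC where "chiC = tensor_map K Q C \<chi> (\<lambda>c. c)"

lemma bilin_chiC: "bilin K P C Q.PC (\<lambda>p c. Q.VC.pu (\<chi> p) c)"
  by (rule bilin_comp[OF Q.VC.bilin_pu chi_linear linear_maps_id])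

lemma chiC_add_map: "add_map P.PC Q.PC chiC"
  unfolding chiC_def tensor_map_def by (rule P.VC.lift_add_map[OF Q.VC.abelian_TT bilin_chiC])

lemma chiC_pu: "p \<in> carrier P \<Longrightarrow> c \<in> carrier C \<Longrightarrow> chiC (P.VC.pu p c) = Q.VC.pu (\<chi> p) c"
  unfolding chiC_def tensor_map_def by (rule P.VC.lift_pu[OF Q.VC.abelian_TT bilin_chiC])

lemma chiC_closed: "t \<in> carrier P.PC \<Longrightarrow> chiC t \<in> carrier Q.PC"
  by (rule add_map_closed[OF chiC_add_map])

lemma chiC_minus: "t \<in> carrier P.PC \<Longrightarrow> t' \<in> carrier P.PC \<Longrightarrow> chiC (t \<ominus>\<^bsub>P.PC\<^esub> t') = chiC t \<ominus>\<^bsub>Q.PC\<^esub> chiC t'"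
  by (rule add_map_minus[OF P.VC.abelian_TT Q.VC.abelian_TT chiC_add_map])

lemma chiC_coact: "p \<in> carrier P \<Longrightarrow> chiC (coact P p) = coact Q (\<chi> p)"
  using chi_colinear by (simp add: colinear_def chiC_def)

lemma chiC_left_act:
  assumes "p \<in> carrier P" "t \<in> carrier P.PC"
  shows "chiC (left_act K C P p t) = left_act K C Q (\<chi> p) (chiC t)"
proof (rule P.VC.TT_eqI[OF _ _ assms(2)])
  show "add_map P.PC Q.PC (\<lambda>t. chiC (left_act K C P p t))"
    using assms(1) by (intro add_map_comp[OF P.left_act_add_map chiC_add_map])
  show "add_map P.PC Q.PC (\<lambda>t. left_act K C Q (\<chi> p) (chiC t))"
    using assms(1) by (intro add_map_comp[OF chiC_add_map Q.left_act_add_map] chi_simps)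
qed (simp add: assms P.left_act_pu Q.left_act_pu chiC_pu chi_mult chi_simps)

text \<open>The image of J \<otimes> C in P \<otimes> C, taken as a span of pure tensors exactly as
  in \<open>subcomodule\<close>.\<close>

definition JC where "JC = generate (add_monoid P.PC) {P.VC.pu j c | j c. j \<in> J \<and> c \<in> carrier C}"

lemma JC_gens: "{P.VC.pu j c | j c. j \<in> J \<and> c \<in> carrier C} \<subseteq> carrier P.PC"
  by (auto simp: J_closed)

lemma JC_pu: "j \<in> J \<Longrightarrow> c \<in> carrier C \<Longrightarrow> P.VC.pu j c \<in> JC"
  unfolding JC_def by (rule P.VC.TT.gen_incl) blast

lemma JC_left_act:
  assumes "j \<in> J" "t \<in> carrier P.PC"
  shows "left_act K C P j t \<in> JC"
  using assms(2)
proof (induction t rule: P.VC.TT_induct)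
  case (pure p c)
  then show ?case using assms(1) by (simp add: P.left_act_pu J_closed JC_pu J_mult_right)
next
  case (add x y)
  then show ?case using assms(1) by (simp add: P.left_act_add J_closed JC_def P.VC.TT.gen_add)
qed

text \<open>Right exactness with the identity on C; the second family of generators then consists of
  p \<otimes> 0 = 0.\<close>

lemma chiC_kernel:
  assumes "t \<in> carrier P.PC" "chiC t = \<zero>\<^bsub>Q.PC\<^esub>"
  shows "t \<in> JC"
proof -
  let ?Z = "{P.VC.b.pure x w | x w. x \<in> carrier P \<and> \<chi> x = \<zero>\<^bsub>Q\<^esub> \<and> w \<in> carrier C} \<union>
     {P.VC.b.pure v y | v y. v \<in> carrier P \<and> y \<in> carrier C \<and> y = \<zero>\<^bsub>C\<^esub>}"
  have "t \<in> generate (add_monoid P.VC.b.T) ?Z"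
  proof (rule tensor_kernel[OF P.VC.b.bal_pair_axioms Q.VC.b.bal_pair_axioms chi_add_map chi_surj])
    show "add_map C C (\<lambda>c. c)" "(\<lambda>c. c) ` carrier C = carrier C" by (simp_all add: add_map_def)
    show "add_map P.VC.b.T Q.VC.b.T chiC"
      using chiC_add_map by (simp add: P.VC.add_map_TT Q.VC.add_map_TT)
    show "chiC (P.VC.b.pure v w) = Q.VC.b.pure (\<chi> v) w" if "v \<in> carrier P" "w \<in> carrier C" for v w
      using chiC_pu[OF that] by (simp add: P.VC.pu_eq Q.VC.pu_eq)
  qed (use assms chi_simps in \<open>auto simp: P.VC.tensor_simps Q.VC.tensor_simps\<close>)
  also have "generate (add_monoid P.VC.b.T) ?Z = generate (add_monoid P.PC) ?Z"
    by (rule P.VC.generate_TT[symmetric])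
  also have "\<dots> \<subseteq> JC"
    unfolding JC_def
  proof (rule P.VC.TT.gen_subsetI[OF _ JC_gens], rule subsetI)
    fix z assume "z \<in> ?Z"
    then consider j c where "z = P.VC.pu j c" "j \<in> J" "c \<in> carrier C" | "z = \<zero>\<^bsub>P.PC\<^esub>"
      using P.VC.b.pure_zero_right by (auto simp: J_def P.VC.pu_eq P.VC.tensor_simps)
    then show "z \<in> generate (add_monoid P.PC) {P.VC.pu j c |j c. j \<in> J \<and> c \<in> carrier C}"
    proof cases
      case 1 then show ?thesis by (intro P.VC.TT.gen_incl) blast
    next
      case 2 then show ?thesis using generate.one[of "add_monoid P.PC"] by simp
    qed
  qed
  finally show ?thesis .
qed

definition chiPT where "chiPT = tensor_lift Q.PT (\<lambda>p q. Q.pp (\<chi> p) (\<chi> q))"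

lemma B_balanced_chiPT: "P.B_balanced Q.PT (\<lambda>p q. Q.pp (\<chi> p) (\<chi> q))"
proof (rule P.B_balancedI)
  fix p b q assume "p \<in> carrier P" "b \<in> P.B" "q \<in> carrier P"
  moreover from this have "\<chi> b \<in> Q.B" using chi_coinv by blast
  ultimately show "Q.pp (\<chi> (p \<otimes>\<^bsub>P\<^esub> b)) (\<chi> q) = Q.pp (\<chi> p) (\<chi> (b \<otimes>\<^bsub>P\<^esub> q))"
    by (simp add: chi_mult P.coinv_closed Q.pp_bal chi_simps)
qed (simp_all add: chi_simps Q.pp_add_left Q.pp_add_right)

lemma chiPT_add_map: "add_map P.PT Q.PT chiPT"
  unfolding chiPT_def by (rule P.lift_PT_add_map[OF Q.PT.abelian_group_axioms B_balanced_chiPT])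

lemma chiPT_pp: "p \<in> carrier P \<Longrightarrow> q \<in> carrier P \<Longrightarrow> chiPT (P.pp p q) = Q.pp (\<chi> p) (\<chi> q)"
  unfolding chiPT_def by (rule P.lift_pp[OF Q.PT.abelian_group_axioms B_balanced_chiPT])

lemma can_chiPT:
  assumes "t \<in> carrier P.PT"
  shows "can_map K C Q (chiPT t) = chiC (can_map K C P t)"
  by (rule P.PT_eqI[OF add_map_comp[OF chiPT_add_map Q.can_add_map] add_map_comp[OF P.can_add_map chiC_add_map] assms])
    (simp add: chiPT_pp Q.can_pp P.can_pp chiC_left_act P.coact_closed chiC_coact chi_simps)

lemma chiPT_surj:
  assumes "z \<in> carrier Q.PT"
  shows "\<exists>t\<in>carrier P.PT. chiPT t = z"
  using assms unfolding Q.PT_eq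
proof (induction z rule: Q.P.T_induct)
  case (pure v w)
  obtain p q where "p \<in> carrier P" "q \<in> carrier P" "\<chi> p = v" "\<chi> q = w"
    using pure by (meson chi_surjE)
  then show ?case using chiPT_pp[of p q] by (auto simp: Q.pp_eq intro!: bexI[of _ "P.pp p q"])
next
  case (add x y)
  then obtain s t where "s \<in> carrier P.PT" "t \<in> carrier P.PT" "chiPT s = x" "chiPT t = y" by blast
  then show ?case
    using add_map_add[OF chiPT_add_map, of s t] by (auto simp: Q.PT_eq intro!: bexI[of _ "s \<oplus>\<^bsub>P.PT\<^esub> t"])
qed

text \<open>Right exactness again, now with the scalars changing from the coinvariants of
  \<open>P\<close> to those of \<open>Q\<close>; every coinvariant of \<open>Q\<close> lifts by
  \<open>chi_coinv\<close>.\<close>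

lemma chiPT_kernel:
  assumes "t \<in> carrier P.PT" "chiPT t = \<zero>\<^bsub>Q.PT\<^esub>"
  shows "t \<in> generate (add_monoid P.PT) ({P.pp j q | j q. j \<in> J \<and> q \<in> carrier P} \<union>
     {P.pp p j | p j. p \<in> carrier P \<and> j \<in> J})"
proof -
  have "t \<in> generate (add_monoid P.P.T)
    ({P.P.pure x w | x w. x \<in> carrier P \<and> \<chi> x = \<zero>\<^bsub>Q\<^esub> \<and> w \<in> carrier P} \<union>
     {P.P.pure v y | v y. v \<in> carrier P \<and> y \<in> carrier P \<and> \<chi> y = \<zero>\<^bsub>Q\<^esub>})"
  proof (rule tensor_kernel[OF P.P.bal_pair_axioms Q.P.bal_pair_axioms chi_add_map chi_surj chi_add_map chi_surj])
    show "add_map P.P.T Q.P.T chiPT" using chiPT_add_map by (simp add: P.PT_eq Q.PT_eq)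
    show "chiPT (P.P.pure v w) = Q.P.pure (\<chi> v) (\<chi> w)" if "v \<in> carrier P" "w \<in> carrier P" for v w
      using chiPT_pp[OF that] by (simp add: P.pp_eq Q.pp_eq)
    fix s' assume "s' \<in> Q.B"
    then obtain b where "b \<in> P.B" "s' = \<chi> b" using chi_coinv by blast
    then show "\<exists>s\<in>P.B. (\<forall>v\<in>carrier P. \<chi> (v \<otimes>\<^bsub>P\<^esub> s) = \<chi> v \<otimes>\<^bsub>Q\<^esub> s') \<and>
        (\<forall>w\<in>carrier P. \<chi> (s \<otimes>\<^bsub>P\<^esub> w) = s' \<otimes>\<^bsub>Q\<^esub> \<chi> w)"
      by (auto simp: chi_mult P.coinv_closed)
  qed (use assms in \<open>simp_all add: P.PT_eq Q.PT_eq\<close>)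
  moreover have "{P.P.pure x w | x w. x \<in> carrier P \<and> \<chi> x = \<zero>\<^bsub>Q\<^esub> \<and> w \<in> carrier P} \<union>
     {P.P.pure v y | v y. v \<in> carrier P \<and> y \<in> carrier P \<and> \<chi> y = \<zero>\<^bsub>Q\<^esub>} =
    {P.pp j q | j q. j \<in> J \<and> q \<in> carrier P} \<union> {P.pp p j | p j. p \<in> carrier P \<and> j \<in> J}"
    by (auto simp: J_def P.pp_eq)
  ultimately show ?thesis by (simp add: P.PT_eq)
qed

end

section \<open>Complements of submodules over a field\<close>

text \<open>By Zorn, choose N maximal among the submodules containing \<open>H2\<close> and meeting
  \<open>H1\<close> in 0. Over a field N is a complement of \<open>H1\<close>, and \<open>r\<close>
  is the projection onto \<open>H1\<close> along N.\<close>

lemma submodule_projection: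
  assumes K: "field K" and M: "module K M" and H1: "submodule H1 K M" and H2: "submodule H2 K M"
    and disj: "H1 \<inter> H2 = {\<zero>\<^bsub>M\<^esub>}"
  obtains r where "r \<in> linear_maps K M M" "\<And>x. x \<in> carrier M \<Longrightarrow> r x \<in> H1"
    "\<And>x. x \<in> H1 \<Longrightarrow> r x = x" "\<And>x. x \<in> H2 \<Longrightarrow> r x = \<zero>\<^bsub>M\<^esub>"
proof -
  interpret K: field K by (rule K)
  interpret M: module K M by (rule M)
  let ?A = "{N. submodule N K M \<and> H2 \<subseteq> N \<and> H1 \<inter> N = {\<zero>\<^bsub>M\<^esub>}}"
  note sD = M.submoduleE
  have "\<exists>N\<in>?A. \<forall>N'\<in>?A. N \<subseteq> N' \<longrightarrow> N' = N"
  proof (rule subset_Zorn_nonempty)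
    show "?A \<noteq> {}" using H2 disj by blast
    fix \<C> assume ne: "\<C> \<noteq> {}" and ch: "subset.chain ?A \<C>"
    have mem: "N \<in> \<C> \<Longrightarrow> submodule N K M \<and> H2 \<subseteq> N \<and> H1 \<inter> N = {\<zero>\<^bsub>M\<^esub>}" for N
      using ch by (auto simp: subset_chain_def)
    have tot: "N \<in> \<C> \<Longrightarrow> N' \<in> \<C> \<Longrightarrow> N \<subseteq> N' \<or> N' \<subseteq> N" for N N'
      using ch by (auto simp: subset_chain_def)
    have "submodule (\<Union>\<C>) K M"
    proof (rule M.submoduleI)
      show "\<Union>\<C> \<subseteq> carrier M" using mem sD(1) by blast
      show "\<zero>\<^bsub>M\<^esub> \<in> \<Union>\<C>" using ne mem by blast
      show "\<ominus>\<^bsub>M\<^esub> a \<in> \<Union>\<C>" if "a \<in> \<Union>\<C>" for a using that mem sD(3) by blast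
      show "k \<odot>\<^bsub>M\<^esub> a \<in> \<Union>\<C>" if "k \<in> carrier K" "a \<in> \<Union>\<C>" for k a using that mem sD(4) by blast
      fix a b assume "a \<in> \<Union>\<C>" "b \<in> \<Union>\<C>"
      then obtain N N' where "N \<in> \<C>" "a \<in> N" "N' \<in> \<C>" "b \<in> N'" by blast
      then obtain N'' where "N'' \<in> \<C>" "a \<in> N''" "b \<in> N''" using tot by blast
      then show "a \<oplus>\<^bsub>M\<^esub> b \<in> \<Union>\<C>" using mem sD(5) by blast
    qed
    then show "\<Union>\<C> \<in> ?A" using ne mem by auto
  qed
  then obtain N where N: "submodule N K M" "H2 \<subseteq> N" "H1 \<inter> N = {\<zero>\<^bsub>M\<^esub>}"
    and max: "\<And>N'. submodule N' K M \<Longrightarrow> N \<subseteq> N' \<Longrightarrow> H1 \<inter> N' = {\<zero>\<^bsub>M\<^esub>} \<Longrightarrow> N' = N"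
    by (smt (verit) Orderings.order.trans mem_Collect_eq)
  have Nc: "n \<in> carrier M" if "n \<in> N" for n using sD(1)[OF N(1)] that by blast
  have Hc: "h \<in> carrier M" if "h \<in> H1" for h using sD(1)[OF H1] that by blast
  \<comment> \<open>If \<open>x\<close> were outside \<open>H1\<close> + \<open>N\<close>, the
    submodule spanned by \<open>N\<close> and \<open>x\<close> would contradict maximality.\<close>
  have decomp: "\<exists>h\<in>H1. \<exists>n\<in>N. x = h \<oplus>\<^bsub>M\<^esub> n" if x: "x \<in> carrier M" for x
  proof (rule ccontr)
    assume no: "\<not> ?thesis"
    define N' where "N' = {n \<oplus>\<^bsub>M\<^esub> a \<odot>\<^bsub>M\<^esub> x | n a. n \<in> N \<and> a \<in> carrier K}"
    have "submodule N' K M"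
    proof (rule M.submoduleI)
      show "N' \<subseteq> carrier M" using x Nc by (auto simp: N'_def)
      have "\<zero>\<^bsub>M\<^esub> = \<zero>\<^bsub>M\<^esub> \<oplus>\<^bsub>M\<^esub> \<zero>\<^bsub>K\<^esub> \<odot>\<^bsub>M\<^esub> x" using x by simp
      then show "\<zero>\<^bsub>M\<^esub> \<in> N'" using N(3) by (force simp: N'_def)
    next
      fix y assume "y \<in> N'"
      then obtain n a where y: "y = n \<oplus>\<^bsub>M\<^esub> a \<odot>\<^bsub>M\<^esub> x" "n \<in> N" "a \<in> carrier K" by (auto simp: N'_def)
      have "\<ominus>\<^bsub>M\<^esub> y = \<ominus>\<^bsub>M\<^esub> n \<oplus>\<^bsub>M\<^esub> (\<ominus>\<^bsub>K\<^esub> a) \<odot>\<^bsub>M\<^esub> x"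
        using y x Nc by (simp add: M.smult_l_minus M.minus_add)
      then show "\<ominus>\<^bsub>M\<^esub> y \<in> N'" using y sD(3)[OF N(1)] by (auto simp: N'_def)
    next
      fix k y assume k: "k \<in> carrier K" and "y \<in> N'"
      then obtain n a where y: "y = n \<oplus>\<^bsub>M\<^esub> a \<odot>\<^bsub>M\<^esub> x" "n \<in> N" "a \<in> carrier K" by (auto simp: N'_def)
      have "k \<odot>\<^bsub>M\<^esub> y = k \<odot>\<^bsub>M\<^esub> n \<oplus>\<^bsub>M\<^esub> (k \<otimes>\<^bsub>K\<^esub> a) \<odot>\<^bsub>M\<^esub> x"
        using y x k Nc by (simp add: M.smult_r_distr M.smult_assoc1)
      then show "k \<odot>\<^bsub>M\<^esub> y \<in> N'" using y k sD(4)[OF N(1)] by (auto simp: N'_def)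
    next
      fix y z assume "y \<in> N'" "z \<in> N'"
      then obtain n a m b where y: "y = n \<oplus>\<^bsub>M\<^esub> a \<odot>\<^bsub>M\<^esub> x" "n \<in> N" "a \<in> carrier K"
        "z = m \<oplus>\<^bsub>M\<^esub> b \<odot>\<^bsub>M\<^esub> x" "m \<in> N" "b \<in> carrier K" by (auto simp: N'_def)
      have "y \<oplus>\<^bsub>M\<^esub> z = (n \<oplus>\<^bsub>M\<^esub> m) \<oplus>\<^bsub>M\<^esub> (a \<oplus>\<^bsub>K\<^esub> b) \<odot>\<^bsub>M\<^esub> x"
        using y x Nc by (simp add: M.smult_l_distr M.a_ac)
      then show "y \<oplus>\<^bsub>M\<^esub> z \<in> N'" using y sD(5)[OF N(1)] by (auto simp: N'_def)
    qed
    moreover have NN': "N \<subseteq> N'"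
    proof
      fix n assume n: "n \<in> N"
      then have "n = n \<oplus>\<^bsub>M\<^esub> \<zero>\<^bsub>K\<^esub> \<odot>\<^bsub>M\<^esub> x" using x Nc by simp
      then show "n \<in> N'" unfolding N'_def using n K.zero_closed by blast
    qed
    moreover have "H1 \<inter> N' = {\<zero>\<^bsub>M\<^esub>}"
    proof
      show "{\<zero>\<^bsub>M\<^esub>} \<subseteq> H1 \<inter> N'" using NN' N(3) by blast
      show "H1 \<inter> N' \<subseteq> {\<zero>\<^bsub>M\<^esub>}"
      proof
        fix h assume "h \<in> H1 \<inter> N'"
        then obtain n a where h: "h \<in> H1" "h = n \<oplus>\<^bsub>M\<^esub> a \<odot>\<^bsub>M\<^esub> x" "n \<in> N" "a \<in> carrier K"
          by (auto simp: N'_def)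
        show "h \<in> {\<zero>\<^bsub>M\<^esub>}"
        proof (cases "a = \<zero>\<^bsub>K\<^esub>")
          case True
          then have "h = n" using h x Nc by simp
          then show ?thesis using h N(3) by blast
        next
          case False
          \<comment> \<open>Dividing by \<open>a\<close>, possible over a field, puts
            \<open>x\<close> into \<open>H1\<close> + \<open>N\<close>.\<close>
          then have u: "a \<in> Units K" using h(4) by (simp add: K.field_Units)
          have ax: "a \<odot>\<^bsub>M\<^esub> x = h \<oplus>\<^bsub>M\<^esub> \<ominus>\<^bsub>M\<^esub> n"
            using h x Nc by (simp add: M.a_ac M.r_neg2 M.r_neg1)
          have "x = (inv\<^bsub>K\<^esub> a \<otimes>\<^bsub>K\<^esub> a) \<odot>\<^bsub>M\<^esub> x" using u x by (simp add: K.Units_l_inv)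
          also have "\<dots> = inv\<^bsub>K\<^esub> a \<odot>\<^bsub>M\<^esub> (h \<oplus>\<^bsub>M\<^esub> \<ominus>\<^bsub>M\<^esub> n)"
            by (simp only: M.smult_assoc1[OF K.Units_inv_closed[OF u] h(4) x] ax)
          also have "\<dots> = inv\<^bsub>K\<^esub> a \<odot>\<^bsub>M\<^esub> h \<oplus>\<^bsub>M\<^esub> inv\<^bsub>K\<^esub> a \<odot>\<^bsub>M\<^esub> (\<ominus>\<^bsub>M\<^esub> n)"
            using u h Nc Hc by (simp add: M.smult_r_distr)
          finally show ?thesis
            using no u h sD(4)[OF H1] sD(4)[OF N(1)] sD(3)[OF N(1)] by blast
        qed
      qed
    qed
    ultimately have "N' = N" by (rule max)
    moreover have "x = \<zero>\<^bsub>M\<^esub> \<oplus>\<^bsub>M\<^esub> \<one>\<^bsub>K\<^esub> \<odot>\<^bsub>M\<^esub> x" using x by simp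
    then have "x \<in> N'" unfolding N'_def using N(3) K.one_closed by blast
    ultimately have "x \<in> N" by simp
    moreover have "x = \<zero>\<^bsub>M\<^esub> \<oplus>\<^bsub>M\<^esub> x" using x by simp
    ultimately show False using no N(3) by blast
  qed
  have uniq: "h = h'" if "h \<in> H1" "n \<in> N" "h' \<in> H1" "n' \<in> N" "h \<oplus>\<^bsub>M\<^esub> n = h' \<oplus>\<^bsub>M\<^esub> n'" for h n h' n'
  proof -
    have c: "h \<in> carrier M" "h' \<in> carrier M" "n \<in> carrier M" "n' \<in> carrier M" using that Nc Hc by auto
    have "h \<ominus>\<^bsub>M\<^esub> h' = (h \<oplus>\<^bsub>M\<^esub> n) \<oplus>\<^bsub>M\<^esub> (\<ominus>\<^bsub>M\<^esub> n \<oplus>\<^bsub>M\<^esub> \<ominus>\<^bsub>M\<^esub> h')"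
      using c by (simp add: a_minus_def M.a_assoc M.r_neg2)
    also have "\<dots> = n' \<oplus>\<^bsub>M\<^esub> \<ominus>\<^bsub>M\<^esub> n"
      unfolding that(5) using c
      by (simp add: M.a_comm[of h' n'] M.a_comm[of "\<ominus>\<^bsub>M\<^esub> n" "\<ominus>\<^bsub>M\<^esub> h'"] M.a_assoc M.r_neg2)
    finally have e: "h \<ominus>\<^bsub>M\<^esub> h' = n' \<oplus>\<^bsub>M\<^esub> \<ominus>\<^bsub>M\<^esub> n" .
    have "h \<ominus>\<^bsub>M\<^esub> h' \<in> H1" using that sD(3,5)[OF H1] by (simp add: a_minus_def)
    moreover have "h \<ominus>\<^bsub>M\<^esub> h' \<in> N" unfolding e using that sD(3,5)[OF N(1)] by simp
    ultimately have "h \<ominus>\<^bsub>M\<^esub> h' = \<zero>\<^bsub>M\<^esub>" using N(3) by blast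
    then show ?thesis by (rule M.minus_zeroD[OF c(1,2)])
  qed
  define r where "r x = (THE h. h \<in> H1 \<and> (\<exists>n\<in>N. x = h \<oplus>\<^bsub>M\<^esub> n))" for x
  have r: "r (h \<oplus>\<^bsub>M\<^esub> n) = h" if "h \<in> H1" "n \<in> N" for h n
    unfolding r_def using that uniq by (intro the_equality) blast+
  show thesis
  proof (rule that)
    show "r x \<in> H1" if "x \<in> carrier M" for x using decomp[OF that] r by auto
    show "r x = x" if "x \<in> H1" for x
      using r[of x "\<zero>\<^bsub>M\<^esub>"] that N(3) Hc by auto
    show "r x = \<zero>\<^bsub>M\<^esub>" if "x \<in> H2" for x
      using r[of "\<zero>\<^bsub>M\<^esub>" x] that N Nc by auto
    show "r \<in> linear_maps K M M"
      unfolding linear_maps_def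
    proof (intro CollectI conjI ballI Pi_I)
      show "r x \<in> carrier M" if "x \<in> carrier M" for x using decomp[OF that] r Hc by auto
      fix x y assume "x \<in> carrier M" "y \<in> carrier M"
      then obtain h n h' n' where *: "h \<in> H1" "n \<in> N" "x = h \<oplus>\<^bsub>M\<^esub> n" "h' \<in> H1" "n' \<in> N" "y = h' \<oplus>\<^bsub>M\<^esub> n'"
        using decomp by meson
      then have "x \<oplus>\<^bsub>M\<^esub> y = (h \<oplus>\<^bsub>M\<^esub> h') \<oplus>\<^bsub>M\<^esub> (n \<oplus>\<^bsub>M\<^esub> n')" using Hc Nc by (simp add: M.a_ac)
      then show "r (x \<oplus>\<^bsub>M\<^esub> y) = r x \<oplus>\<^bsub>M\<^esub> r y"
        using * r sD(5)[OF H1] sD(5)[OF N(1)] by simp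
    next
      fix a x assume a: "a \<in> carrier K" and "x \<in> carrier M"
      then obtain h n where *: "h \<in> H1" "n \<in> N" "x = h \<oplus>\<^bsub>M\<^esub> n" using decomp by meson
      then have "a \<odot>\<^bsub>M\<^esub> x = a \<odot>\<^bsub>M\<^esub> h \<oplus>\<^bsub>M\<^esub> a \<odot>\<^bsub>M\<^esub> n" using a Hc Nc by (simp add: M.smult_r_distr)
      then show "r (a \<odot>\<^bsub>M\<^esub> x) = a \<odot>\<^bsub>M\<^esub> r x"
        using * a r sD(4)[OF H1] sD(4)[OF N(1)] by simp
    qed
  qed
qed

section \<open>Gluing two extensions\<close>

text \<open>\<open>r\<close> is the projection onto J_1 obtained from a complement that contains
  J_2, and \<open>gam_comm\<close> is the form in which the commutation hypothesis enters:
  \<open>N\<close>, the set of coinvariants in J_1, corresponds under \<chi>2 to the kernel of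
  \<pi>.\<close>

locale glued_extension = S1: comodule_algebra_surj K C P Q1 \<chi>1 + S2: comodule_algebra_surj K C P Q2 \<chi>2 +
    L: cleft_galois K C Q2 \<gamma> g
  for K :: "('k, 'r) ring_scheme" and C :: "('k, 'c, 's) coalg_scheme"
    and P :: "('k, 'p, 'c, 't) comod_alg_scheme" and Q1 :: "('k, 'q1, 'c, 't1) comod_alg_scheme"
    and Q2 :: "('k, 'q2, 'c, 't2) comod_alg_scheme" and \<chi>1 \<chi>2 \<gamma> g +
  fixes r :: "'p \<Rightarrow> 'p"
  assumes disj: "S1.J \<inter> S2.J = {\<zero>\<^bsub>P\<^esub>}"
    and coact_J: "j \<in> S1.J \<Longrightarrow> coact P j \<in> S1.JC"
    and can1: "bij_betw (can_map K C Q1) (carrier (tensor_over Q1 (coinvariants K C Q1))) (carrier (tensor K Q1 C))"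
    and can2: "bij_betw (can_map K C Q2) (carrier (tensor_over Q2 (coinvariants K C Q2))) (carrier (tensor K Q2 C))"
    and r_linear: "r \<in> linear_maps K P P"
    and r_range: "p \<in> carrier P \<Longrightarrow> r p \<in> S1.J"
    and r_id: "p \<in> S1.J \<Longrightarrow> r p = p"
    and r_zero: "p \<in> S2.J \<Longrightarrow> r p = \<zero>\<^bsub>P\<^esub>"
    and gam_comm: "n \<in> coinvariants K C P \<Longrightarrow> n \<in> S1.J \<Longrightarrow> c \<in> carrier C \<Longrightarrow> \<chi>2 n \<otimes>\<^bsub>Q2\<^esub> \<gamma> c \<in>
      generate (add_monoid Q2) {q \<otimes>\<^bsub>Q2\<^esub> \<chi>2 n' | q n'. q \<in> carrier Q2 \<and> n' \<in> coinvariants K C P \<and> n' \<in> S1.J}"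
begin

abbreviation N where "N \<equiv> coinvariants K C P \<inter> S1.J"

section \<open>Injectivity of \<chi>2 on J_1 and on J_1 \<otimes> C\<close>

lemma J_inj: "j \<in> S1.J \<Longrightarrow> j' \<in> S1.J \<Longrightarrow> \<chi>2 j = \<chi>2 j' \<Longrightarrow> j = j'"
proof -
  assume j: "j \<in> S1.J" "j' \<in> S1.J" "\<chi>2 j = \<chi>2 j'"
  have c: "j \<in> carrier P" "j' \<in> carrier P" using j S1.J_closed by auto
  have "j \<ominus>\<^bsub>P\<^esub> j' \<in> S1.J \<inter> S2.J"
    using j c S1.J_minus by (simp add: S2.J_def S2.chi_minus S2.chi_simps S2.Q.A.minus_self)
  then show "j = j'" using disj by (intro S1.P.A.minus_zeroD[OF c]) blast
qed

definition sec where "sec q = (SOME p. p \<in> carrier P \<and> \<chi>2 p = q)"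

lemma sec: "q \<in> carrier Q2 \<Longrightarrow> sec q \<in> carrier P" "q \<in> carrier Q2 \<Longrightarrow> \<chi>2 (sec q) = q"
proof -
  assume q: "q \<in> carrier Q2"
  obtain p where "p \<in> carrier P" "\<chi>2 p = q" using S2.chi_surjE[OF q] .
  then have "sec q \<in> carrier P \<and> \<chi>2 (sec q) = q" unfolding sec_def by (intro someI) blast
  then show "sec q \<in> carrier P" "\<chi>2 (sec q) = q" by auto
qed

text \<open>As \<open>r\<close> vanishes on the kernel of \<chi>2, it factors through
  \<open>Q2\<close>.\<close>

lemma r_eq:
  assumes p: "p \<in> carrier P" "p' \<in> carrier P" and "\<chi>2 p = \<chi>2 p'"
  shows "r p = r p'"
proof -
  have "p \<ominus>\<^bsub>P\<^esub> p' \<in> S2.J"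
    using assms by (simp add: S2.J_def S2.chi_minus S2.chi_simps S2.Q.A.minus_self)
  then have "r p \<ominus>\<^bsub>P\<^esub> r p' = \<zero>\<^bsub>P\<^esub>"
    using r_zero add_map_minus[OF S1.P.A.abelian_group_axioms S1.P.A.abelian_group_axioms linear_add_map[OF r_linear] p] by simp
  then show ?thesis
    using p r_range S1.J_closed by (intro S1.P.A.minus_zeroD[of "r p" "r p'"]) auto
qed

text \<open>\<open>sec\<close> is a mere set-theoretic choice, but its composite with
  \<open>r\<close> is the map \<open>Q2\<close> \<rightarrow> J_1 induced by \<open>r\<close>, hence
  linear. It is left inverse to \<chi>2 on J_1.\<close>

lemma r_sec_linear: "(\<lambda>q. r (sec q)) \<in> linear_maps K Q2 P"
  unfolding linear_maps_def
proof (intro CollectI conjI ballI Pi_I)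
  note rl = linear_mapsD[OF r_linear]
  show "r (sec q) \<in> carrier P" if "q \<in> carrier Q2" for q using that by (simp add: rl sec)
  show "r (sec (x \<oplus>\<^bsub>Q2\<^esub> y)) = r (sec x) \<oplus>\<^bsub>P\<^esub> r (sec y)" if "x \<in> carrier Q2" "y \<in> carrier Q2" for x y
  proof -
    have "r (sec (x \<oplus>\<^bsub>Q2\<^esub> y)) = r (sec x \<oplus>\<^bsub>P\<^esub> sec y)"
      by (rule r_eq) (use that in \<open>simp_all add: sec S2.chi_simps\<close>)
    then show ?thesis using that by (simp add: rl sec)
  qed
  show "r (sec (a \<odot>\<^bsub>Q2\<^esub> x)) = a \<odot>\<^bsub>P\<^esub> r (sec x)" if "a \<in> carrier K" "x \<in> carrier Q2" for a x
  proof -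
    have "r (sec (a \<odot>\<^bsub>Q2\<^esub> x)) = r (a \<odot>\<^bsub>P\<^esub> sec x)"
      by (rule r_eq) (use that in \<open>simp_all add: sec S2.chi_simps\<close>)
    then show ?thesis using that by (simp add: rl sec)
  qed
qed

text \<open>A linear left inverse survives tensoring with C, which injectivity of \<chi>2 on J_1
  alone would not do over a general ring.\<close>

lemma chiC_inj:
  assumes t: "t \<in> S1.JC" and t': "t' \<in> S1.JC" and eq: "S2.chiC t = S2.chiC t'"
  shows "t = t'"
proof -
  define R where "R = tensor_map K P C (\<lambda>q. r (sec q)) (\<lambda>c. c)"
  have b: "bilin K Q2 C S1.P.PC (\<lambda>q c. S1.P.VC.pu (r (sec q)) c)"
    by (rule bilin_comp[OF S1.P.VC.bilin_pu r_sec_linear linear_maps_id])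
  have R: "add_map S2.Q.PC S1.P.PC R"
    unfolding R_def tensor_map_def by (rule S2.Q.VC.lift_add_map[OF S1.P.VC.abelian_TT b])
  have "R (S2.chiC x) = x" if x: "x \<in> S1.JC" for x
  proof (rule gen_eq[OF S1.P.VC.abelian_TT S1.P.VC.abelian_TT add_map_comp[OF S2.chiC_add_map R] _ S1.JC_gens _ x[unfolded S1.JC_def]])
    show "add_map S1.P.PC S1.P.PC (\<lambda>x. x)" by (simp add: add_map_def)
    fix z assume "z \<in> {S1.P.VC.pu j c |j c. j \<in> S1.J \<and> c \<in> carrier C}"
    then obtain j c where z: "z = S1.P.VC.pu j c" "j \<in> S1.J" "c \<in> carrier C" by blast
    have jc: "j \<in> carrier P" using z S1.J_closed by blast
    have "r (sec (\<chi>2 j)) = r j" by (rule r_eq) (use jc in \<open>simp_all add: sec S2.chi_simps\<close>)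
    moreover have "R (S2.Q.VC.pu (\<chi>2 j) c) = S1.P.VC.pu (r (sec (\<chi>2 j))) c"
      unfolding R_def tensor_map_def
      by (rule S2.Q.VC.lift_pu[OF S1.P.VC.abelian_TT b]) (use jc z in \<open>simp_all add: S2.chi_simps\<close>)
    ultimately show "R (S2.chiC z) = z"
      using z jc by (simp add: S2.chiC_pu r_id)
  qed
  then show ?thesis using t t' eq by metis
qed

text \<open>Both sides of the coinvariance identity lie in \<open>S1.JC\<close>: j p is in the ideal
  J_1, a subcomodule, and j \<rho>(p) has its left factors in J_1. They may be compared in
  \<open>Q2\<close> \<otimes> C, where the identity is coinvariance of \<chi>2(j).\<close>

lemma coinv_lift:
  assumes j: "j \<in> S1.J" and b: "\<chi>2 j \<in> coinvariants K C Q2"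
  shows "j \<in> coinvariants K C P"
proof (rule S1.P.coinvI)
  show jc: "j \<in> carrier P" using j by (rule S1.J_closed)
  fix p assume p: "p \<in> carrier P"
  show "coact P (j \<otimes>\<^bsub>P\<^esub> p) = left_act K C P j (coact P p)"
  proof (rule chiC_inj)
    show "coact P (j \<otimes>\<^bsub>P\<^esub> p) \<in> S1.JC" by (rule coact_J[OF S1.J_mult_right[OF j p]])
    show "left_act K C P j (coact P p) \<in> S1.JC" by (rule S1.JC_left_act[OF j S1.P.coact_closed[OF p]])
    show "S2.chiC (coact P (j \<otimes>\<^bsub>P\<^esub> p)) = S2.chiC (left_act K C P j (coact P p))"
      using p jc b by (simp add: S2.chiC_coact S2.chiC_left_act S1.P.coact_closed S2.chi_mult
          S2.Q.coinv_coact S2.chi_simps)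
  qed
qed

section \<open>Generators of J_1\<close>

lemma chiJ_subgroup: "subgroup (\<chi>2 ` S1.J) (add_monoid Q2)"
proof -
  interpret h: abelian_group_hom P Q2 \<chi>2
    by (rule add_map_hom[OF S1.P.A.abelian_group_axioms S2.Q.A.abelian_group_axioms S2.chi_add_map])
  interpret gh: group_hom "add_monoid P" "add_monoid Q2" \<chi>2
    by (rule h.a_group_hom)
  show ?thesis by (rule gh.subgroup_img_is_subgroup[OF S1.J_subgroup])
qed

text \<open>J_1 being a subcomodule, \<rho>(j) lies in the span of the j' \<otimes> c with j' in
  J_1, so only the values f(\<chi>2(j'), c) have to be inspected.\<close>

lemma lift_JC:
  assumes b: "bilin K Q2 C Q2 f" and H: "subgroup H (add_monoid Q2)" and j: "j \<in> S1.J"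
    and f: "\<And>j c. j \<in> S1.J \<Longrightarrow> c \<in> carrier C \<Longrightarrow> f (\<chi>2 j) c \<in> H"
  shows "tensor_lift Q2 f (coact Q2 (\<chi>2 j)) \<in> H"
proof -
  have "tensor_lift Q2 f (S2.chiC (coact P j)) \<in> H"
  proof (rule gen_image[OF S1.P.VC.abelian_TT S2.Q.A.abelian_group_axioms
      add_map_comp[OF S2.chiC_add_map S2.Q.VC.lift_add_map[OF S2.Q.A.abelian_group_axioms b]] S1.JC_gens _ H
      coact_J[OF j, unfolded S1.JC_def]], clarify)
    fix j c assume "j \<in> S1.J" "c \<in> carrier C"
    then show "tensor_lift Q2 f (S2.chiC (S1.P.VC.pu j c)) \<in> H"
      using S2.Q.VC.lift_pu[OF S2.Q.A.abelian_group_axioms b] f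
      by (simp add: S2.chiC_pu S1.J_closed S2.chi_simps)
  qed
  then show ?thesis using j by (simp add: S2.chiC_coact S1.J_closed)
qed

text \<open>For q = \<chi>2(j), the element q0 g(q1) stays in the ideal \<chi>2(J_1) and is
  coinvariant by \<open>E_coinvariant\<close>; \<open>coinv_lift\<close> carries coinvariance up to
  P.\<close>

lemma E_J:
  assumes j: "j \<in> S1.J"
  shows "L.E (\<chi>2 j) \<in> \<chi>2 ` N"
proof -
  have jc: "j \<in> carrier P" using j by (rule S1.J_closed)
  have "L.E (\<chi>2 j) \<in> \<chi>2 ` S1.J"
    unfolding L.E_def
  proof (rule lift_JC[OF L.bilin_E chiJ_subgroup j])
    fix j c assume j: "j \<in> S1.J" and c: "c \<in> carrier C"
    have "\<chi>2 j \<otimes>\<^bsub>Q2\<^esub> g c = \<chi>2 (j \<otimes>\<^bsub>P\<^esub> sec (g c))"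
      using j c by (simp add: S2.chi_mult sec L.gam_simps S1.J_closed)
    then show "\<chi>2 j \<otimes>\<^bsub>Q2\<^esub> g c \<in> \<chi>2 ` S1.J"
      using j c by (auto intro!: imageI S1.J_mult_right sec L.gam_simps)
  qed
  then obtain k where k: "k \<in> S1.J" "L.E (\<chi>2 j) = \<chi>2 k" by blast
  have "L.E (\<chi>2 j) \<in> coinvariants K C Q2" by (rule L.E_coinvariant) (simp add: jc S2.chi_simps)
  then have "k \<in> coinvariants K C P" using k by (intro coinv_lift) simp_all
  then show ?thesis using k by auto
qed

text \<open>\<open>E_decomp\<close> writes q = \<chi>2(j) as E(q0) \<gamma>(q1), and the
  coefficients lie in \<chi>2(N) by \<open>E_J\<close>.\<close>

lemma chiJ_gen:
  assumes j: "j \<in> S1.J"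
  shows "\<chi>2 j \<in> generate (add_monoid Q2) {\<chi>2 n \<otimes>\<^bsub>Q2\<^esub> \<gamma> c | n c. n \<in> N \<and> c \<in> carrier C}"
proof -
  let ?Z = "{\<chi>2 n \<otimes>\<^bsub>Q2\<^esub> \<gamma> c | n c. n \<in> N \<and> c \<in> carrier C}"
  have Z: "?Z \<subseteq> carrier Q2" by (auto simp: S2.chi_simps L.gam_simps S1.J_closed)
  note El = add_map_closed[OF L.E_add_map] add_map_add[OF L.E_add_map]
  have b: "bilin K Q2 C Q2 (\<lambda>p c. L.E p \<otimes>\<^bsub>Q2\<^esub> \<gamma> c)"
    by (rule L.bilin_E_gam)
  have "tensor_lift Q2 (\<lambda>p c. L.E p \<otimes>\<^bsub>Q2\<^esub> \<gamma> c) (coact Q2 (\<chi>2 j)) \<in> generate (add_monoid Q2) ?Z"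
  proof (rule lift_JC[OF b S2.Q.A.gen_subgroup[OF Z] j])
    fix j c assume j: "j \<in> S1.J" and c: "c \<in> carrier C"
    obtain n where "n \<in> N" "L.E (\<chi>2 j) = \<chi>2 n" using E_J[OF j] by (elim imageE)
    then have "L.E (\<chi>2 j) \<otimes>\<^bsub>Q2\<^esub> \<gamma> c \<in> ?Z" using c by auto
    then show "L.E (\<chi>2 j) \<otimes>\<^bsub>Q2\<^esub> \<gamma> c \<in> generate (add_monoid Q2) ?Z"
      by (rule S2.Q.A.gen_incl)
  qed
  then show ?thesis
    using L.E_decomp[of "\<chi>2 j"] j by (simp add: S1.J_closed S2.chi_simps)
qed

text \<open>As \<chi>2 is injective on J_1, membership in the span of a subset of J_1 can be tested
  in \<open>Q2\<close>.\<close>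

lemma J_genI:
  assumes j: "j \<in> S1.J" and Z: "Z \<subseteq> S1.J" and g: "\<chi>2 j \<in> generate (add_monoid Q2) (\<chi>2 ` Z)"
  shows "j \<in> generate (add_monoid P) Z"
proof -
  have Zc: "Z \<subseteq> carrier P" using Z S1.J_closed by blast
  obtain y where y: "y \<in> generate (add_monoid P) Z" "\<chi>2 j = \<chi>2 y"
    by (rule gen_preimage[OF S1.P.A.abelian_group_axioms S2.Q.A.abelian_group_axioms S2.chi_add_map Zc g])
  have "y \<in> S1.J"
    using y(1) S1.P.A.add.generate_subgroup_incl[OF Z S1.J_subgroup] by blast
  then show ?thesis using y J_inj[OF j] by simp
qed

definition gam_lift where "gam_lift c = sec (\<gamma> c)"

lemma gam_lift: "c \<in> carrier C \<Longrightarrow> gam_lift c \<in> carrier P" "c \<in> carrier C \<Longrightarrow> \<chi>2 (gam_lift c) = \<gamma> c"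
  by (simp_all add: gam_lift_def sec L.gam_simps)

text \<open>\<open>N\<close> stands on the left here, so that it can be moved out of a right tensor
  factor.\<close>

lemma N_gen:
  assumes j: "j \<in> S1.J"
  shows "j \<in> generate (add_monoid P) {n \<otimes>\<^bsub>P\<^esub> gam_lift c | n c. n \<in> N \<and> c \<in> carrier C}"
proof (rule J_genI[OF j])
  show "{n \<otimes>\<^bsub>P\<^esub> gam_lift c | n c. n \<in> N \<and> c \<in> carrier C} \<subseteq> S1.J"
    by (auto intro: S1.J_mult_right gam_lift)
  have "\<chi>2 ` {n \<otimes>\<^bsub>P\<^esub> gam_lift c | n c. n \<in> N \<and> c \<in> carrier C} =
      {\<chi>2 n \<otimes>\<^bsub>Q2\<^esub> \<gamma> c | n c. n \<in> N \<and> c \<in> carrier C}"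
    by (force simp: S2.chi_mult gam_lift S1.J_closed image_iff)
  then show "\<chi>2 j \<in> generate (add_monoid Q2) (\<chi>2 ` {n \<otimes>\<^bsub>P\<^esub> gam_lift c | n c. n \<in> N \<and> c \<in> carrier C})"
    using chiJ_gen[OF j] by simp
qed

text \<open>\<open>N\<close> stands on the right here, so that it can be moved out of a left tensor
  factor. \<open>gam_comm\<close> converts the generators \<chi>2(n) \<gamma>(c) into this
  shape.\<close>

lemma gen_N:
  assumes j: "j \<in> S1.J"
  shows "j \<in> generate (add_monoid P) {p \<otimes>\<^bsub>P\<^esub> n | p n. p \<in> carrier P \<and> n \<in> N}"
proof (rule J_genI[OF j])
  show "{p \<otimes>\<^bsub>P\<^esub> n | p n. p \<in> carrier P \<and> n \<in> N} \<subseteq> S1.J"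
    by (auto intro: S1.J_mult_left)
  have eq: "\<chi>2 ` {p \<otimes>\<^bsub>P\<^esub> n | p n. p \<in> carrier P \<and> n \<in> N} =
      {q \<otimes>\<^bsub>Q2\<^esub> \<chi>2 n | q n. q \<in> carrier Q2 \<and> n \<in> coinvariants K C P \<and> n \<in> S1.J}" (is "_ = ?Z")
  proof (intro equalityI subsetI)
    fix z assume "z \<in> ?Z"
    then obtain q n where z: "z = q \<otimes>\<^bsub>Q2\<^esub> \<chi>2 n" "q \<in> carrier Q2" "n \<in> N" by blast
    then have "z = \<chi>2 (sec q \<otimes>\<^bsub>P\<^esub> n)" by (simp add: S2.chi_mult sec S1.J_closed)
    then show "z \<in> \<chi>2 ` {p \<otimes>\<^bsub>P\<^esub> n | p n. p \<in> carrier P \<and> n \<in> N}" using z sec by blast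
  next
    fix z assume "z \<in> \<chi>2 ` {p \<otimes>\<^bsub>P\<^esub> n | p n. p \<in> carrier P \<and> n \<in> N}"
    then obtain p n where z: "z = \<chi>2 (p \<otimes>\<^bsub>P\<^esub> n)" "p \<in> carrier P" "n \<in> N" by blast
    then have "z = \<chi>2 p \<otimes>\<^bsub>Q2\<^esub> \<chi>2 n" "\<chi>2 p \<in> carrier Q2" by (simp_all add: S2.chi_mult S2.chi_simps S1.J_closed)
    then show "z \<in> ?Z" using z by blast
  qed
  have Z: "?Z \<subseteq> carrier Q2" by (auto simp: S2.chi_simps S1.J_closed)
  have "generate (add_monoid Q2) {\<chi>2 n \<otimes>\<^bsub>Q2\<^esub> \<gamma> c | n c. n \<in> N \<and> c \<in> carrier C} \<subseteq> generate (add_monoid Q2) ?Z"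
    by (rule S2.Q.A.gen_subsetI[OF _ Z]) (auto intro: gam_comm)
  then show "\<chi>2 j \<in> generate (add_monoid Q2) (\<chi>2 ` {p \<otimes>\<^bsub>P\<^esub> n | p n. p \<in> carrier P \<and> n \<in> N})"
    unfolding eq using chiJ_gen[OF j] by blast
qed

section \<open>The kernel of the canonical map\<close>

lemma PN_gens: "{p \<otimes>\<^bsub>P\<^esub> n | p n. p \<in> carrier P \<and> n \<in> N} \<subseteq> carrier P"
  by (auto simp: S1.J_closed)

lemma Ngam_gens: "{n \<otimes>\<^bsub>P\<^esub> gam_lift c | n c. n \<in> N \<and> c \<in> carrier C} \<subseteq> carrier P"
  by (auto simp: S1.J_closed gam_lift)

lemma pp_add_maps:
  "q \<in> carrier P \<Longrightarrow> add_map P S1.P.PT (\<lambda>p. S1.P.pp p q)" "p \<in> carrier P \<Longrightarrow> add_map P S1.P.PT (S1.P.pp p)"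
  by (simp_all add: add_map_def S1.P.pp_add_left S1.P.pp_add_right)

text \<open>For j = p n the tensor equals p \<otimes> n k, and n k lies in J_1 \<inter> J_2 =
  0.\<close>

lemma pp_J_J:
  assumes j: "j \<in> S1.J" and k: "k \<in> S2.J"
  shows "S1.P.pp j k = \<zero>\<^bsub>S1.P.PT\<^esub>"
proof (rule gen_zero[OF S1.P.A.abelian_group_axioms S1.P.PT.abelian_group_axioms _ PN_gens _ gen_N[OF j]])
  have kc: "k \<in> carrier P" using k by (rule S2.J_closed)
  then show "add_map P S1.P.PT (\<lambda>p. S1.P.pp p k)" by (rule pp_add_maps)
  fix z assume "z \<in> {p \<otimes>\<^bsub>P\<^esub> n | p n. p \<in> carrier P \<and> n \<in> N}"
  then obtain p n where z: "z = p \<otimes>\<^bsub>P\<^esub> n" "p \<in> carrier P" "n \<in> N" by blast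
  have "n \<otimes>\<^bsub>P\<^esub> k \<in> S1.J \<inter> S2.J"
    using z k kc by (auto intro: S1.J_mult_right S2.J_mult_left S1.J_closed)
  then have "n \<otimes>\<^bsub>P\<^esub> k = \<zero>\<^bsub>P\<^esub>" using disj by blast
  then show "S1.P.pp z k = \<zero>\<^bsub>S1.P.PT\<^esub>"
    using z kc by (simp add: S1.P.pp_bal S1.P.pp_zero_right)
qed

lemma pp_J_eq:
  assumes j: "j \<in> S1.J" and q: "q \<in> carrier P" "q' \<in> carrier P" "\<chi>2 q = \<chi>2 q'"
  shows "S1.P.pp j q = S1.P.pp j q'"
proof -
  have jc: "j \<in> carrier P" using j by (rule S1.J_closed)
  have "q \<ominus>\<^bsub>P\<^esub> q' \<in> S2.J" using q by (simp add: S2.J_def S2.chi_minus S2.chi_simps S2.Q.A.minus_self)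
  then have "S1.P.pp j q \<ominus>\<^bsub>S1.P.PT\<^esub> S1.P.pp j q' = \<zero>\<^bsub>S1.P.PT\<^esub>"
    using pp_J_J[OF j] add_map_minus[OF S1.P.A.abelian_group_axioms S1.P.PT.abelian_group_axioms pp_add_maps(2)[OF jc] q(1,2)]
    by simp
  then show ?thesis using jc q by (intro S1.P.PT.minus_zeroD[of "S1.P.pp j q" "S1.P.pp j q'"]) auto
qed

text \<open>\<open>gam_lift\<close> is not linear, but by \<open>pp_J_eq\<close> the tensor \<open>j \<otimes>\<^sub>B gam_lift c\<close> only depends on \<open>\<gamma> c\<close>.\<close>

definition Omega where "Omega = tensor_lift S1.P.PT (\<lambda>p c. S1.P.pp (r p) (gam_lift c))"

text \<open>\<open>r\<close> puts every left factor into J_1, where \<open>pp_J_eq\<close> makes up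
  for the missing linearity of \<open>gam_lift\<close>. It also lets \<open>Omega\<close> be defined
  on all of P \<otimes> C, although it is applied to \<open>S1.JC\<close>.\<close>

lemma bilin_Omega: "bilin K P C S1.P.PT (\<lambda>p c. S1.P.pp (r p) (gam_lift c))"
proof (rule bilinI)
  note rl = linear_mapsD[OF r_linear]
  fix p c c' assume p: "p \<in> carrier P" and c: "c \<in> carrier C" "c' \<in> carrier C"
  have "S1.P.pp (r p) (gam_lift (c \<oplus>\<^bsub>C\<^esub> c')) = S1.P.pp (r p) (gam_lift c \<oplus>\<^bsub>P\<^esub> gam_lift c')"
    by (rule pp_J_eq[OF r_range[OF p]]) (use c in \<open>simp_all add: gam_lift S2.chi_simps L.gam_simps S1.P.C.add.m_closed\<close>)
  then show "S1.P.pp (r p) (gam_lift (c \<oplus>\<^bsub>C\<^esub> c')) = S1.P.pp (r p) (gam_lift c) \<oplus>\<^bsub>S1.P.PT\<^esub> S1.P.pp (r p) (gam_lift c')"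
    using p c by (simp add: rl gam_lift S1.P.pp_add_right)
next
  note rl = linear_mapsD[OF r_linear]
  fix a p c assume a: "a \<in> carrier K" and p: "p \<in> carrier P" and c: "c \<in> carrier C"
  have "S1.P.pp (r p) (gam_lift (a \<odot>\<^bsub>C\<^esub> c)) = S1.P.pp (r p) (a \<odot>\<^bsub>P\<^esub> gam_lift c)"
    by (rule pp_J_eq[OF r_range[OF p]]) (use a c in \<open>simp_all add: gam_lift S2.chi_simps L.gam_simps\<close>)
  then show "S1.P.pp (r (a \<odot>\<^bsub>P\<^esub> p)) (gam_lift c) = S1.P.pp (r p) (gam_lift (a \<odot>\<^bsub>C\<^esub> c))"
    using a p c by (simp add: rl gam_lift S1.P.pp_smult)
qed (simp_all add: linear_mapsD[OF r_linear] gam_lift S1.P.pp_add_left)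

lemma Omega_add_map: "add_map S1.P.PC S1.P.PT Omega"
  unfolding Omega_def by (rule S1.P.VC.lift_add_map[OF S1.P.PT.abelian_group_axioms bilin_Omega])

lemma Omega_pu: "j \<in> S1.J \<Longrightarrow> c \<in> carrier C \<Longrightarrow> Omega (S1.P.VC.pu j c) = S1.P.pp j (gam_lift c)"
  unfolding Omega_def
  by (subst S1.P.VC.lift_pu[OF S1.P.PT.abelian_group_axioms bilin_Omega]) (simp_all add: S1.J_closed r_id)

lemma can_kernel_Omega:
  assumes t: "t \<in> carrier S1.P.PT" and z: "can_map K C P t = \<zero>\<^bsub>S1.P.PC\<^esub>"
  obtains s where "s \<in> S1.JC" "t = Omega s"
proof -
  let ?M = "{S1.P.pp j (gam_lift c) | j c. j \<in> S1.J \<and> c \<in> carrier C}"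
  let ?Z = "{S1.P.pp j q | j q. j \<in> S1.J \<and> q \<in> carrier P} \<union> {S1.P.pp p j | p j. p \<in> carrier P \<and> j \<in> S1.J}"
  have M: "?M \<subseteq> carrier S1.P.PT" by (auto simp: S1.J_closed gam_lift)
  have "can_map K C Q1 (S1.chiPT t) = can_map K C Q1 \<zero>\<^bsub>S1.Q.PT\<^esub>"
    by (simp add: S1.can_chiPT[OF t] z
        add_map_zero[OF S1.P.VC.abelian_TT S1.Q.VC.abelian_TT S1.chiC_add_map]
        add_map_zero[OF S1.Q.PT.abelian_group_axioms S1.Q.VC.abelian_TT S1.Q.can_add_map])
  then have "S1.chiPT t = \<zero>\<^bsub>S1.Q.PT\<^esub>"
    by (rule inj_onD[OF bij_betw_imp_inj_on[OF can1]]) (simp_all add: add_map_closed[OF S1.chiPT_add_map t])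
  then have tZ: "t \<in> generate (add_monoid S1.P.PT) ?Z"
    by (rule S1.chiPT_kernel[OF t])
  \<comment> \<open>By \<open>N_gen\<close>, j is a sum of elements n \<gamma>(c) up to lifting, and
    p \<otimes> n \<gamma>(c) = p n \<otimes> \<gamma>(c) with p n in J_1.\<close>
  have 1: "S1.P.pp p j \<in> generate (add_monoid S1.P.PT) ?M" if p: "p \<in> carrier P" and j: "j \<in> S1.J" for p j
  proof (rule gen_image[OF S1.P.A.abelian_group_axioms S1.P.PT.abelian_group_axioms pp_add_maps(2)[OF p]
        Ngam_gens _ S1.P.PT.gen_subgroup[OF M] N_gen[OF j]], clarify)
    fix n c assume n: "n \<in> coinvariants K C P" "n \<in> S1.J" and c: "c \<in> carrier C"
    have "S1.P.pp p (n \<otimes>\<^bsub>P\<^esub> gam_lift c) = S1.P.pp (p \<otimes>\<^bsub>P\<^esub> n) (gam_lift c)"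
      using p n c by (simp add: S1.P.pp_bal gam_lift)
    moreover have "p \<otimes>\<^bsub>P\<^esub> n \<in> S1.J" using p n by (simp add: S1.J_mult_left)
    ultimately show "S1.P.pp p (n \<otimes>\<^bsub>P\<^esub> gam_lift c) \<in> generate (add_monoid S1.P.PT) ?M"
      using c by (intro S1.P.PT.gen_incl) blast
  qed
  \<comment> \<open>By \<open>gen_N\<close>, j is a sum of elements p n, and p n \<otimes> q = p
    \<otimes> n q falls under the previous case, n q being in J_1.\<close>
  have 2: "S1.P.pp j q \<in> generate (add_monoid S1.P.PT) ?M" if j: "j \<in> S1.J" and q: "q \<in> carrier P" for j q
  proof (rule gen_image[OF S1.P.A.abelian_group_axioms S1.P.PT.abelian_group_axioms pp_add_maps(1)[OF q]
        PN_gens _ S1.P.PT.gen_subgroup[OF M] gen_N[OF j]], clarify)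
    fix p n assume n: "n \<in> coinvariants K C P" "n \<in> S1.J" and p: "p \<in> carrier P"
    have "S1.P.pp (p \<otimes>\<^bsub>P\<^esub> n) q = S1.P.pp p (n \<otimes>\<^bsub>P\<^esub> q)"
      using p n q by (simp add: S1.P.pp_bal)
    then show "S1.P.pp (p \<otimes>\<^bsub>P\<^esub> n) q \<in> generate (add_monoid S1.P.PT) ?M"
      using 1[OF p S1.J_mult_right[OF n(2) q]] by simp
  qed
  have "generate (add_monoid S1.P.PT) ?Z \<subseteq> generate (add_monoid S1.P.PT) ?M"
    by (rule S1.P.PT.gen_subsetI[OF _ M]) (use 1 2 in blast)
  then have "t \<in> generate (add_monoid S1.P.PT) ?M" using tZ by blast
  also have "?M = Omega ` {S1.P.VC.pu j c | j c. j \<in> S1.J \<and> c \<in> carrier C}"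
    by (force simp: Omega_pu image_iff)
  finally show thesis
    using gen_preimage[OF S1.P.VC.abelian_TT S1.P.PT.abelian_group_axioms Omega_add_map S1.JC_gens] that
    unfolding S1.JC_def by blast
qed

text \<open>On a generator, \<open>Omega\<close> gives j \<otimes> \<gamma>(c), whose canonical
  image becomes \<chi>2(j) \<gamma>(c1) \<otimes> c2 in \<open>Q2\<close> \<otimes> C;
  \<open>Psi_left_act\<close> strips off \<gamma>.\<close>

lemma Psi_can_Omega:
  assumes s: "s \<in> S1.JC"
  shows "L.Psi (S2.chiC (can_map K C P (Omega s))) = S2.chiC s"
proof (rule gen_eq[OF S1.P.VC.abelian_TT S2.Q.VC.abelian_TT
    add_map_comp[OF add_map_comp[OF add_map_comp[OF Omega_add_map S1.P.can_add_map] S2.chiC_add_map] L.Psi_add_map]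
    S2.chiC_add_map S1.JC_gens _ s[unfolded S1.JC_def]], clarify)
  fix j c assume j: "j \<in> S1.J" and c: "c \<in> carrier C"
  then show "L.Psi (S2.chiC (can_map K C P (Omega (S1.P.VC.pu j c)))) = S2.chiC (S1.P.VC.pu j c)"
    by (simp add: Omega_pu S1.P.can_pp S1.J_closed gam_lift S2.chiC_left_act S1.P.coact_closed S2.chiC_coact
        S2.chi_simps L.Psi_left_act S2.chiC_pu)
qed

lemma can_inj_zero:
  assumes t: "t \<in> carrier S1.P.PT" and z: "can_map K C P t = \<zero>\<^bsub>S1.P.PC\<^esub>"
  shows "t = \<zero>\<^bsub>S1.P.PT\<^esub>"
proof -
  obtain s where s: "s \<in> S1.JC" "t = Omega s" by (rule can_kernel_Omega[OF t z])
  have zz: "\<zero>\<^bsub>S1.P.PC\<^esub> \<in> S1.JC"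
    using generate.one[of "add_monoid S1.P.PC"] by (simp add: S1.JC_def)
  have "S2.chiC s = L.Psi (S2.chiC \<zero>\<^bsub>S1.P.PC\<^esub>)" using Psi_can_Omega[OF s(1)] z s(2) by simp
  also have "\<dots> = S2.chiC \<zero>\<^bsub>S1.P.PC\<^esub>"
    by (simp add: add_map_zero[OF S1.P.VC.abelian_TT S2.Q.VC.abelian_TT S2.chiC_add_map]
        add_map_zero[OF S2.Q.VC.abelian_TT S2.Q.VC.abelian_TT L.Psi_add_map])
  finally have "s = \<zero>\<^bsub>S1.P.PC\<^esub>" by (rule chiC_inj[OF s(1) zz])
  then show ?thesis
    using s(2) add_map_zero[OF S1.P.VC.abelian_TT S1.P.PT.abelian_group_axioms Omega_add_map] by simp
qed

text \<open>A preimage of 1 \<otimes> c under the canonical map of \<open>Q2\<close> is lifted to P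
  \<otimes> P and multiplied by j from the left. The ambiguity of the lift disappears, because the
  image lies in \<open>S1.JC\<close>, where \<chi>2 decides equality.\<close>

lemma can_surj_JC:
  assumes j: "j \<in> S1.J" and c: "c \<in> carrier C"
  shows "\<exists>t\<in>carrier S1.P.PT. can_map K C P t = S1.P.VC.pu j c"
proof -
  have jc: "j \<in> carrier P" using j by (rule S1.J_closed)
  have "S2.Q.VC.pu \<one>\<^bsub>Q2\<^esub> c \<in> can_map K C Q2 ` carrier S2.Q.PT"
    using bij_betw_imp_surj_on[OF can2] c by simp
  then obtain z2 where z2: "z2 \<in> carrier S2.Q.PT" "can_map K C Q2 z2 = S2.Q.VC.pu \<one>\<^bsub>Q2\<^esub> c" by force
  obtain z where z: "z \<in> carrier S1.P.PT" "S2.chiPT z = z2" using S2.chiPT_surj[OF z2(1)] by blast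
  have cz: "can_map K C P z \<in> carrier S1.P.PC" by (rule add_map_closed[OF S1.P.can_add_map z(1)])
  have "can_map K C P (S1.P.lmul j z) = S1.P.VC.pu j c"
  proof (rule chiC_inj)
    show "can_map K C P (S1.P.lmul j z) \<in> S1.JC"
      unfolding S1.P.can_lmul[OF jc z(1)] by (rule S1.JC_left_act[OF j cz])
    show "S1.P.VC.pu j c \<in> S1.JC" by (rule S1.JC_pu[OF j c])
    show "S2.chiC (can_map K C P (S1.P.lmul j z)) = S2.chiC (S1.P.VC.pu j c)"
      using jc c by (simp add: S1.P.can_lmul z(1) S2.chiC_left_act cz S2.can_chiPT[OF z(1), symmetric] z(2) z2(2)
          S2.Q.left_act_pu S2.chi_simps S2.chiC_pu)
  qed
  then show ?thesis using add_map_closed[OF S1.P.lmul_add_map[OF jc] z(1)] by blast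
qed

lemma can_bij: "bij_betw (can_map K C P) (carrier S1.P.PT) (carrier S1.P.PC)"
  unfolding bij_betw_def
proof
  show "inj_on (can_map K C P) (carrier S1.P.PT)"
  proof (rule inj_onI)
    fix s t assume st: "s \<in> carrier S1.P.PT" "t \<in> carrier S1.P.PT" "can_map K C P s = can_map K C P t"
    have "can_map K C P (s \<ominus>\<^bsub>S1.P.PT\<^esub> t) = \<zero>\<^bsub>S1.P.PC\<^esub>"
      using st add_map_closed[OF S1.P.can_add_map st(2)]
      by (simp add: add_map_minus[OF S1.P.PT.abelian_group_axioms S1.P.VC.abelian_TT S1.P.can_add_map]
          S1.P.VC.TT.minus_self)
    then have "s \<ominus>\<^bsub>S1.P.PT\<^esub> t = \<zero>\<^bsub>S1.P.PT\<^esub>" using st by (intro can_inj_zero) simp_all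
    then show "s = t" by (rule S1.P.PT.minus_zeroD[OF st(1,2)])
  qed
  interpret h: abelian_group_hom S1.P.PT S1.P.PC "can_map K C P"
    by (rule add_map_hom[OF S1.P.PT.abelian_group_axioms S1.P.VC.abelian_TT S1.P.can_add_map])
  interpret gh: group_hom "add_monoid S1.P.PT" "add_monoid S1.P.PC" "can_map K C P"
    by (rule h.a_group_hom)
  have im: "subgroup (can_map K C P ` carrier S1.P.PT) (add_monoid S1.P.PC)"
    using gh.img_is_subgroup by simp
  have JC: "S1.JC \<subseteq> can_map K C P ` carrier S1.P.PT"
    unfolding S1.JC_def
    by (rule S1.P.VC.TT.add.generate_subgroup_incl[OF _ im]) (use can_surj_JC in force)
  show "can_map K C P ` carrier S1.P.PT = carrier S1.P.PC"
  proof (intro equalityI subsetI)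
    fix t assume t: "t \<in> carrier S1.P.PC"
    \<comment> \<open>A preimage found over \<open>Q1\<close> and lifted to P \<otimes> P has an
      image agreeing with \<open>t\<close> modulo J_1 \<otimes> C, and \<open>JC\<close> covers the
      difference.\<close>
    have "S1.chiC t \<in> can_map K C Q1 ` carrier S1.Q.PT"
      using bij_betw_imp_surj_on[OF can1] S1.chiC_closed[OF t] by simp
    then obtain z1 where z1: "z1 \<in> carrier S1.Q.PT" "can_map K C Q1 z1 = S1.chiC t" by force
    obtain z where z: "z \<in> carrier S1.P.PT" "S1.chiPT z = z1" using S1.chiPT_surj[OF z1(1)] by blast
    have cz: "can_map K C P z \<in> carrier S1.P.PC" by (rule add_map_closed[OF S1.P.can_add_map z(1)])
    have "S1.chiC (t \<ominus>\<^bsub>S1.P.PC\<^esub> can_map K C P z) = \<zero>\<^bsub>S1.Q.PC\<^esub>"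
      using z z1 S1.can_chiPT[OF z(1)] S1.chiC_closed[OF t] by (simp add: S1.chiC_minus t cz S1.Q.VC.TT.minus_self)
    then have "t \<ominus>\<^bsub>S1.P.PC\<^esub> can_map K C P z \<in> S1.JC"
      using t cz by (intro S1.chiC_kernel) simp_all
    then have "t \<ominus>\<^bsub>S1.P.PC\<^esub> can_map K C P z \<in> can_map K C P ` carrier S1.P.PT" using JC by blast
    then have "(t \<ominus>\<^bsub>S1.P.PC\<^esub> can_map K C P z) \<oplus>\<^bsub>S1.P.PC\<^esub> can_map K C P z \<in> can_map K C P ` carrier S1.P.PT"
      using subgroup.m_closed[OF im] z(1) by simp
    then show "t \<in> can_map K C P ` carrier S1.P.PT"
      using t cz by (simp add: a_minus_def S1.P.VC.TT.a_assoc S1.P.VC.TT.l_neg)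
  qed (auto simp: add_map_closed[OF S1.P.can_add_map])
qed

end

section \<open>Quotients of comodule algebras\<close>

text \<open>\<open>quot_alg\<close> defines its coaction by means of \<open>quot_module\<close>,
  before a coaction field exists. The tensor products read only carrier, addition and scalar action,
  on which the two records agree.\<close>

lemma tensor_cong:
  assumes "carrier V = carrier V'" "ring.add V = ring.add V'" "smult V = smult V'"
  shows "tensor K V W = tensor K V' W" "tensor_pure K V W = tensor_pure K V' W"
  using assms
  by (simp_all add: tensor_def bal_tensor_def bal_subgroup_def bal_rels_def tensor_pure_def bal_pure_def fun_eq_iff)

lemma quot_alg_simps:
  "carrier (quot_alg K C P I) = a_rcosets\<^bsub>P\<^esub> I"
  "monoid.mult (quot_alg K C P I) = rcoset_mult P I"
  "one (quot_alg K C P I) = I +>\<^bsub>P\<^esub> \<one>\<^bsub>P\<^esub>"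
  "ring.zero (quot_alg K C P I) = I"
  "ring.add (quot_alg K C P I) = set_add P"
  "smult (quot_alg K C P I) = (\<lambda>a Y. \<Union>x\<in>Y. I +>\<^bsub>P\<^esub> (a \<odot>\<^bsub>P\<^esub> x))"
  "coact (quot_alg K C P I) = (\<lambda>Y. the_elem
        ((\<lambda>p. tensor_map K (quot_alg K C P I) C (\<lambda>q. I +>\<^bsub>P\<^esub> q) (\<lambda>c. c) (coact P p)) ` Y))"
proof -
  have 1: "tensor K (quot_alg K C P I) C = tensor K (quot_module P I) C"
    "tensor_pure K (quot_alg K C P I) C = tensor_pure K (quot_module P I) C"
    by (rule tensor_cong; simp add: quot_alg_def quot_module_def FactRing_def ring.defs module.defs comod_alg.defs)+
  show "coact (quot_alg K C P I) = (\<lambda>Y. the_elem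
        ((\<lambda>p. tensor_map K (quot_alg K C P I) C (\<lambda>q. I +>\<^bsub>P\<^esub> q) (\<lambda>c. c) (coact P p)) ` Y))"
    unfolding tensor_map_def 1
    by (simp add: quot_alg_def tensor_map_def module.defs comod_alg.defs)
qed (simp_all add: quot_alg_def quot_module_def FactRing_def ring.defs module.defs comod_alg.defs)

lemma the_elem_const:
  assumes "x \<in> A" "\<And>y. y \<in> A \<Longrightarrow> f y = f x"
  shows "the_elem (f ` A) = f x"
proof -
  have "f ` A = {f x}" using assms by blast
  then show ?thesis by simp
qed

lemma (in abelian_subgroup) rcos_cases:
  assumes "x \<in> H +> p" obtains h where "h \<in> H" "x = h \<oplus> p"
  using assms by (auto simp: a_r_coset_def')

lemma (in abelian_subgroup) rcos_absorb:
  assumes "h \<in> H" "p \<in> carrier G" shows "H +> (h \<oplus> p) = H +> p"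
proof -
  have "h \<oplus> p \<in> H +> p" using assms(1) by (auto simp: a_r_coset_def')
  then show ?thesis using a_repr_independence'[OF _ assms(2)] by simp
qed

lemma (in abelian_subgroup) rcos_eq_self_iff: "p \<in> carrier G \<Longrightarrow> H +> p = H \<longleftrightarrow> p \<in> H"
  using a_rcos_self a_rcos_const by blast

text \<open>Cosets are compatible with scalars because \<open>I\<close> is a submodule, and with the
  coaction because \<open>I\<close> is a subcomodule, so that (\<chi> \<otimes> id) \<rho> kills
  it.\<close>

lemma quot_alg_surj:
  assumes P: "comodule_algebra K C P" and I: "ideal I P" and sub: "subcomodule K C P (coact P) I"
    and Q: "comodule_algebra K C (quot_alg K C P I)"
    and co: "(\<lambda>b. I +>\<^bsub>P\<^esub> b) ` coinvariants K C P = coinvariants K C (quot_alg K C P I)"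
  shows "comodule_algebra_surj K C P (quot_alg K C P I) (\<lambda>b. I +>\<^bsub>P\<^esub> b)"
proof -
  let ?Q = "quot_alg K C P I" and ?\<chi> = "\<lambda>b. I +>\<^bsub>P\<^esub> b"
  interpret P: comodule_algebra K C P by (rule P)
  interpret Q: comodule_algebra K C ?Q by (rule Q)
  interpret I: ideal I P by (rule I)
  have sm: "submodule I K P" using sub by (simp add: subcomodule_def)
  have lin: "?\<chi> \<in> linear_maps K P ?Q"
    unfolding linear_maps_def
  proof (intro CollectI conjI ballI Pi_I)
    show "?\<chi> p \<in> carrier ?Q" if "p \<in> carrier P" for p
      using that by (simp add: quot_alg_simps P.A.a_rcosetsI I.a_subset)
    show "?\<chi> (p \<oplus>\<^bsub>P\<^esub> q) = ?\<chi> p \<oplus>\<^bsub>?Q\<^esub> ?\<chi> q" if "p \<in> carrier P" "q \<in> carrier P" for p q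
      using that by (simp add: quot_alg_simps I.a_rcos_sum)
    fix a p assume a: "a \<in> carrier K" and p: "p \<in> carrier P"
    have "?\<chi> (a \<odot>\<^bsub>P\<^esub> x) = ?\<chi> (a \<odot>\<^bsub>P\<^esub> p)" if x: "x \<in> ?\<chi> p" for x
    proof -
      obtain h where h: "h \<in> I" "x = h \<oplus>\<^bsub>P\<^esub> p" using x by (rule I.rcos_cases)
      have "a \<odot>\<^bsub>P\<^esub> h \<in> I" using sm a h(1) by (rule P.A.submoduleE(4))
      then show ?thesis using a p h by (simp add: P.A.smult_r_distr I.rcos_absorb)
    qed
    then have "(\<Union>x\<in>?\<chi> p. ?\<chi> (a \<odot>\<^bsub>P\<^esub> x)) = ?\<chi> (a \<odot>\<^bsub>P\<^esub> p)"
      using I.a_rcos_self[OF p] by blast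
    then show "?\<chi> (a \<odot>\<^bsub>P\<^esub> p) = a \<odot>\<^bsub>?Q\<^esub> ?\<chi> p" by (simp add: quot_alg_simps)
  qed
  have b: "bilin K P C Q.PC (\<lambda>p c. Q.VC.pu (?\<chi> p) c)"
    by (rule bilin_comp[OF Q.VC.bilin_pu lin linear_maps_id])
  define t where "t = tensor_map K ?Q C ?\<chi> (\<lambda>c. c)"
  have t: "add_map P.PC Q.PC t"
    unfolding t_def tensor_map_def by (rule P.VC.lift_add_map[OF Q.VC.abelian_TT b])
  have t_pu: "t (P.VC.pu p c) = Q.VC.pu (?\<chi> p) c" if "p \<in> carrier P" "c \<in> carrier C" for p c
    unfolding t_def tensor_map_def by (rule P.VC.lift_pu[OF Q.VC.abelian_TT b that])
  have gens: "{P.VC.pu h c | h c. h \<in> I \<and> c \<in> carrier C} \<subseteq> carrier P.PC" by auto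
  have t_I: "t (coact P h) = \<zero>\<^bsub>Q.PC\<^esub>" if h: "h \<in> I" for h
  proof (rule gen_zero[OF P.VC.abelian_TT Q.VC.abelian_TT t gens])
    show "coact P h \<in> generate (add_monoid P.PC) {P.VC.pu h c | h c. h \<in> I \<and> c \<in> carrier C}"
      using sub h unfolding subcomodule_def by blast
    fix z assume "z \<in> {P.VC.pu h c | h c. h \<in> I \<and> c \<in> carrier C}"
    then obtain h c where z: "z = P.VC.pu h c" "h \<in> I" "c \<in> carrier C" by blast
    then have "?\<chi> h = \<zero>\<^bsub>?Q\<^esub>" by (simp add: quot_alg_simps I.a_rcos_const)
    then show "t z = \<zero>\<^bsub>Q.PC\<^esub>"
      using z Q.VC.b.pure_zero_left[of c] by (simp add: t_pu Q.VC.pu_eq Q.VC.tensor_simps)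
  qed
  \<comment> \<open>The image set defining the coaction on a coset is a singleton: representatives
    differ by an element h of \<open>I\<close>, and \<open>t_I\<close> removes the contribution of
    \<rho>(h).\<close>
  have coact: "coact ?Q (?\<chi> p) = t (coact P p)" if p: "p \<in> carrier P" for p
  proof -
    have "t (coact P x) = t (coact P p)" if x: "x \<in> ?\<chi> p" for x
    proof -
      obtain h where h: "h \<in> I" "x = h \<oplus>\<^bsub>P\<^esub> p" using x by (rule I.rcos_cases)
      then show ?thesis
        using p t_I[OF h(1)] by (simp add: P.coact_add add_map_add[OF t] P.coact_closed add_map_closed[OF t])
    qed
    then have "the_elem ((\<lambda>p. t (coact P p)) ` ?\<chi> p) = t (coact P p)"
      by (rule the_elem_const[OF I.a_rcos_self[OF p]])
    then show ?thesis by (simp add: quot_alg_simps(7) t_def)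
  qed
  show ?thesis
  proof (intro comodule_algebra_surj.intro P Q comodule_algebra_surj_axioms.intro co)
    show "colinear K C P (coact P) ?Q (coact ?Q) ?\<chi>"
      unfolding colinear_def using lin coact by (simp add: t_def)
    show "?\<chi> ` carrier P = carrier ?Q"
      by (auto simp: quot_alg_simps A_RCOSETS_def')
    show "?\<chi> (p \<otimes>\<^bsub>P\<^esub> q) = ?\<chi> p \<otimes>\<^bsub>?Q\<^esub> ?\<chi> q" if "p \<in> carrier P" "q \<in> carrier P" for p q
      using that by (simp add: quot_alg_simps I.rcoset_mult_add)
    show "?\<chi> \<one>\<^bsub>P\<^esub> = \<one>\<^bsub>?Q\<^esub>" by (simp add: quot_alg_simps)
  qed
qed

lemma quot_alg_ker:
  assumes "comodule_algebra_surj K C P (quot_alg K C P I) (\<lambda>b. I +>\<^bsub>P\<^esub> b)" "ideal I P"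
  shows "comodule_algebra_surj.J P (quot_alg K C P I) (\<lambda>b. I +>\<^bsub>P\<^esub> b) = I"
proof -
  interpret I: ideal I P by fact
  show ?thesis
    unfolding comodule_algebra_surj.J_def[OF assms(1)]
    using I.rcos_eq_self_iff I.a_subset by (auto simp: quot_alg_simps)
qed

text \<open>A coset J_i + b with b in B is in the kernel iff b lies in (B \<inter> J_i) + (B
  \<inter> J_j); modulo J_i the first summand drops out.\<close>

lemma ker_pi_eq:
  assumes P: "abelian_group P" and B: "additive_subgroup B P"
    and Ji: "additive_subgroup Ji P" and Jj: "additive_subgroup Jj P"
  shows "ker_pi P B Ji Jj = (\<lambda>b. Ji +>\<^bsub>P\<^esub> b) ` (B \<inter> Jj)"
proof -
  interpret P: abelian_group P by fact
  interpret B: additive_subgroup B P by fact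
  interpret Ji: abelian_subgroup Ji P by (rule abelian_subgroupI3[OF Ji P])
  interpret Jj: abelian_subgroup Jj P by (rule abelian_subgroupI3[OF Jj P])
  define N where "N = (B \<inter> Ji) <+>\<^bsub>P\<^esub> (B \<inter> Jj)"
  have BJ: "additive_subgroup (B \<inter> J) P" if "additive_subgroup J P" for J
    using that B P.add.subgroups_Inter_pair[of B J] by (simp add: additive_subgroup_def)
  have "additive_subgroup N P"
    unfolding N_def by (intro P.add_additive_subgroups BJ Ji Jj)
  then interpret N: abelian_subgroup N P by (rule abelian_subgroupI3[OF _ P])
  have N_mem: "x \<in> N \<longleftrightarrow> (\<exists>i\<in>B \<inter> Ji. \<exists>j\<in>B \<inter> Jj. x = i \<oplus>\<^bsub>P\<^esub> j)" for x
    by (auto simp: N_def set_add_def')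
  \<comment> \<open>(J_i + b) \<inter> B is the coset of B \<inter> J_i through b, and B \<inter>
    J_i is contained in \<open>N\<close>; so all its elements have the same class modulo
    \<open>N\<close>.\<close>
  have proj: "coset_proj (P\<lparr>carrier := B\<rparr>) N ((Ji +>\<^bsub>P\<^esub> b) \<inter> B) = N +>\<^bsub>P\<^esub> b" if b: "b \<in> B" for b
  proof -
    have bc: "b \<in> carrier P" using b B.a_subset by blast
    have "the_elem ((\<lambda>x. N +>\<^bsub>P\<^esub> x) ` ((Ji +>\<^bsub>P\<^esub> b) \<inter> B)) = N +>\<^bsub>P\<^esub> b"
    proof (rule the_elem_const)
      show "b \<in> (Ji +>\<^bsub>P\<^esub> b) \<inter> B" using b Ji.a_rcos_self[OF bc] by blast
      fix y assume y: "y \<in> (Ji +>\<^bsub>P\<^esub> b) \<inter> B"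
      then obtain i where i: "i \<in> Ji" "y = i \<oplus>\<^bsub>P\<^esub> b" by (blast elim: Ji.rcos_cases)
      have ic: "i \<in> carrier P" using i(1) by (rule Ji.a_Hcarr)
      have "i = y \<oplus>\<^bsub>P\<^esub> \<ominus>\<^bsub>P\<^esub> b" using i(2) ic bc by (simp add: P.a_assoc P.r_neg)
      also have "\<dots> \<in> B" using y b by (intro B.a_closed B.a_inv_closed) auto
      finally have iB: "i \<in> B \<inter> Ji" using i(1) by blast
      have "i = i \<oplus>\<^bsub>P\<^esub> \<zero>\<^bsub>P\<^esub>" using ic by simp
      then have "i \<in> N" unfolding N_mem using iB B.zero_closed Jj.zero_closed by blast
      then show "N +>\<^bsub>P\<^esub> y = N +>\<^bsub>P\<^esub> b" unfolding i(2) by (rule N.rcos_absorb[OF _ bc])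
    qed
    then show ?thesis by (simp add: coset_proj_def a_r_coset_def')
  qed
  have "ker_pi P B Ji Jj = {Y \<in> (\<lambda>b. Ji +>\<^bsub>P\<^esub> b) ` B. coset_proj (P\<lparr>carrier := B\<rparr>) N (Y \<inter> B) = N}"
    by (simp add: ker_pi_def N_def[symmetric] Let_def a_kernel_def' FactRing_def)
  also have "\<dots> = (\<lambda>b. Ji +>\<^bsub>P\<^esub> b) ` {b \<in> B. b \<in> N}"
    using proj N.rcos_eq_self_iff B.a_subset by auto
  also have "\<dots> = (\<lambda>b. Ji +>\<^bsub>P\<^esub> b) ` (B \<inter> Jj)"
  proof (intro equalityI subsetI)
    fix Y assume "Y \<in> (\<lambda>b. Ji +>\<^bsub>P\<^esub> b) ` {b \<in> B. b \<in> N}"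
    then obtain i j where ij: "Y = Ji +>\<^bsub>P\<^esub> (i \<oplus>\<^bsub>P\<^esub> j)" "i \<in> Ji" "j \<in> B \<inter> Jj" by (auto simp: N_mem)
    then have "Y = Ji +>\<^bsub>P\<^esub> j" using Jj.a_Hcarr by (simp add: Ji.rcos_absorb)
    then show "Y \<in> (\<lambda>b. Ji +>\<^bsub>P\<^esub> b) ` (B \<inter> Jj)" using ij(3) by blast
  next
    fix Y assume "Y \<in> (\<lambda>b. Ji +>\<^bsub>P\<^esub> b) ` (B \<inter> Jj)"
    then obtain j where j: "Y = Ji +>\<^bsub>P\<^esub> j" "j \<in> B" "j \<in> Jj" by blast
    have "j = \<zero>\<^bsub>P\<^esub> \<oplus>\<^bsub>P\<^esub> j" using j(3) Jj.a_Hcarr by simp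
    then have "j \<in> N" unfolding N_mem using j B.zero_closed Ji.zero_closed by blast
    then show "Y \<in> (\<lambda>b. Ji +>\<^bsub>P\<^esub> b) ` {b \<in> B. b \<in> N}" using j by blast
  qed
  finally show ?thesis .
qed

theorem proposition6p9:
  fixes K :: "('k, 'r) ring_scheme"
    and C :: "('k, 'c, 's) coalg_scheme"
    and P :: "('k, 'p, 'c, 't) comod_alg_scheme"
    and B :: "'p set"
    and J :: "nat \<Rightarrow> 'p set"
    and \<gamma> :: "nat \<Rightarrow> 'c \<Rightarrow> 'p set"
  assumes "field K"
    and "\<one>\<^bsub>K\<^esub> \<oplus>\<^bsub>K\<^esub> \<one>\<^bsub>K\<^esub> \<noteq> \<zero>\<^bsub>K\<^esub>"
    and "\<one>\<^bsub>K\<^esub> \<oplus>\<^bsub>K\<^esub> \<one>\<^bsub>K\<^esub> \<oplus>\<^bsub>K\<^esub> \<one>\<^bsub>K\<^esub> \<noteq> \<zero>\<^bsub>K\<^esub>"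
    and "coalgebra K C"
    and "regular_locally_cleft K C P B {1, 2} J \<gamma>"
    and "subspace_prod (quot_alg K C P (J 2)) (\<gamma> 2 ` carrier C) (ker_pi P B (J 2) (J 1)) =
         subspace_prod (quot_alg K C P (J 2)) (ker_pi P B (J 2) (J 1)) (\<gamma> 2 ` carrier C)"
  shows "coalgebra_galois K C P B"
proof -
  define Q where "Q i = quot_alg K C P (J i)" for i
  define \<chi> where "\<chi> i = (\<lambda>b. J i +>\<^bsub>P\<^esub> b)" for i
  have lc: "locally_cleft K C P B {1, 2} J \<gamma>"
    using assms(5) by (simp add: regular_locally_cleft_def)
  have lg: "locally_coalgebra_galois K C P B {1, 2} J"
    using lc by (simp add: locally_cleft_def)
  have P: "comodule_algebra K C P" and B: "B = coinvariants K C P"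
    using lg by (simp_all add: locally_coalgebra_galois_def)
  have I: "ideal (J i) P" and sub: "subcomodule K C P (coact P) (J i)"
    and co: "\<chi> i ` B = coinvariants K C (Q i)"
    and gal: "coalgebra_galois K C (Q i) (coinvariants K C (Q i))"
    and clv: "cleaving_map K C (Q i) (\<gamma> i)" if "i \<in> {1, 2}" for i
    using lc lg that
    by (auto simp: locally_cleft_def locally_coalgebra_galois_def complete_cover_def cover_def Q_def \<chi>_def)
  have disj: "J 1 \<inter> J 2 = {\<zero>\<^bsub>P\<^esub>}"
  proof -
    have "carrier P \<inter> (\<Inter>i\<in>{1, 2}. J i) = {\<zero>\<^bsub>P\<^esub>}"
      using lg by (simp only: locally_coalgebra_galois_def complete_cover_def cover_def)
    moreover have "J 1 \<subseteq> carrier P"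
      using I[of 1] by (auto intro: additive_subgroup.a_Hcarr[OF ideal.axioms(1)])
    ultimately show ?thesis by auto
  qed
  have can: "bij_betw (can_map K C (Q i)) (carrier (tensor_over (Q i) (coinvariants K C (Q i))))
      (carrier (tensor K (Q i) C))" and QA: "comodule_algebra K C (Q i)" if "i \<in> {1, 2}" for i
    using gal[OF that] by (simp_all add: coalgebra_galois_def)
  interpret P: comodule_algebra K C P by (rule P)
  have surj: "comodule_algebra_surj K C P (Q i) (\<chi> i)" if "i \<in> {1, 2}" for i
    unfolding Q_def \<chi>_def
    by (rule quot_alg_surj[OF P I[OF that] sub[OF that] QA[OF that, unfolded Q_def]])
       (use co[OF that] B in \<open>simp add: Q_def \<chi>_def\<close>)
  have ker: "comodule_algebra_surj.J P (Q i) (\<chi> i) = J i" if "i \<in> {1, 2}" for i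
    using quot_alg_ker[OF surj[OF that, unfolded Q_def \<chi>_def] I[OF that]] by (simp add: Q_def \<chi>_def)
  \<comment> \<open>An arbitrary convolution inverse is fixed; the argument rests on its defining
    identities.\<close>
  obtain g where g: "is_conv_inverse K C (Q 2) (\<gamma> 2) g"
    using clv[of 2] by (auto simp: cleaving_map_def)
  have cg: "cleft_galois K C (Q 2) (\<gamma> 2) g"
    by (intro cleft_galois.intro cleft_comodule_algebra.intro cleft_comodule_algebra_axioms.intro
        cleft_galois_axioms.intro QA g bij_betw_imp_inj_on[OF can])
      (use clv[of 2] in \<open>auto simp: cleaving_map_def\<close>)
  have sm: "submodule (J i) K P" if "i \<in> {1, 2}" for i
    using sub[OF that] by (simp add: subcomodule_def)
  \<comment> \<open>The field hypothesis enters here, through a complement of J_1 containing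
    J_2.\<close>
  obtain r where r: "r \<in> linear_maps K P P" "\<And>x. x \<in> carrier P \<Longrightarrow> r x \<in> J 1"
    "\<And>x. x \<in> J 1 \<Longrightarrow> r x = x" "\<And>x. x \<in> J 2 \<Longrightarrow> r x = \<zero>\<^bsub>P\<^esub>"
    using submodule_projection[OF assms(1) _ sm[of 1] sm[of 2] disj] P.A.module_axioms by auto
  interpret S1: comodule_algebra_surj K C P "Q 1" "\<chi> 1" by (rule surj) simp
  interpret S2: comodule_algebra_surj K C P "Q 2" "\<chi> 2" by (rule surj) simp
  interpret L: cleft_galois K C "Q 2" "\<gamma> 2" g by (rule cg)
  have kerpi: "ker_pi P B (J 2) (J 1) = \<chi> 2 ` (B \<inter> J 1)"
    unfolding \<chi>_def
    by (rule ker_pi_eq[OF P.A.abelian_group_axioms])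
      (use I[of 1] I[of 2] P.coinv_subgroup in \<open>auto simp: B additive_subgroup_def dest!: ideal.axioms(1)\<close>)
  \<comment> \<open>\<chi>2(n) \<gamma>(c) lies in ker(\<pi>) \<gamma>(C); the hypothesis moves it
    into \<gamma>(C) ker(\<pi>), whose generators have the factor from \<chi>2(N) on the
    right.\<close>
  have comm: "\<chi> 2 n \<otimes>\<^bsub>Q 2\<^esub> \<gamma> 2 c \<in> generate (add_monoid (Q 2))
      {q \<otimes>\<^bsub>Q 2\<^esub> \<chi> 2 n' | q n'. q \<in> carrier (Q 2) \<and> n' \<in> coinvariants K C P \<and> n' \<in> J 1}" (is "_ \<in> generate _ ?Z")
    if n: "n \<in> coinvariants K C P" "n \<in> J 1" and c: "c \<in> carrier C" for n c
  proof -
    have "\<chi> 2 n \<otimes>\<^bsub>Q 2\<^esub> \<gamma> 2 c \<in> subspace_prod (Q 2) (ker_pi P B (J 2) (J 1)) (\<gamma> 2 ` carrier C)"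
      unfolding subspace_prod_def kerpi using n c by (intro generate.incl) (auto simp: B)
    also have "\<dots> = subspace_prod (Q 2) (\<gamma> 2 ` carrier C) (\<chi> 2 ` (B \<inter> J 1))"
      unfolding kerpi[symmetric] Q_def by (rule assms(6)[symmetric])
    also have "\<dots> \<subseteq> generate (add_monoid (Q 2)) ?Z"
      unfolding subspace_prod_def
    proof (rule S2.Q.A.gen_subsetI)
      show "?Z \<subseteq> carrier (Q 2)" by (auto simp: S2.chi_simps P.coinv_closed)
      show "{u \<otimes>\<^bsub>Q 2\<^esub> v |u v. u \<in> \<gamma> 2 ` carrier C \<and> v \<in> \<chi> 2 ` (B \<inter> J 1)} \<subseteq> generate (add_monoid (Q 2)) ?Z"
      proof
        fix z assume "z \<in> {u \<otimes>\<^bsub>Q 2\<^esub> v |u v. u \<in> \<gamma> 2 ` carrier C \<and> v \<in> \<chi> 2 ` (B \<inter> J 1)}"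
        then obtain c n where "z = \<gamma> 2 c \<otimes>\<^bsub>Q 2\<^esub> \<chi> 2 n" "c \<in> carrier C" "n \<in> B" "n \<in> J 1" by blast
        then have "z \<in> ?Z" using L.gam_simps(1) B by blast
        then show "z \<in> generate (add_monoid (Q 2)) ?Z" by (rule S2.Q.A.gen_incl)
      qed
    qed
    finally show ?thesis .
  qed
  have k1: "S1.J = J 1" and k2: "S2.J = J 2" using ker[of 1] ker[of 2] by simp_all
  interpret G: glued_extension K C P "Q 1" "Q 2" "\<chi> 1" "\<chi> 2" "\<gamma> 2" g r
  proof (unfold_locales, unfold k1 k2)
    show "J 1 \<inter> J 2 = {\<zero>\<^bsub>P\<^esub>}" by (rule disj)
    show "coact P j \<in> S1.JC" if "j \<in> J 1" for j
      using sub[of 1] that unfolding S1.JC_def k1 subcomodule_def by auto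
    show "bij_betw (can_map K C (Q 1)) (carrier (tensor_over (Q 1) (coinvariants K C (Q 1)))) (carrier (tensor K (Q 1) C))"
      by (rule can) simp
    show "bij_betw (can_map K C (Q 2)) (carrier (tensor_over (Q 2) (coinvariants K C (Q 2)))) (carrier (tensor K (Q 2) C))"
      by (rule can) simp
  qed (fact r comm)+
  show ?thesis
    unfolding coalgebra_galois_def using P B G.can_bij by simp
qed

end
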